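(* For each Borel probability measure $\kappa$ on $\mathbb R^*_+$ there is a Poisson flow $\widetilde T$ (the Poisson suspension of a measure preserving flow $T=(T_t)_{t\in\mathbb R}$ on an infinite $\sigma$-finite standard measure space) such that $\widetilde T$ is weakly mixing and $I_{\mathrm{Po}}(\widetilde T)=H_{\mathbb R^*_+}(\kappa)$.
   Context: $\mathbb R^*$ is the multiplicative group of nonzero reals and $\mathbb R^*_+$ is its subgroup of positive reals. Group of quasi-invariance: for a probability measure $\kappa$ on $\mathbb R^*_+$ and $h\in\mathbb R^*_+$, let $\kappa_h$ be the image of $\kappa$ under $s\mapsto hs$; then $H_{\mathbb R^*_+}(\kappa)=\{h\in\mathbb R^*_+\mid \kappa_h\sim\kappa\}$, where $\sim$ is mutual absolute continuity. Flows and self-similarities: a measure preserving flow $T=(T_t)_{t\in\mathbb R}$ on a $\sigma$-finite standard measure space $(X,\mu)$ is a measurable action of $\mathbb R$ by $\mu$-preserving transformations. For $s\in\mathbb R^*$, $T\circ s:=(T_{st})_{t\in\mathbb R}$. Put $I(T)=\{s\in\mathbb R^*\mid T\circ s\text{ is isomorphic to }T\}$, where $T\circ s$ isomorphic to $T$ means that there is an invertible $\mu$-preserving transformation $Q$ of $X$ (modulo null sets) with $Q^{-1}T_tQ=T_{st}$ almost everywhere for all $t\in\mathbb R$. The same definition is used for finite and infinite measure. Poisson suspension: let $(X,\mu)$ be a standard Borel space with an infinite $\sigma$-finite measure. Let $\widetilde X$ be the space of measures $\omega$ on $X$ that arise as realizations of point processes (countable sums of Dirac masses), with the $\sigma$-algebra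 generated by the maps $\omega\mapsto\omega(A)$, $A\subset X$ measurable with $\mu(A)<\infty$. Let $\widetilde\mu$ be the law of the Poisson point process with intensity $\mu$: the probability measure on $\widetilde X$ for which $\widetilde\mu(\{\omega\mid\omega(A)=j\})=e^{-\mu(A)}\mu(A)^j/j!$ for each $A$ with $\mu(A)<\infty$ and each integer $j\ge0$, and for which $\omega\mapsto\omega(A_1),\dots,\omega\mapsto\omega(A_n)$ are independent whenever $A_1,\dots,A_n$ are pairwise disjoint sets of finite measure. A $\mu$-preserving flow $T=(T_t)_{t\in\mathbb R}$ induces the $\widetilde\mu$-preserving flow $\widetilde T=(\widetilde T_t)_{t\in\mathbb R}$, $\widetilde T_t\omega=\omega\circ T_t^{-1}$, called the Poisson suspension of $T$ (a Poisson flow). Poissonian self-similarities: if $\widetilde T$ is the Poisson suspension of a measure preserving flow $T$, then $I_{\mathrm{Po}}(\widetilde T):=I(T)$; it is a subgroup of $I(\widetilde T)$. *)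

theory Defs
  imports "HOL-Probability.Probability"
begin

text \<open>The topology below is an abstract one on \<^term>\<open>space M\<close>; it need not come from a type class.\<close>

definition standard_borel :: "'a measure \<Rightarrow> bool" where
  "standard_borel M \<longleftrightarrow>
     (\<exists>S. completely_metrizable_space S \<and> second_countable S \<and> topspace S = space M \<and>
          sets M = sigma_sets (space M) {U. openin S U})"

definition quasi_invariance_group :: "real measure \<Rightarrow> real set" where
  "quasi_invariance_group \<kappa> =
     {h. 0 < h \<and> absolutely_continuous \<kappa> (distr \<kappa> \<kappa> (\<lambda>s. h * s)) \<and>
               absolutely_continuous (distr \<kappa> \<kappa> (\<lambda>s. h * s)) \<kappa>}"

definition measure_preserving_flow :: "'a measure \<Rightarrow> (real \<Rightarrow> 'a \<Rightarrow> 'a) \<Rightarrow> bool" where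
  "measure_preserving_flow M T \<longleftrightarrow>
     (\<lambda>(t, x). T t x) \<in> borel \<Otimes>\<^sub>M M \<rightarrow>\<^sub>M M \<and>
     (\<forall>x\<in>space M. T 0 x = x) \<and>
     (\<forall>s t. \<forall>x\<in>space M. T (s + t) x = T s (T t x)) \<and>
     (\<forall>t. distr M M (T t) = M)"

text \<open>A transformation invertible modulo null sets is given by a pair of everywhere defined
  measurable maps that are inverse to each other almost everywhere.\<close>

definition invertible_mod_null :: "'a measure \<Rightarrow> ('a \<Rightarrow> 'a) \<Rightarrow> ('a \<Rightarrow> 'a) \<Rightarrow> bool" where
  "invertible_mod_null M Q Q' \<longleftrightarrow>
     Q \<in> M \<rightarrow>\<^sub>M M \<and> Q' \<in> M \<rightarrow>\<^sub>M M \<and>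
     (AE x in M. Q' (Q x) = x) \<and> (AE x in M. Q (Q' x) = x)"

definition flow_isomorphic ::
    "'a measure \<Rightarrow> (real \<Rightarrow> 'a \<Rightarrow> 'a) \<Rightarrow> (real \<Rightarrow> 'a \<Rightarrow> 'a) \<Rightarrow> bool" where
  "flow_isomorphic M S T \<longleftrightarrow>
     (\<exists>Q Q'. invertible_mod_null M Q Q' \<and> distr M M Q = M \<and> distr M M Q' = M \<and>
             (\<forall>t. AE x in M. Q' (T t (Q x)) = S t x))"

definition self_similarities :: "'a measure \<Rightarrow> (real \<Rightarrow> 'a \<Rightarrow> 'a) \<Rightarrow> real set" where
  "self_similarities M T = {s. s \<noteq> 0 \<and> flow_isomorphic M (\<lambda>t. T (s * t)) T}"

text \<open>Each countable sum of Dirac masses is the image of the counting measure on some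
  \<open>I \<subseteq> \<nat>\<close> under \<open>i \<mapsto> x i\<close>; repeated points are allowed.\<close>

definition point_configurations :: "'a measure \<Rightarrow> 'a measure set" where
  "point_configurations M =
     {distr (count_space I) M x | (I :: nat set) x. x \<in> I \<rightarrow> space M}"

definition configuration_space :: "'a measure \<Rightarrow> 'a measure measure" where
  "configuration_space M =
     sigma (point_configurations M)
       {(\<lambda>\<omega>. emeasure \<omega> A) -` B \<inter> point_configurations M | A B.
          A \<in> sets M \<and> emeasure M A < \<infinity> \<and> B \<in> sets borel}"

text \<open>\<open>poisson_law M P\<close>: \<open>P\<close> is the law of the Poisson point process with intensity \<open>M\<close>
  (for \<open>\<sigma>\<close>-finite \<open>M\<close>, these conditions determine \<open>P\<close>).\<close>

definition poisson_law :: "'a measure \<Rightarrow> 'a measure measure \<Rightarrow> bool" where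
  "poisson_law M P \<longleftrightarrow>
     prob_space P \<and> space P = point_configurations M \<and> sets P = sets (configuration_space M) \<and>
     (\<forall>A j. A \<in> sets M \<and> emeasure M A < \<infinity> \<longrightarrow>
        measure P {\<omega> \<in> space P. emeasure \<omega> A = of_nat j}
          = exp (- measure M A) * measure M A ^ j / fact j) \<and>
     (\<forall>(n :: nat) A. (\<forall>i<n. A i \<in> sets M \<and> emeasure M (A i) < \<infinity>) \<and> disjoint_family_on A {..<n} \<longrightarrow>
        prob_space.indep_vars P (\<lambda>_. borel) (\<lambda>i \<omega>. emeasure \<omega> (A i)) {..<n})"

definition suspension :: "'a measure \<Rightarrow> (real \<Rightarrow> 'a \<Rightarrow> 'a) \<Rightarrow> real \<Rightarrow> 'a measure \<Rightarrow> 'a measure" where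
  "suspension M T t \<omega> = distr \<omega> M (T t)"

text \<open>The Poissonian self-similarities of a suspension are by definition those of the base flow,
  so the base flow is the argument.\<close>

definition poissonian_self_similarities :: "'a measure \<Rightarrow> (real \<Rightarrow> 'a \<Rightarrow> 'a) \<Rightarrow> real set" where
  "poissonian_self_similarities M T = self_similarities M T"

text \<open>Invariance of a set is understood modulo null sets, separately for each time.\<close>

definition ergodic_flow :: "'a measure \<Rightarrow> (real \<Rightarrow> 'a \<Rightarrow> 'a) \<Rightarrow> bool" where
  "ergodic_flow N S \<longleftrightarrow>
     (\<forall>A\<in>sets N. (\<forall>t. AE x in N. S t x \<in> A \<longleftrightarrow> x \<in> A) \<longrightarrow>
        (AE x in N. x \<in> A) \<or> (AE x in N. x \<notin> A))"

text \<open>Weak mixing of a flow on a probability space: the Cartesian square is ergodic.\<close>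

definition weakly_mixing_flow :: "'a measure \<Rightarrow> (real \<Rightarrow> 'a \<Rightarrow> 'a) \<Rightarrow> bool" where
  "weakly_mixing_flow N S \<longleftrightarrow> ergodic_flow (N \<Otimes>\<^sub>M N) (\<lambda>t (x, y). (S t x, S t y))"

end

theory Submission
  imports Defs
begin

text \<open>
  Let \<open>S\<close> be a flow on an infinite measure space that sits on a product of circles of lengths
  \<open>q\<^sub>n\<close>, acting by simultaneous rotation, with the infinite product measure restricted with respect
  to the sets \<open>A\<^sub>n = {0, c\<^sub>n, 3 c\<^sub>n} + [0, l\<^sub>n)\<close>, where \<open>l\<^sub>n\<close>, \<open>c\<^sub>n\<close>, \<open>q\<^sub>n\<close> grow very fast and \<open>c\<^sub>n\<close> is
  a multiple of all earlier \<open>q\<^sub>m\<close>.  Every set \<open>A\<close> of positive measure contains triples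
  \<open>x, S\<^sub>u x, S\<^sub>3\<^sub>u x\<close> with \<open>u\<close> close to \<open>c\<^sub>n\<close>, for all large \<open>n\<close>, whereas on a
  suitable exhausting sequence of sets such triples occur only for \<open>u\<close> close to some \<open>c\<^sub>m\<close>, so for
  \<open>u > 0\<close>.  Hence the time scale of \<open>S\<close>, with its sign, is an invariant of isomorphism.

  Let \<open>T\<close> act on pairs of a label \<open>s\<close>, distributed according to \<open>\<kappa>\<close>, and a point \<open>x\<close> by
  \<open>T\<^sub>t (s, x) = (s, S\<^sub>s\<^sub>t x)\<close>.  An isomorphism of \<open>T \<circ> h\<close> with \<open>T\<close> must multiply
  labels by \<open>h\<close>, so it exists only if \<open>h\<close> is positive and \<open>\<kappa>\<close> is quasi-invariant under \<open>h\<close>.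
  Conversely a quasi-invariance gives an isomorphism, because an additional Lebesgue coordinate on which \<open>T\<close>
  does nothing can be rescaled to absorb the density.

  There are times \<open>t\<^sub>n\<close> with \<open>\<mu> (A \<inter> T\<^sub>t\<^sub>n\<^sup>-\<^sup>1 B) \<longlonglongrightarrow> 0\<close> for all \<open>A\<close>, \<open>B\<close> of
  finite measure.  The Laplace functional of the Poisson law turns this into mixing of the suspension along
  \<open>t\<^sub>n\<close>, which gives weak mixing.
\<close>

section \<open>Laplace functionals and configuration spaces\<close>

text \<open>Mixing concerns counts on A and on a translate of B, which may overlap, whereas the
  Poisson law is prescribed by single counts and by independence over disjoint sets. Laplace
  functionals of finite lists of arbitrary sets avoid cutting into disjoint pieces: the covariance
  of two of them is at most the measure of the overlap, and this one estimate yields both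
  independence and mixing.

  The obstacle for the flow is that an isomorphism intertwines only almost everywhere for each fixed
  time, while the time that moves a point by \<open>gap n\<close> depends on its label. Fubini gives
  the relation at almost all times, and the return times become \<open>gap n + e n\<close> with
  small generic e n > 0; the recurrence lemma has to tolerate them.

  \<open>ell n\<close> and \<open>gap n\<close> are powers of 4 whose exponents are the squares of
  the even and of the odd numbers. Differences of consecutive squares grow, so the scales separate
  by unbounded factors, and a bounded rescaling takes a large gap close to a gap only if its factor
  is close to 1. Powers of 4 also make \<open>gap n\<close> a multiple of the earlier circle
  lengths.\<close>

definition lexp :: "ennreal \<Rightarrow> real" where
  "lexp x = (if x = \<top> then 0 else exp (- enn2real x))"

lemma lexp_nonneg [simp]: "0 \<le> lexp x"
  and lexp_le_1 [simp]: "lexp x \<le> 1"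
  by (auto simp: lexp_def)

lemma lexp_0 [simp]: "lexp 0 = 1"
  by (simp add: lexp_def)

lemma lexp_of_nat [simp]: "lexp (of_nat j) = exp (- real j)"
  by (simp add: lexp_def flip: ennreal_of_nat_eq_real_of_nat)

lemma lexp_top [simp]: "lexp \<top> = 0"
  by (simp add: lexp_def)

text \<open>The value 0 chosen at infinity differs from every exp (-j), so an infinite count, which
  a configuration is allowed to have, is never confused with a finite one.\<close>

lemma lexp_eq_exp_of_nat_iff: "lexp x = exp (- real j) \<longleftrightarrow> x = of_nat j"
proof
  assume "lexp x = exp (- real j)"
  then have "x \<noteq> \<top>" "enn2real x = real j" by (auto simp: lexp_def split: if_splits)
  then show "x = of_nat j"
    by (metis ennreal_enn2real_if ennreal_of_nat_eq_real_of_nat)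
qed simp

lemma measurable_lexp [measurable]: "lexp \<in> borel_measurable borel"
  unfolding lexp_def by measurable

lemma lexp_add: "lexp (x + y) = lexp x * lexp y"
proof (cases "x = \<top> \<or> y = \<top>")
  case False
  then show ?thesis by (simp add: lexp_def enn2real_plus less_top exp_add[symmetric])
qed auto

section \<open>Approximating indicators of count events by products of exponentials\<close>

lemma prod_list_nonneg_le_1:
  fixes f :: "'b \<Rightarrow> real"
  assumes "\<And>x. x \<in> set xs \<Longrightarrow> 0 \<le> f x \<and> f x \<le> 1"
  shows "0 \<le> (\<Prod>x\<leftarrow>xs. f x) \<and> (\<Prod>x\<leftarrow>xs. f x) \<le> 1"
  using assms
proof (induction xs)
  case (Cons a xs)
  then show ?case using mult_mono[of "f a" 1 "\<Prod>x\<leftarrow>xs. f x" 1] by simp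
qed simp

lemma borel_measurable_prod_list [measurable (raw)]:
  fixes f :: "'b \<Rightarrow> 'a \<Rightarrow> real"
  assumes "\<And>b. b \<in> set bs \<Longrightarrow> f b \<in> borel_measurable M"
  shows "(\<lambda>\<omega>. \<Prod>b\<leftarrow>bs. f b \<omega>) \<in> borel_measurable M"
  using assms by (induction bs) auto

text \<open>The points \<open>exp (-j)\<close> are isolated in \<open>{0} \<union> {exp (-m) | m. True}\<close>, so the indicator of one of
  them extends to a continuous function on \<open>[0,1]\<close>.\<close>

lemma polynomial_approx_indicator_exp:
  fixes j :: nat and \<epsilon> :: real
  assumes "0 < \<epsilon>"
  obtains a :: "nat \<Rightarrow> real" and d :: nat where
    "\<And>y. y = 0 \<or> (\<exists>m::nat. y = exp (- real m)) \<Longrightarrow>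
      \<bar>of_bool (y = exp (- real j)) - (\<Sum>i\<le>d. a i * y ^ i)\<bar> \<le> \<epsilon>"
proof -
  \<comment> \<open>The half-width of a tent function around exp (-j): the next smaller point is at
    distance exactly r, while the next larger one and 0 are farther away.\<close>
  define r where "r = exp (- real j) - exp (- real (Suc j))"
  have r: "0 < r" by (simp add: r_def)
  define \<phi> where "\<phi> y = max 0 (1 - \<bar>y - exp (- real j)\<bar> / r)" for y :: real
  have "continuous_on {0..1} \<phi>" unfolding \<phi>_def using r by (intro continuous_intros) auto
  from Stone_Weierstrass_real_polynomial_function[OF compact_Icc this assms] obtain g where
    g: "real_polynomial_function g" and ge: "\<And>y. y \<in> {0..1} \<Longrightarrow> \<bar>\<phi> y - g y\<bar> < \<epsilon>" by blast
  from g obtain a d where ad: "g = (\<lambda>x. \<Sum>i\<le>d. a i * x ^ i)"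
    unfolding real_polynomial_function_iff_sum by blast
  have "\<phi> y = of_bool (y = exp (- real j))" if y: "y = 0 \<or> (\<exists>m::nat. y = exp (- real m))" for y
  proof (cases "y = exp (- real j)")
    case True
    then show ?thesis by (simp add: \<phi>_def)
  next
    case False
    have "r \<le> \<bar>y - exp (- real j)\<bar>"
    proof (cases "y < exp (- real j)")
      case True
      have "y \<le> exp (- real (Suc j))"
        using y
      proof
        assume "\<exists>m::nat. y = exp (- real m)"
        then show ?thesis using True by auto
      qed (use True in auto)
      then show ?thesis using True by (simp add: r_def)
    next
      case notless: False
      then have gt: "exp (- real j) < y" using \<open>y \<noteq> _\<close> by simp
      then have "0 < y" using exp_gt_zero[of "- real j"] by linarith
      then obtain m where m: "y = exp (- real m)" using y by auto
      with gt have "m < j" by simp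
      then have "exp (- real m) \<ge> exp (1 - real j)" by simp
      moreover have "exp (1 - real j) = exp 1 * exp (- real j)"
        by (simp flip: exp_add)
      moreover have "(exp 1 - 1) * exp (- real j) \<ge> 1 * exp (- real j)"
        using exp_ge_add_one_self[of 1] by (intro mult_right_mono) auto
      moreover have "r \<le> exp (- real j)" by (simp add: r_def)
      ultimately have "r + exp (- real j) \<le> exp (- real m)" by (simp only: left_diff_distrib mult_1)
      then show ?thesis using m by simp
    qed
    then show ?thesis using r False by (simp add: \<phi>_def max_def divide_simps)
  qed
  moreover have "y \<in> {0..1}" if "y = 0 \<or> (\<exists>m::nat. y = exp (- real m))" for y
    using that by auto
  ultimately show thesis using ge ad that by (metis less_imp_le)
qed

text \<open>A monotone class principle, resting on the fact that the indicator of {z b = exp (-j)}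
  is a uniform limit of polynomials in z b. The indicators are replaced one at a time, and the
  induction carries along an arbitrary further product over \<open>bs\<close>, which absorbs the
  monomials that each replacement produces.\<close>

lemma indicator_exp_values_induct:
  fixes z :: "'b \<Rightarrow> 'c \<Rightarrow> real" and Q :: "('c \<Rightarrow> real) \<Rightarrow> bool"
  assumes z: "\<And>b \<omega>. b \<in> B \<Longrightarrow> \<omega> \<in> \<Omega> \<Longrightarrow> z b \<omega> = 0 \<or> (\<exists>j::nat. z b \<omega> = exp (- real j))"
    and base: "\<And>bs. set bs \<subseteq> B \<Longrightarrow> Q (\<lambda>\<omega>. \<Prod>b\<leftarrow>bs. z b \<omega>)"
    and add: "\<And>F G. Q F \<Longrightarrow> Q G \<Longrightarrow> Q (\<lambda>\<omega>. F \<omega> + G \<omega>)"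
    and scale: "\<And>F c. Q F \<Longrightarrow> Q (\<lambda>\<omega>. c * F \<omega>)"
    and lim: "\<And>F. (\<And>\<epsilon>. 0 < \<epsilon> \<Longrightarrow> \<exists>G. Q G \<and> (\<forall>\<omega>\<in>\<Omega>. \<bar>F \<omega> - G \<omega>\<bar> \<le> \<epsilon>)) \<Longrightarrow> Q F"
    and xs: "fst ` set xs \<subseteq> B"
  shows "Q (\<lambda>\<omega>. \<Prod>(b, j)\<leftarrow>xs. of_bool (z b \<omega> = exp (- real j)))"
proof -
  have "\<forall>bs. set bs \<subseteq> B \<longrightarrow>
      Q (\<lambda>\<omega>. (\<Prod>(b, j)\<leftarrow>xs. of_bool (z b \<omega> = exp (- real j))) * (\<Prod>b\<leftarrow>bs. z b \<omega>))"
    using xs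
  proof (induction xs)
    case Nil
    then show ?case using base by simp
  next
    case (Cons x xs)
    obtain b j where x: "x = (b, j)" by (cases x)
    have b: "b \<in> B" and xs: "fst ` set xs \<subseteq> B" using Cons.prems x by auto
    define I where "I \<omega> = (\<Prod>(b, j)\<leftarrow>xs. of_bool (z b \<omega> = exp (- real j)) :: real)" for \<omega>
    have I01: "0 \<le> I \<omega> \<and> I \<omega> \<le> 1" for \<omega>
      unfolding I_def by (rule prod_list_nonneg_le_1) (simp add: case_prod_beta)
    show ?case
    proof (intro allI impI, rule lim)
      fix bs and \<epsilon> :: real
      assume bs: "set bs \<subseteq> B" and "0 < \<epsilon>"
      obtain a d where
        ad: "\<And>y. y = 0 \<or> (\<exists>m::nat. y = exp (- real m)) \<Longrightarrow>
          \<bar>of_bool (y = exp (- real j)) - (\<Sum>i\<le>d. a i * y ^ i)\<bar> \<le> \<epsilon>"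
        using polynomial_approx_indicator_exp[OF \<open>0 < \<epsilon>\<close>, of j] by blast
      define R where "R \<omega> = (\<Prod>b\<leftarrow>bs. z b \<omega>)" for \<omega>
      have R01: "0 \<le> R \<omega> \<and> R \<omega> \<le> 1" if "\<omega> \<in> \<Omega>" for \<omega>
        unfolding R_def
      proof (rule prod_list_nonneg_le_1)
        fix c assume "c \<in> set bs"
        then have "z c \<omega> = 0 \<or> (\<exists>j::nat. z c \<omega> = exp (- real j))" using z that bs by auto
        then show "0 \<le> z c \<omega> \<and> z c \<omega> \<le> 1" by auto
      qed
      define G where "G \<omega> = (\<Sum>i\<le>d. a i * (I \<omega> * (\<Prod>b\<leftarrow>replicate i b @ bs. z b \<omega>)))" for \<omega>
      have Qsum: "Q (\<lambda>\<omega>. \<Sum>i\<le>d. a i * F i \<omega>)" if "\<And>i. Q (F i)" for F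
        by (induction d) (auto intro!: add scale that)
      have "Q G"
        unfolding G_def I_def
        using Cons.IH[OF xs] bs b by (intro Qsum) (simp add: set_replicate_conv_if del: map_append)
      moreover have "\<bar>(\<Prod>(b, j)\<leftarrow>x # xs. of_bool (z b \<omega> = exp (- real j))) * (\<Prod>b\<leftarrow>bs. z b \<omega>) - G \<omega>\<bar> \<le> \<epsilon>"
        if \<omega>: "\<omega> \<in> \<Omega>" for \<omega>
      proof -
        have "G \<omega> = (\<Sum>i\<le>d. a i * z b \<omega> ^ i) * (I \<omega> * R \<omega>)"
          unfolding G_def R_def sum_distrib_right
          by (intro sum.cong) (simp_all add: map_replicate prod_list_replicate)
        moreover have "(\<Prod>(b, j)\<leftarrow>x # xs. of_bool (z b \<omega> = exp (- real j))) * (\<Prod>b\<leftarrow>bs. z b \<omega>)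
            = of_bool (z b \<omega> = exp (- real j)) * (I \<omega> * R \<omega>)"
          by (simp add: x I_def R_def)
        ultimately have "\<bar>(\<Prod>(b, j)\<leftarrow>x # xs. of_bool (z b \<omega> = exp (- real j))) * (\<Prod>b\<leftarrow>bs. z b \<omega>) - G \<omega>\<bar>
            = \<bar>of_bool (z b \<omega> = exp (- real j)) - (\<Sum>i\<le>d. a i * z b \<omega> ^ i)\<bar> * \<bar>I \<omega> * R \<omega>\<bar>"
          by (simp add: abs_mult[symmetric] left_diff_distrib)
        also have "\<dots> \<le> \<epsilon> * 1"
          using I01[of \<omega>] R01[OF \<omega>] z[OF b \<omega>] \<open>0 < \<epsilon>\<close>
          by (intro mult_mono ad) (auto simp: abs_mult intro: mult_le_one)
        finally show ?thesis by simp
      qed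
      ultimately show "\<exists>G. Q G \<and> (\<forall>\<omega>\<in>\<Omega>. \<bar>(\<Prod>(b, j)\<leftarrow>x # xs. of_bool (z b \<omega> = exp (- real j))) *
          (\<Prod>b\<leftarrow>bs. z b \<omega>) - G \<omega>\<bar> \<le> \<epsilon>)"
        by blast
    qed
  qed
  from this[rule_format, of "[]"] show ?thesis by simp
qed

text \<open>The weights \<open>g n\<close>, the factor \<open>d\<close> and the second measure are
  left free so that one approximation argument serves several times: constant sequences give
  uniqueness, point masses and independence, and weights composed with the flow give mixing.\<close>

lemma tendsto_integral_indicator_exp_values:
  fixes z :: "'b \<Rightarrow> 'c \<Rightarrow> real" and g :: "nat \<Rightarrow> 'c \<Rightarrow> real"
  assumes N: "prob_space N" and N': "prob_space N'" and sets: "sets N' = sets N"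
    and z: "\<And>b \<omega>. b \<in> B \<Longrightarrow> \<omega> \<in> space N \<Longrightarrow> z b \<omega> = 0 \<or> (\<exists>j::nat. z b \<omega> = exp (- real j))"
    and zm: "\<And>b. b \<in> B \<Longrightarrow> z b \<in> borel_measurable N"
    and gm: "\<And>n. g n \<in> borel_measurable N"
    and g01: "\<And>n \<omega>. 0 \<le> g n \<omega> \<and> g n \<omega> \<le> 1" and d01: "0 \<le> d \<and> d \<le> 1"
    and conv: "\<And>bs. set bs \<subseteq> B \<Longrightarrow>
      (\<lambda>n. \<integral>\<omega>. (\<Prod>b\<leftarrow>bs. z b \<omega>) * g n \<omega> \<partial>N) \<longlonglongrightarrow> d * (\<integral>\<omega>. (\<Prod>b\<leftarrow>bs. z b \<omega>) \<partial>N')"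
    and xs: "fst ` set xs \<subseteq> B"
  shows "(\<lambda>n. \<integral>\<omega>. (\<Prod>(b, j)\<leftarrow>xs. of_bool (z b \<omega> = exp (- real j))) * g n \<omega> \<partial>N) \<longlonglongrightarrow>
    d * (\<integral>\<omega>. (\<Prod>(b, j)\<leftarrow>xs. of_bool (z b \<omega> = exp (- real j))) \<partial>N')"
proof -
  interpret N: prob_space N by fact
  interpret N': prob_space N' by fact
  have sp: "space N' = space N" using sets by (rule sets_eq_imp_space_eq)
  define Q where "Q F \<longleftrightarrow> F \<in> borel_measurable N \<and> (\<exists>C. \<forall>\<omega>\<in>space N. \<bar>F \<omega>\<bar> \<le> C) \<and>
    (\<lambda>n. \<integral>\<omega>. F \<omega> * g n \<omega> \<partial>N) \<longlonglongrightarrow> d * (\<integral>\<omega>. F \<omega> \<partial>N')" for F :: "'c \<Rightarrow> real"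
  have int: "integrable N (\<lambda>\<omega>. F \<omega> * g n \<omega>)" "integrable N' F" "integrable N F"
    if Fm: "F \<in> borel_measurable N" and Fb: "\<exists>C. \<forall>\<omega>\<in>space N. \<bar>F \<omega>\<bar> \<le> C" for F n
  proof -
    note [measurable] = Fm gm
    have [measurable]: "F \<in> borel_measurable N'" using Fm measurable_cong_sets[OF sets refl] by blast
    obtain C where C: "\<And>\<omega>. \<omega> \<in> space N \<Longrightarrow> \<bar>F \<omega>\<bar> \<le> C" using Fb by blast
    have "\<bar>F \<omega> * g n \<omega>\<bar> \<le> C" if "\<omega> \<in> space N" for \<omega>
      using mult_mono[OF C[OF that], of "\<bar>g n \<omega>\<bar>" 1] g01[of n \<omega>] C[OF that] by (simp add: abs_mult)
    then show "integrable N (\<lambda>\<omega>. F \<omega> * g n \<omega>)"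
      by (intro N.integrable_const_bound[where B=C]) (auto intro!: AE_I2)
    show "integrable N F" by (intro N.integrable_const_bound[where B=C]) (auto intro!: AE_I2 C)
    show "integrable N' F" by (intro N'.integrable_const_bound[where B=C]) (auto intro!: AE_I2 C simp: sp)
  qed
  have "Q (\<lambda>\<omega>. \<Prod>(b, j)\<leftarrow>xs. of_bool (z b \<omega> = exp (- real j)))"
  proof (rule indicator_exp_values_induct[where z=z and Q=Q and \<Omega>="space N" and B=B])
    fix bs assume bs: "set bs \<subseteq> B"
    have "\<bar>\<Prod>b\<leftarrow>bs. z b \<omega>\<bar> \<le> 1" if "\<omega> \<in> space N" for \<omega>
    proof -
      have "0 \<le> (\<Prod>b\<leftarrow>bs. z b \<omega>) \<and> (\<Prod>b\<leftarrow>bs. z b \<omega>) \<le> 1"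
      proof (rule prod_list_nonneg_le_1)
        fix c assume "c \<in> set bs"
        then have "z c \<omega> = 0 \<or> (\<exists>j::nat. z c \<omega> = exp (- real j))" using z that bs by auto
        then show "0 \<le> z c \<omega> \<and> z c \<omega> \<le> 1" by auto
      qed
      then show ?thesis by simp
    qed
    then show "Q (\<lambda>\<omega>. \<Prod>b\<leftarrow>bs. z b \<omega>)"
      unfolding Q_def using conv[OF bs] zm bs by (auto intro!: borel_measurable_prod_list)
  next
    fix F G assume F: "Q F" and G: "Q G"
    from F G obtain C D where "\<forall>\<omega>\<in>space N. \<bar>F \<omega>\<bar> \<le> C" "\<forall>\<omega>\<in>space N. \<bar>G \<omega>\<bar> \<le> D"
      unfolding Q_def by blast
    then have "\<forall>\<omega>\<in>space N. \<bar>F \<omega> + G \<omega>\<bar> \<le> C + D" by fastforce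
    moreover have "(\<lambda>n. (\<integral>\<omega>. F \<omega> * g n \<omega> \<partial>N) + (\<integral>\<omega>. G \<omega> * g n \<omega> \<partial>N)) \<longlonglongrightarrow>
        d * (\<integral>\<omega>. F \<omega> \<partial>N') + d * (\<integral>\<omega>. G \<omega> \<partial>N')"
      using F G unfolding Q_def by (intro tendsto_add) auto
    moreover have "(\<integral>\<omega>. (F \<omega> + G \<omega>) * g n \<omega> \<partial>N) = (\<integral>\<omega>. F \<omega> * g n \<omega> \<partial>N) + (\<integral>\<omega>. G \<omega> * g n \<omega> \<partial>N)" for n
      using int(1)[of F n] int(1)[of G n] F G unfolding Q_def by (simp add: distrib_right)
    moreover have "(\<integral>\<omega>. F \<omega> + G \<omega> \<partial>N') = (\<integral>\<omega>. F \<omega> \<partial>N') + (\<integral>\<omega>. G \<omega> \<partial>N')"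
      using int(2)[of F] int(2)[of G] F G unfolding Q_def by simp
    ultimately show "Q (\<lambda>\<omega>. F \<omega> + G \<omega>)"
      using F G unfolding Q_def by (auto simp: distrib_left)
  next
    fix F and c :: real assume F: "Q F"
    then obtain C where "\<forall>\<omega>\<in>space N. \<bar>F \<omega>\<bar> \<le> C"
      unfolding Q_def by blast
    then have "\<forall>\<omega>\<in>space N. \<bar>c * F \<omega>\<bar> \<le> \<bar>c\<bar> * C" by (auto simp: abs_mult intro!: mult_left_mono)
    moreover have "(\<lambda>n. c * (\<integral>\<omega>. F \<omega> * g n \<omega> \<partial>N)) \<longlonglongrightarrow> c * (d * (\<integral>\<omega>. F \<omega> \<partial>N'))"
      using F unfolding Q_def by (intro tendsto_mult_left) auto
    moreover have "(\<integral>\<omega>. c * F \<omega> * g n \<omega> \<partial>N) = c * (\<integral>\<omega>. F \<omega> * g n \<omega> \<partial>N)" for n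
      by (simp add: mult.assoc)
    ultimately show "Q (\<lambda>\<omega>. c * F \<omega>)"
      using F unfolding Q_def by (auto simp: mult.left_commute)
  next
    fix F assume approx: "\<And>\<epsilon>. 0 < \<epsilon> \<Longrightarrow> \<exists>G. Q G \<and> (\<forall>\<omega>\<in>space N. \<bar>F \<omega> - G \<omega>\<bar> \<le> \<epsilon>)"
    then have "\<forall>n::nat. \<exists>G. Q G \<and> (\<forall>\<omega>\<in>space N. \<bar>F \<omega> - G \<omega>\<bar> \<le> 1 / Suc n)" by simp
    then obtain G where G: "\<And>n. Q (G n)" and FG: "\<And>n \<omega>. \<omega> \<in> space N \<Longrightarrow> \<bar>F \<omega> - G n \<omega>\<bar> \<le> 1 / Suc n"
      by metis
    have Fm: "F \<in> borel_measurable N"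
    proof (rule borel_measurable_LIMSEQ_real)
      show "G n \<in> borel_measurable N" for n using G by (simp add: Q_def)
      fix \<omega> assume \<omega>: "\<omega> \<in> space N"
      have "(\<lambda>n. 1 / real (Suc n)) \<longlonglongrightarrow> 0"
        using LIMSEQ_inverse_real_of_nat by (simp add: inverse_eq_divide)
      then have "(\<lambda>n. F \<omega> - G n \<omega>) \<longlonglongrightarrow> 0"
        by (rule Lim_null_comparison[rotated]) (use FG[OF \<omega>] in auto)
      then show "(\<lambda>n. G n \<omega>) \<longlonglongrightarrow> F \<omega>"
        using tendsto_diff[OF tendsto_const[of "F \<omega>"], of "\<lambda>n. F \<omega> - G n \<omega>" 0] by simp
    qed
    obtain C where C: "\<And>\<omega>. \<omega> \<in> space N \<Longrightarrow> \<bar>G 0 \<omega>\<bar> \<le> C" using G[of 0] unfolding Q_def by blast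
    have "\<bar>F \<omega>\<bar> \<le> C + 1" if "\<omega> \<in> space N" for \<omega>
      using C[OF that] FG[OF that, of 0] by auto
    then have Fb: "\<exists>C. \<forall>\<omega>\<in>space N. \<bar>F \<omega>\<bar> \<le> C" by blast
    have "(\<lambda>n. \<integral>\<omega>. F \<omega> * g n \<omega> \<partial>N) \<longlonglongrightarrow> d * (\<integral>\<omega>. F \<omega> \<partial>N')"
    proof (rule LIMSEQ_I)
      fix r :: real assume r: "0 < r"
      then obtain H where H: "Q H" and FH: "\<And>\<omega>. \<omega> \<in> space N \<Longrightarrow> \<bar>F \<omega> - H \<omega>\<bar> \<le> r / 4"
        using approx[of "r / 4"] by auto
      have Hm: "H \<in> borel_measurable N" and Hb: "\<exists>C. \<forall>\<omega>\<in>space N. \<bar>H \<omega>\<bar> \<le> C"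
        and Hc: "(\<lambda>n. \<integral>\<omega>. H \<omega> * g n \<omega> \<partial>N) \<longlonglongrightarrow> d * (\<integral>\<omega>. H \<omega> \<partial>N')"
        using H by (auto simp: Q_def)
      note iF = int[OF Fm Fb] and iH = int[OF Hm Hb]
      have 1: "\<bar>(\<integral>\<omega>. F \<omega> * g n \<omega> \<partial>N) - (\<integral>\<omega>. H \<omega> * g n \<omega> \<partial>N)\<bar> \<le> r / 4" for n
      proof -
        have "\<bar>(\<integral>\<omega>. F \<omega> * g n \<omega> \<partial>N) - (\<integral>\<omega>. H \<omega> * g n \<omega> \<partial>N)\<bar> = \<bar>\<integral>\<omega>. (F \<omega> - H \<omega>) * g n \<omega> \<partial>N\<bar>"
          using iF(1)[of n] iH(1)[of n] by (simp add: left_diff_distrib)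
        also have "\<dots> \<le> (\<integral>\<omega>. \<bar>(F \<omega> - H \<omega>) * g n \<omega>\<bar> \<partial>N)" by (rule integral_abs_bound)
        also have "\<dots> \<le> (\<integral>\<omega>. r / 4 \<partial>N)"
        proof (rule integral_mono)
          show "integrable N (\<lambda>\<omega>. \<bar>(F \<omega> - H \<omega>) * g n \<omega>\<bar>)"
            using iF(1)[of n] iH(1)[of n] by (simp add: left_diff_distrib)
          show "\<bar>(F \<omega> - H \<omega>) * g n \<omega>\<bar> \<le> r / 4" if "\<omega> \<in> space N" for \<omega>
            using mult_mono[OF FH[OF that], of "\<bar>g n \<omega>\<bar>" 1] g01[of n \<omega>] r by (simp add: abs_mult)
        qed auto
        finally show ?thesis by (simp add: N.prob_space)
      qed
      have 2: "\<bar>d * (\<integral>\<omega>. F \<omega> \<partial>N') - d * (\<integral>\<omega>. H \<omega> \<partial>N')\<bar> \<le> r / 4"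
      proof -
        have "\<bar>(\<integral>\<omega>. F \<omega> \<partial>N') - (\<integral>\<omega>. H \<omega> \<partial>N')\<bar> = \<bar>\<integral>\<omega>. F \<omega> - H \<omega> \<partial>N'\<bar>"
          using iF iH by simp
        also have "\<dots> \<le> (\<integral>\<omega>. \<bar>F \<omega> - H \<omega>\<bar> \<partial>N')" by (rule integral_abs_bound)
        also have "\<dots> \<le> (\<integral>\<omega>. r / 4 \<partial>N')"
          using FH iF iH by (intro integral_mono) (auto simp: sp)
        finally have "\<bar>(\<integral>\<omega>. F \<omega> \<partial>N') - (\<integral>\<omega>. H \<omega> \<partial>N')\<bar> \<le> r / 4" by (simp add: N'.prob_space)
        then have "\<bar>d\<bar> * \<bar>(\<integral>\<omega>. F \<omega> \<partial>N') - (\<integral>\<omega>. H \<omega> \<partial>N')\<bar> \<le> 1 * (r / 4)"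
          using d01 by (intro mult_mono) auto
        then show ?thesis by (simp add: abs_mult[symmetric] right_diff_distrib)
      qed
      obtain n0 where n0: "\<And>n. n \<ge> n0 \<Longrightarrow>
          \<bar>(\<integral>\<omega>. H \<omega> * g n \<omega> \<partial>N) - d * (\<integral>\<omega>. H \<omega> \<partial>N')\<bar> < r / 4"
        using LIMSEQ_D[OF Hc, of "r / 4"] r by auto
      show "\<exists>n0. \<forall>n\<ge>n0. norm ((\<integral>\<omega>. F \<omega> * g n \<omega> \<partial>N) - d * (\<integral>\<omega>. F \<omega> \<partial>N')) < r"
      proof (intro exI allI impI)
        fix n assume "n \<ge> n0"
        from n0[OF this] 1[of n] 2 show "norm ((\<integral>\<omega>. F \<omega> * g n \<omega> \<partial>N) - d * (\<integral>\<omega>. F \<omega> \<partial>N')) < r"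
          unfolding real_norm_def using r by linarith
      qed
    qed
    with Fm Fb show "Q F" by (simp add: Q_def)
  qed (use z xs in auto)
  then show ?thesis by (simp add: Q_def)
qed

section \<open>Configurations and the pi-system of cylinders\<close>

definition finite_sets :: "'a measure \<Rightarrow> 'a set set" where
  "finite_sets M = {A \<in> sets M. emeasure M A < \<infinity>}"

lemma finite_setsD: "A \<in> finite_sets M \<Longrightarrow> A \<in> sets M" "A \<in> finite_sets M \<Longrightarrow> emeasure M A < \<infinity>"
  by (auto simp: finite_sets_def)

lemma sets_point_configuration: "\<omega> \<in> point_configurations M \<Longrightarrow> sets \<omega> = sets M"
  by (auto simp: point_configurations_def)

lemma emeasure_point_configuration:
  assumes "\<omega> \<in> point_configurations M"
  shows "emeasure \<omega> A = \<top> \<or> (\<exists>j::nat. emeasure \<omega> A = of_nat j)"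
proof (cases "A \<in> sets M")
  case A: True
  obtain I :: "nat set" and x where \<omega>: "\<omega> = distr (count_space I) M x" and x: "x \<in> I \<rightarrow> space M"
    using assms by (auto simp: point_configurations_def)
  have "emeasure \<omega> A = emeasure (count_space I) (x -` A \<inter> I)"
    unfolding \<omega> using x A by (subst emeasure_distr) auto
  then show ?thesis by (cases "finite (x -` A \<inter> I)") auto
next
  case False
  then have "emeasure \<omega> A = of_nat 0"
    using sets_point_configuration[OF assms] by (simp add: emeasure_notin_sets)
  then show ?thesis by blast
qed

lemma lexp_point_configuration:
  assumes "\<omega> \<in> point_configurations M"
  shows "lexp (emeasure \<omega> A) = 0 \<or> (\<exists>j::nat. lexp (emeasure \<omega> A) = exp (- real j))"
  using emeasure_point_configuration[OF assms, of A] by auto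

lemma space_configuration_space [simp]: "space (configuration_space M) = point_configurations M"
  by (auto simp: configuration_space_def intro!: space_measure_of)

lemma measurable_emeasure_configuration:
  assumes "A \<in> finite_sets M"
  shows "(\<lambda>\<omega>. emeasure \<omega> A) \<in> borel_measurable (configuration_space M)"
proof (rule measurableI)
  fix B :: "ennreal set" assume "B \<in> sets borel"
  then show "(\<lambda>\<omega>. emeasure \<omega> A) -` B \<inter> space (configuration_space M) \<in> sets (configuration_space M)"
    unfolding space_configuration_space unfolding configuration_space_def
    using assms by (intro in_measure_of) (auto simp: finite_sets_def)
qed auto

definition cylinder :: "'a measure \<Rightarrow> ('a set \<times> nat) list \<Rightarrow> 'a measure set" where
  "cylinder M xs = {\<omega> \<in> point_configurations M. \<forall>(A, j)\<in>set xs. emeasure \<omega> A = of_nat j}"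

definition cylinders :: "'a measure \<Rightarrow> 'a measure set set" where
  "cylinders M = {cylinder M xs |xs. fst ` set xs \<subseteq> finite_sets M}"

lemma cylinder_append: "cylinder M (xs @ ys) = cylinder M xs \<inter> cylinder M ys"
  by (auto simp: cylinder_def)

lemma Int_stable_cylinders: "Int_stable (cylinders M)"
proof (rule Int_stableI)
  fix a b assume "a \<in> cylinders M" "b \<in> cylinders M"
  then obtain xs ys where "a = cylinder M xs" "b = cylinder M ys"
    "fst ` set xs \<subseteq> finite_sets M" "fst ` set ys \<subseteq> finite_sets M"
    by (auto simp: cylinders_def)
  then show "a \<inter> b \<in> cylinders M"
    unfolding cylinders_def by (intro CollectI exI[of _ "xs @ ys"]) (simp add: cylinder_append image_Un)
qed

lemma space_in_cylinders: "point_configurations M \<in> cylinders M"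
  unfolding cylinders_def by (auto intro!: exI[of _ "[]"] simp: cylinder_def)

text \<open>Counts lie in the countable set of naturals together with infinity, so a preimage is a
  countable union of events {count = j}, plus the complement of all of them if infinity belongs to
  B.\<close>

lemma vimage_emeasure_sigma_sets:
  assumes "\<And>j::nat. {\<omega> \<in> point_configurations M. emeasure \<omega> A = of_nat j} \<in> sigma_sets (point_configurations M) G"
  shows "(\<lambda>\<omega>. emeasure \<omega> A) -` B \<inter> point_configurations M \<in> sigma_sets (point_configurations M) G"
    (is "?V \<in> _")
proof -
  let ?\<Omega> = "point_configurations M"
  let ?E = "\<lambda>j::nat. {\<omega> \<in> ?\<Omega>. emeasure \<omega> A = of_nat j}"
  let ?F = "\<lambda>j. if of_nat j \<in> B then ?E j else {}"
  have F: "(\<Union>j. ?F j) \<in> sigma_sets ?\<Omega> G"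
    using assms by (intro sigma_sets.Union) (auto intro: sigma_sets.Empty)
  have U: "(\<Union>j. ?E j) \<in> sigma_sets ?\<Omega> G"
    using assms by (intro sigma_sets.Union) auto
  have fin: "?V = (\<Union>j. ?F j) \<union> (if \<top> \<in> B then ?\<Omega> - (\<Union>j. ?E j) else {})"
  proof (intro set_eqI)
    fix \<omega>
    show "\<omega> \<in> ?V \<longleftrightarrow> \<omega> \<in> (\<Union>j. ?F j) \<union> (if \<top> \<in> B then ?\<Omega> - (\<Union>j. ?E j) else {})"
    proof (cases "\<omega> \<in> ?\<Omega>")
      case True
      with emeasure_point_configuration[OF True, of A] show ?thesis by auto
    qed (auto split: if_splits)
  qed
  have "(if \<top> \<in> B then ?\<Omega> - (\<Union>j. ?E j) else {}) \<in> sigma_sets ?\<Omega> G"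
    using U by (auto intro: sigma_sets.Empty sigma_sets.Compl)
  with F show ?thesis unfolding fin by (rule sigma_sets_Un)
qed

lemma sets_configuration_space:
  "sets (configuration_space M) = sigma_sets (point_configurations M) (cylinders M)"
proof
  have "sets (configuration_space M) = sigma_sets (point_configurations M)
       {(\<lambda>\<omega>. emeasure \<omega> A) -` B \<inter> point_configurations M | A B.
          A \<in> sets M \<and> emeasure M A < \<infinity> \<and> B \<in> sets borel}"
    unfolding configuration_space_def by (subst sets_measure_of) auto
  also have "\<dots> \<subseteq> sigma_sets (point_configurations M) (cylinders M)"
  proof (rule sigma_sets_mono, safe)
    fix A B assume A: "A \<in> sets M" "emeasure M A < \<infinity>"
    have "{\<omega> \<in> point_configurations M. emeasure \<omega> A = of_nat j} \<in> cylinders M" for j :: nat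
      unfolding cylinders_def using A
      by (auto intro!: exI[of _ "[(A, j)]"] simp: cylinder_def finite_sets_def)
    then show "(\<lambda>\<omega>. emeasure \<omega> A) -` B \<inter> point_configurations M
        \<in> sigma_sets (point_configurations M) (cylinders M)"
      by (intro vimage_emeasure_sigma_sets) auto
  qed
  finally show "sets (configuration_space M) \<subseteq> sigma_sets (point_configurations M) (cylinders M)" .
  have "cylinder M xs \<in> sets (configuration_space M)" if "fst ` set xs \<subseteq> finite_sets M" for xs
    using that
  proof (induction xs)
    case Nil
    have "cylinder M [] = space (configuration_space M)" by (simp add: cylinder_def)
    then show ?case by (simp only: sets.top)
  next
    case (Cons a xs)
    have "(\<lambda>\<omega>. emeasure \<omega> (fst a)) -` {of_nat (snd a)} \<inter> space (configuration_space M) \<in> sets (configuration_space M)"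
      using Cons.prems by (intro measurable_sets[OF measurable_emeasure_configuration]) auto
    moreover have "cylinder M (a # xs) =
        ((\<lambda>\<omega>. emeasure \<omega> (fst a)) -` {of_nat (snd a)} \<inter> space (configuration_space M)) \<inter> cylinder M xs"
      by (auto simp: cylinder_def)
    ultimately show ?case using Cons by auto
  qed
  then show "sigma_sets (point_configurations M) (cylinders M) \<subseteq> sets (configuration_space M)"
    unfolding space_configuration_space[symmetric]
    by (intro sets.sigma_sets_subset) (auto simp: cylinders_def)
qed

lemma prod_list_of_bool:
  "(\<Prod>(b, j)\<leftarrow>xs. of_bool (R b j)) = (of_bool (\<forall>(b, j)\<in>set xs. R b j) :: real)"
  by (induction xs) auto

lemma indicator_cylinder:
  assumes "\<omega> \<in> point_configurations M"
  shows "(\<Prod>(A, j)\<leftarrow>xs. of_bool (lexp (emeasure \<omega> A) = exp (- real j))) = (indicator (cylinder M xs) \<omega> :: real)"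
  using assms by (simp add: prod_list_of_bool lexp_eq_exp_of_nat_iff cylinder_def indicator_def case_prod_beta)

section \<open>Laplace functionals of the Poisson law\<close>

definition covered :: "'a set list \<Rightarrow> 'a \<Rightarrow> real" where
  "covered As x = 1 - exp (- (\<Sum>A\<leftarrow>As. indicator A x))"

definition laplace :: "'a set list \<Rightarrow> 'a measure \<Rightarrow> real" where
  "laplace As \<omega> = (\<Prod>A\<leftarrow>As. lexp (emeasure \<omega> A))"

text \<open>For a Poisson process, E exp (-\<omega>(f)) = exp (-\<integral>(1 - exp (-f)) dM); here
  f is a sum of indicators, and \<open>covered\<close> is the integrand 1 - exp (-f). A list may
  repeat a set, which provides all integer multiplicities and closes the functions
  \<open>laplace\<close> under products.\<close>

definition laplace_law :: "'a measure \<Rightarrow> 'a measure measure \<Rightarrow> bool" where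
  "laplace_law M P \<longleftrightarrow>
     prob_space P \<and> sets P = sets (configuration_space M) \<and>
     (\<forall>As. set As \<subseteq> finite_sets M \<longrightarrow> (\<integral>\<omega>. laplace As \<omega> \<partial>P) = exp (- (\<integral>x. covered As x \<partial>M)))"

lemma laplace_bounds: "0 \<le> laplace As \<omega>" "laplace As \<omega> \<le> 1"
  using prod_list_nonneg_le_1[of As "\<lambda>A. lexp (emeasure \<omega> A)"] by (auto simp: laplace_def)

lemma laplace_append: "laplace (As @ Bs) \<omega> = laplace As \<omega> * laplace Bs \<omega>"
  by (simp add: laplace_def)

lemma measurable_laplace:
  assumes "set As \<subseteq> finite_sets M"
  shows "laplace As \<in> borel_measurable (configuration_space M)"
  unfolding laplace_def[abs_def]
  using assms by (auto intro!: borel_measurable_prod_list measurable_compose[OF measurable_emeasure_configuration measurable_lexp])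

lemma sum_list_indicator_nonneg: "0 \<le> (\<Sum>A\<leftarrow>As. indicator A x :: real)"
  by (intro sum_list_nonneg) auto

lemma covered_bounds: "0 \<le> covered As x" "covered As x \<le> indicator (\<Union>(set As)) x"
proof -
  show "0 \<le> covered As x" using sum_list_indicator_nonneg by (simp add: covered_def)
  show "covered As x \<le> indicator (\<Union>(set As)) x"
  proof (cases "x \<in> \<Union>(set As)")
    case False
    then have "(\<Sum>A\<leftarrow>As. indicator A x :: real) = 0"
      by (induction As) auto
    then show ?thesis by (simp add: covered_def)
  qed (simp add: covered_def)
qed

lemma covered_append: "covered (As @ Bs) x = covered As x + covered Bs x - covered As x * covered Bs x"
  by (simp add: covered_def algebra_simps flip: exp_add)

lemma measurable_covered:
  assumes "set As \<subseteq> sets M"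
  shows "covered As \<in> borel_measurable M"
proof -
  have "(\<lambda>x. \<Sum>A\<leftarrow>As. indicator A x :: real) \<in> borel_measurable M"
    using assms by (induction As) auto
  then show ?thesis unfolding covered_def[abs_def] by simp
qed

lemma Union_finite_sets: "set As \<subseteq> finite_sets M \<Longrightarrow> \<Union>(set As) \<in> finite_sets M"
proof (induction As)
  case (Cons A As)
  then have "A \<in> finite_sets M" "\<Union>(set As) \<in> finite_sets M" by auto
  then show ?case using emeasure_subadditive[of A M "\<Union>(set As)"]
    by (auto simp: finite_sets_def intro: le_less_trans)
qed (auto simp: finite_sets_def)

lemma integrable_covered:
  assumes "set As \<subseteq> finite_sets M"
  shows "integrable M (covered As)"
proof (rule Bochner_Integration.integrable_bound)
  show "integrable M (indicator (\<Union>(set As)) :: _ \<Rightarrow> real)"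
    using Union_finite_sets[OF assms] by (auto simp: finite_sets_def)
  show "covered As \<in> borel_measurable M"
    using assms by (intro measurable_covered) (auto simp: finite_sets_def)
  show "AE x in M. norm (covered As x) \<le> norm (indicator (\<Union>(set As)) x :: real)"
    using covered_bounds[of As] by (auto simp: abs_of_nonneg)
qed

lemma exp_perturb:
  fixes a b c \<delta> :: real
  assumes "0 \<le> c" "c \<le> \<delta>" "c \<le> a + b"
  shows "\<bar>exp (- (a + b - c)) - exp (- a) * exp (- b)\<bar> \<le> \<delta>"
proof -
  have "exp (- a) * exp (- b) = exp (- (a + b - c)) * exp (- c)" by (simp flip: exp_add)
  then have "exp (- (a + b - c)) - exp (- a) * exp (- b) = exp (- (a + b - c)) * (1 - exp (- c))"
    by (simp add: algebra_simps)
  moreover have "exp (- (a + b - c)) * (1 - exp (- c)) \<le> 1 * c"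
    using assms exp_ge_add_one_self[of "- c"] by (intro mult_mono) auto
  moreover have "0 \<le> exp (- (a + b - c)) * (1 - exp (- c))"
    using assms by simp
  ultimately show ?thesis using assms by simp
qed

text \<open>For the concatenated list the exponent falls short of the sum of the two exponents by
  the integral of \<open>covered As x * covered Bs x\<close>, which lives on the overlap of the two
  unions. Disjoint families therefore give an exact product, and a small overlap gives near
  independence.\<close>

lemma laplace_law_append:
  assumes P: "laplace_law M P" and As: "set As \<subseteq> finite_sets M" and Bs: "set Bs \<subseteq> finite_sets M"
  shows "\<bar>(\<integral>\<omega>. laplace As \<omega> * laplace Bs \<omega> \<partial>P) - (\<integral>\<omega>. laplace As \<omega> \<partial>P) * (\<integral>\<omega>. laplace Bs \<omega> \<partial>P)\<bar>
    \<le> measure M (\<Union>(set As) \<inter> \<Union>(set Bs))"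
proof -
  let ?D = "\<Union>(set As) \<inter> \<Union>(set Bs)"
  have iA: "integrable M (covered As)" and iB: "integrable M (covered Bs)"
    and iAB: "integrable M (covered (As @ Bs))"
    using As Bs by (auto intro!: integrable_covered)
  have prod: "covered As x * covered Bs x = covered As x + covered Bs x - covered (As @ Bs) x" for x
    by (simp add: covered_append)
  have ip: "integrable M (\<lambda>x. covered As x * covered Bs x)"
    unfolding prod using iA iB iAB by simp
  let ?a = "\<integral>x. covered As x \<partial>M" and ?b = "\<integral>x. covered Bs x \<partial>M"
    and ?c = "\<integral>x. covered As x * covered Bs x \<partial>M"
  have "0 \<le> ?c" by (intro Bochner_Integration.integral_nonneg) (simp add: covered_bounds)
  moreover have "?c \<le> (\<integral>x. indicator ?D x \<partial>M)"
  proof (rule Bochner_Integration.integral_mono[OF ip])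
    have "emeasure M ?D \<le> emeasure M (\<Union>(set As))"
      using Union_finite_sets[OF As] by (intro emeasure_mono) (auto simp: finite_sets_def)
    then show "integrable M (indicator ?D :: _ \<Rightarrow> real)"
      using Union_finite_sets[OF As] Union_finite_sets[OF Bs]
      by (auto simp: finite_sets_def)
    show "covered As x * covered Bs x \<le> indicator ?D x" for x
      using mult_mono[OF covered_bounds(2)[of As x] covered_bounds(2)[of Bs x]]
      by (simp add: covered_bounds indicator_inter_arith)
  qed
  moreover have "(\<integral>x. indicator ?D x \<partial>M) = measure M ?D"
    using Union_finite_sets[OF As] Union_finite_sets[OF Bs] sets.Int_space_eq2[of ?D M]
    by (simp add: finite_sets_def sets.Int)
  moreover have eq: "(\<integral>x. covered (As @ Bs) x \<partial>M) = ?a + ?b - ?c"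
    unfolding covered_append using iA iB ip by simp
  moreover have "0 \<le> (\<integral>x. covered (As @ Bs) x \<partial>M)"
    by (intro Bochner_Integration.integral_nonneg) (simp add: covered_bounds)
  moreover have "(\<integral>\<omega>. laplace As \<omega> * laplace Bs \<omega> \<partial>P) = exp (- (\<integral>x. covered (As @ Bs) x \<partial>M))"
    unfolding laplace_append[symmetric] using P As Bs by (simp add: laplace_law_def)
  moreover have "(\<integral>\<omega>. laplace As \<omega> \<partial>P) = exp (- ?a)" "(\<integral>\<omega>. laplace Bs \<omega> \<partial>P) = exp (- ?b)"
    using P As Bs by (auto simp: laplace_law_def)
  ultimately show ?thesis
    using exp_perturb[of ?c "measure M ?D" ?a ?b] by simp
qed

lemma laplace_law_space: "laplace_law M P \<Longrightarrow> space P = point_configurations M"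
  using sets_eq_imp_space_eq[of P "configuration_space M"] by (simp add: laplace_law_def)

lemma measurable_laplace_law:
  assumes "laplace_law M P"
  shows "measurable P N = measurable (configuration_space M) N"
  using assms by (intro measurable_cong_sets) (auto simp: laplace_law_def)

lemma cylinder_sets_laplace_law:
  assumes "laplace_law M P" "fst ` set xs \<subseteq> finite_sets M"
  shows "cylinder M xs \<in> sets P"
  using assms unfolding laplace_law_def sets_configuration_space by (auto simp: cylinders_def)

text \<open>The family B is a parameter because independence can only supply test functionals built
  from the sets of one cylinder, whereas uniqueness and mixing supply them for all of
  \<open>finite_sets M\<close>.\<close>

lemma tendsto_integral_cylinder:
  assumes P: "laplace_law M P" and P': "prob_space P'" "sets P' = sets P"
    and B: "B \<subseteq> finite_sets M"
    and gm: "\<And>n. g n \<in> borel_measurable P"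
    and g01: "\<And>n \<omega>. 0 \<le> g n \<omega> \<and> g n \<omega> \<le> (1::real)" and d01: "0 \<le> d \<and> d \<le> 1"
    and conv: "\<And>As. set As \<subseteq> B \<Longrightarrow>
      (\<lambda>n. \<integral>\<omega>. laplace As \<omega> * g n \<omega> \<partial>P) \<longlonglongrightarrow> d * (\<integral>\<omega>. laplace As \<omega> \<partial>P')"
    and xs: "fst ` set xs \<subseteq> B"
  shows "(\<lambda>n. \<integral>\<omega>. indicator (cylinder M xs) \<omega> * g n \<omega> \<partial>P) \<longlonglongrightarrow> d * measure P' (cylinder M xs)"
proof -
  have sp: "space P = point_configurations M" "space P' = point_configurations M"
    using laplace_law_space[OF P] sets_eq_imp_space_eq[OF P'(2)] by auto
  have "(\<lambda>n. \<integral>\<omega>. (\<Prod>(b, j)\<leftarrow>xs. of_bool (lexp (emeasure \<omega> b) = exp (- real j))) * g n \<omega> \<partial>P) \<longlonglongrightarrow>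
    d * (\<integral>\<omega>. (\<Prod>(b, j)\<leftarrow>xs. of_bool (lexp (emeasure \<omega> b) = exp (- real j))) \<partial>P')"
  proof (rule tendsto_integral_indicator_exp_values[where B = B])
    show "prob_space P" using P by (simp add: laplace_law_def)
    show "lexp (emeasure \<omega> b) = 0 \<or> (\<exists>j::nat. lexp (emeasure \<omega> b) = exp (- real j))"
      if "\<omega> \<in> space P" for b \<omega>
      using that sp lexp_point_configuration by blast
    show "(\<lambda>\<omega>. lexp (emeasure \<omega> b)) \<in> borel_measurable P" if "b \<in> B" for b
      unfolding measurable_laplace_law[OF P] using that B
      by (intro measurable_compose[OF measurable_emeasure_configuration measurable_lexp]) auto
  qed (use P' gm g01 d01 conv xs in \<open>auto simp: laplace_def\<close>)
  moreover have "(\<integral>\<omega>. (\<Prod>(b, j)\<leftarrow>xs. of_bool (lexp (emeasure \<omega> b) = exp (- real j))) * g n \<omega> \<partial>P)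
      = (\<integral>\<omega>. indicator (cylinder M xs) \<omega> * g n \<omega> \<partial>P)" for n
    by (intro Bochner_Integration.integral_cong) (auto simp: sp indicator_cylinder)
  moreover have "(\<integral>\<omega>. (\<Prod>(b, j)\<leftarrow>xs. of_bool (lexp (emeasure \<omega> b) = exp (- real j)) :: real) \<partial>P')
      = (\<integral>\<omega>. indicator (cylinder M xs) \<omega> \<partial>P')"
    by (intro Bochner_Integration.integral_cong) (auto simp: sp indicator_cylinder)
  moreover have "\<dots> = measure P' (cylinder M xs)"
    using sp by (simp add: Int_absorb2 cylinder_def Collect_conj_eq)
  ultimately show ?thesis by simp
qed

lemma laplace_law_unique:
  assumes P: "laplace_law M P" and P': "laplace_law M P'"
  shows "P = P'"
proof -
  interpret P: prob_space P using P by (simp add: laplace_law_def)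
  interpret P': prob_space P' using P' by (simp add: laplace_law_def)
  have sets: "sets P = sigma_sets (point_configurations M) (cylinders M)"
    "sets P' = sigma_sets (point_configurations M) (cylinders M)"
    using P P' by (auto simp: laplace_law_def sets_configuration_space)
  show ?thesis
  proof (rule measure_eqI_generator_eq[OF Int_stable_cylinders _ _ sets, where A="\<lambda>_. point_configurations M"])
    show "cylinders M \<subseteq> Pow (point_configurations M)" by (auto simp: cylinders_def cylinder_def)
    fix X assume "X \<in> cylinders M"
    then obtain xs where X: "X = cylinder M xs" and xs: "fst ` set xs \<subseteq> finite_sets M"
      by (auto simp: cylinders_def)
    \<comment> \<open>The sequence is constant, so the limit statement is an equation between the
      two laws.\<close>
    have "(\<lambda>n::nat. \<integral>\<omega>. indicator (cylinder M xs) \<omega> * 1 \<partial>P) \<longlonglongrightarrow> 1 * measure P' (cylinder M xs)"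
      by (rule tendsto_integral_cylinder[OF P _ _ subset_refl _ _ _ _ xs])
        (use P P' P'.prob_space_axioms in \<open>auto simp: laplace_law_def\<close>)
    then have "(\<integral>\<omega>. indicator (cylinder M xs) \<omega> \<partial>P) = measure P' (cylinder M xs)"
      by (simp add: LIMSEQ_const_iff)
    then have "measure P X = measure P' X"
      using cylinder_sets_laplace_law[OF P xs] by (simp add: X sets.Int_space_eq2)
    then show "emeasure P X = emeasure P' X"
      by (simp add: P.emeasure_eq_measure P'.emeasure_eq_measure)
  qed (use space_in_cylinders in auto)
qed

text \<open>Laplace functionals over disjoint families are uncorrelated. Indicators replace them
  first in the \<open>xs\<close> factor, with \<open>laplace Bs\<close> as a fixed weight, and then
  in the \<open>ys\<close> factor, with the indicator of the first cylinder as the weight.\<close>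

lemma laplace_law_indep_cylinders:
  assumes P: "laplace_law M P"
    and xs: "fst ` set xs \<subseteq> finite_sets M" and ys: "fst ` set ys \<subseteq> finite_sets M"
    and disj: "\<Union>(fst ` set xs) \<inter> \<Union>(fst ` set ys) = {}"
  shows "measure P (cylinder M xs \<inter> cylinder M ys) = measure P (cylinder M xs) * measure P (cylinder M ys)"
proof -
  interpret P: prob_space P using P by (simp add: laplace_law_def)
  note cyl = cylinder_sets_laplace_law[OF P]
  have lm: "laplace As \<in> borel_measurable P" if "set As \<subseteq> finite_sets M" for As
    unfolding measurable_laplace_law[OF P] using that by (rule measurable_laplace)
  have e01: "0 \<le> (\<integral>\<omega>. laplace As \<omega> \<partial>P) \<and> (\<integral>\<omega>. laplace As \<omega> \<partial>P) \<le> 1" if "set As \<subseteq> finite_sets M" for As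
  proof
    show "0 \<le> (\<integral>\<omega>. laplace As \<omega> \<partial>P)" by (intro Bochner_Integration.integral_nonneg) (simp add: laplace_bounds)
    have "(\<integral>\<omega>. laplace As \<omega> \<partial>P) \<le> (\<integral>\<omega>. 1 \<partial>P)"
      using lm[OF that] by (intro Bochner_Integration.integral_mono P.integrable_const_bound[where B=1]) (auto simp: laplace_bounds)
    then show "(\<integral>\<omega>. laplace As \<omega> \<partial>P) \<le> 1" by (simp add: P.prob_space)
  qed
  have eq: "(\<integral>\<omega>. laplace As \<omega> * laplace Bs \<omega> \<partial>P) = (\<integral>\<omega>. laplace Bs \<omega> \<partial>P) * (\<integral>\<omega>. laplace As \<omega> \<partial>P)"
    if "set As \<subseteq> fst ` set xs" "set Bs \<subseteq> fst ` set ys" for As Bs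
  proof -
    have "\<Union>(set As) \<inter> \<Union>(set Bs) = {}" using disj that by blast
    then show ?thesis using laplace_law_append[OF P, of As Bs] that xs ys by auto
  qed
  have 1: "(\<integral>\<omega>. indicator (cylinder M xs) \<omega> * laplace Bs \<omega> \<partial>P) = (\<integral>\<omega>. laplace Bs \<omega> \<partial>P) * measure P (cylinder M xs)"
    if "set Bs \<subseteq> fst ` set ys" for Bs
  proof -
    have Bs: "set Bs \<subseteq> finite_sets M" using that ys by blast
    have "(\<lambda>n::nat. \<integral>\<omega>. indicator (cylinder M xs) \<omega> * laplace Bs \<omega> \<partial>P) \<longlonglongrightarrow>
        (\<integral>\<omega>. laplace Bs \<omega> \<partial>P) * measure P (cylinder M xs)"
      by (rule tendsto_integral_cylinder[OF P P.prob_space_axioms refl xs _ _ _ _ subset_refl])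
        (use that eq lm[OF Bs] e01[OF Bs] in \<open>auto simp: laplace_bounds\<close>)
    then show ?thesis by (simp add: LIMSEQ_const_iff)
  qed
  have "(\<lambda>n::nat. \<integral>\<omega>. indicator (cylinder M ys) \<omega> * indicator (cylinder M xs) \<omega> \<partial>P) \<longlonglongrightarrow>
      measure P (cylinder M xs) * measure P (cylinder M ys)"
    by (rule tendsto_integral_cylinder[OF P P.prob_space_axioms refl ys _ _ _ _ subset_refl])
      (use 1 cyl[OF xs] in \<open>auto simp: mult.commute indicator_def\<close>)
  then have "(\<integral>\<omega>. indicator (cylinder M ys \<inter> cylinder M xs) \<omega> \<partial>P) = measure P (cylinder M xs) * measure P (cylinder M ys)"
    by (simp add: LIMSEQ_const_iff indicator_inter_arith)
  then show ?thesis using cyl[OF xs] cyl[OF ys] by (simp add: Int_commute sets.Int_space_eq2)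
qed

section \<open>Poisson counts and independence from Laplace functionals\<close>

definition poisson_distribution :: "real \<Rightarrow> nat pmf" where
  "poisson_distribution c = (if 0 < c then poisson_pmf c else return_pmf 0)"

lemma pmf_poisson_distribution:
  assumes "0 \<le> c"
  shows "pmf (poisson_distribution c) k = c ^ k / fact k * exp (- c)"
  using assms by (auto simp: poisson_distribution_def indicator_def)

lemma nn_integral_poisson_distribution:
  assumes c: "0 \<le> c" and x: "0 \<le> x"
  shows "(\<integral>\<^sup>+n. ennreal x ^ n \<partial>poisson_distribution c) = ennreal (exp (c * (x - 1)))"
proof -
  have sums: "(\<lambda>n. exp (- c) * ((c * x) ^ n /\<^sub>R fact n)) sums (exp (- c) * exp (c * x))"
    by (intro sums_mult exp_converges)
  have "(\<integral>\<^sup>+n. ennreal x ^ n \<partial>poisson_distribution c)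
      = (\<Sum>n. ennreal (pmf (poisson_distribution c) n) * ennreal x ^ n)"
    by (simp add: nn_integral_measure_pmf nn_integral_count_space_nat)
  also have "\<dots> = (\<Sum>n. ennreal (exp (- c) * ((c * x) ^ n /\<^sub>R fact n)))"
    using c x by (intro suminf_cong)
      (simp add: pmf_poisson_distribution ennreal_power ennreal_mult[symmetric] power_mult_distrib field_simps)
  also have "\<dots> = ennreal (exp (- c) * exp (c * x))"
    using c x sums by (intro suminf_ennreal_eq) auto
  also have "exp (- c) * exp (c * x) = exp (c * (x - 1))"
    by (simp add: algebra_simps flip: exp_add)
  finally show ?thesis .
qed

lemma integral_poisson_distribution:
  assumes "0 \<le> c" "0 \<le> x"
  shows "(\<integral>n. x ^ n \<partial>poisson_distribution c) = exp (c * (x - 1))"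
  using assms nn_integral_poisson_distribution[OF assms]
  by (intro integral_eq_nn_integral[THEN trans]) (auto simp: ennreal_power)

text \<open>The k-th moment of exp (-count) is the Laplace functional of
  \<open>replicate k A\<close>, and it equals the generating function of the Poisson distribution at
  exp (-k). Since polynomials in exp (-count) approximate the event {count = j}, the point masses
  agree. \<open>None\<close> stands for an infinite count, with z = 0.\<close>

lemma laplace_law_poisson:
  assumes P: "laplace_law M P" and A: "A \<in> finite_sets M"
  shows "measure P {\<omega> \<in> space P. emeasure \<omega> A = of_nat j}
    = exp (- measure M A) * measure M A ^ j / fact j"
proof -
  interpret P: prob_space P using P by (simp add: laplace_law_def)
  define D where "D = measure_pmf (poisson_distribution (measure M A))"
  interpret D: prob_space D unfolding D_def by (rule measure_pmf.prob_space_axioms)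
  define X :: "'a measure \<Rightarrow> nat option" where
    "X \<omega> = (if emeasure \<omega> A = \<top> then None else Some (nat \<lfloor>enn2real (emeasure \<omega> A)\<rfloor>))" for \<omega>
  have eA [measurable]: "(\<lambda>\<omega>. emeasure \<omega> A) \<in> borel_measurable P"
    unfolding measurable_laplace_law[OF P] using A by (rule measurable_emeasure_configuration)
  have X [measurable]: "X \<in> P \<rightarrow>\<^sub>M count_space UNIV" unfolding X_def by measurable
  define z :: "unit \<Rightarrow> nat option \<Rightarrow> real" where
    "z u v = (case v of None \<Rightarrow> 0 | Some j \<Rightarrow> exp (- real j))" for u v
  have zX: "z u (X \<omega>) = lexp (emeasure \<omega> A)" if "\<omega> \<in> space P" for u \<omega>
    using emeasure_point_configuration[of \<omega> M A] that laplace_law_space[OF P]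
    by (auto simp: z_def X_def)
  have [measurable]: "Some \<in> D \<rightarrow>\<^sub>M count_space UNIV" by (simp add: D_def)
  let ?N = "distr P (count_space UNIV) X" and ?N' = "distr D (count_space UNIV) Some"
  have "(\<lambda>n::nat. \<integral>v. (\<Prod>(b, j)\<leftarrow>[((), j)]. of_bool (z b v = exp (- real j))) * (1::real) \<partial>?N) \<longlonglongrightarrow>
      1 * (\<integral>v. (\<Prod>(b, j)\<leftarrow>[((), j)]. of_bool (z b v = exp (- real j))) \<partial>?N')"
  proof (rule tendsto_integral_indicator_exp_values[where B=UNIV and g="\<lambda>_ _. 1" and d=1])
    show "prob_space ?N" by (intro P.prob_space_distr) simp
    show "prob_space ?N'" by (intro D.prob_space_distr) simp
    show "z b v = 0 \<or> (\<exists>j::nat. z b v = exp (- real j))" for b v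
      by (auto simp: z_def split: option.split)
    fix bs :: "unit list"
    define k where "k = length bs"
    have zk: "(\<Prod>b\<leftarrow>bs. z b v) = z () v ^ k" for v
      unfolding k_def by (induction bs) auto
    have "(\<integral>v. (\<Prod>b\<leftarrow>bs. z b v) \<partial>?N) = (\<integral>\<omega>. z () (X \<omega>) ^ k \<partial>P)"
      unfolding zk by (simp add: integral_distr)
    also have "\<dots> = (\<integral>\<omega>. laplace (replicate k A) \<omega> \<partial>P)"
      by (intro Bochner_Integration.integral_cong) (auto simp: zX laplace_def map_replicate prod_list_replicate)
    also have "\<dots> = exp (- (\<integral>x. covered (replicate k A) x \<partial>M))"
      using P A by (auto simp: laplace_law_def set_replicate_conv_if)
    also have "(\<integral>x. covered (replicate k A) x \<partial>M) = (\<integral>x. (1 - exp (- real k)) * indicator A x \<partial>M)"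
      by (intro Bochner_Integration.integral_cong)
        (auto simp: covered_def map_replicate sum_list_replicate indicator_def)
    also have "\<dots> = (1 - exp (- real k)) * measure M A"
      using A by (simp add: finite_sets_def sets.Int_space_eq2)
    finally have 1: "(\<integral>v. (\<Prod>b\<leftarrow>bs. z b v) \<partial>?N) = exp (- ((1 - exp (- real k)) * measure M A))" .
    have "(\<integral>v. (\<Prod>b\<leftarrow>bs. z b v) \<partial>?N') = (\<integral>n. z () (Some n) ^ k \<partial>D)"
      unfolding zk by (simp add: integral_distr)
    also have "\<dots> = (\<integral>n. exp (- real k) ^ n \<partial>D)"
      by (intro Bochner_Integration.integral_cong)
        (auto simp: z_def mult.commute simp flip: exp_of_nat_mult)
    also have "\<dots> = exp (measure M A * (exp (- real k) - 1))"
      unfolding D_def by (rule integral_poisson_distribution) auto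
    finally have 2: "(\<integral>v. (\<Prod>b\<leftarrow>bs. z b v) \<partial>?N') = exp (measure M A * (exp (- real k) - 1))" .
    have "- ((1 - exp (- real k)) * measure M A) = measure M A * (exp (- real k) - 1)"
      by (simp add: algebra_simps)
    with 1 2 show "(\<lambda>n::nat. \<integral>v. (\<Prod>b\<leftarrow>bs. z b v) * 1 \<partial>?N) \<longlonglongrightarrow> 1 * (\<integral>v. (\<Prod>b\<leftarrow>bs. z b v) \<partial>?N')"
      by simp
  qed auto
  then have "(\<integral>v. of_bool (z () v = exp (- real j)) \<partial>?N) = (\<integral>v. (of_bool (z () v = exp (- real j)) :: real) \<partial>?N')"
    by (simp add: LIMSEQ_const_iff)
  moreover have "(\<integral>v. (of_bool (z () v = exp (- real j)) :: real) \<partial>?N) = measure P {\<omega> \<in> space P. emeasure \<omega> A = of_nat j}"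
  proof -
    have "(\<integral>v. (of_bool (z () v = exp (- real j)) :: real) \<partial>?N) = (\<integral>\<omega>. of_bool (z () (X \<omega>) = exp (- real j)) \<partial>P)"
      by (simp add: integral_distr)
    also have "\<dots> = (\<integral>\<omega>. indicator {\<omega> \<in> space P. emeasure \<omega> A = of_nat j} \<omega> \<partial>P)"
      by (intro Bochner_Integration.integral_cong) (auto simp: zX lexp_eq_exp_of_nat_iff indicator_def)
    finally show ?thesis by simp
  qed
  moreover have "(\<integral>v. (of_bool (z () v = exp (- real j)) :: real) \<partial>?N') = pmf (poisson_distribution (measure M A)) j"
  proof -
    have "(\<integral>v. (of_bool (z () v = exp (- real j)) :: real) \<partial>?N') = (\<integral>n. of_bool (z () (Some n) = exp (- real j)) \<partial>D)"
      by (simp add: integral_distr)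
    also have "\<dots> = (\<integral>n. indicator {j} n \<partial>D)"
      by (intro Bochner_Integration.integral_cong) (auto simp: z_def indicator_def)
    also have "\<dots> = pmf (poisson_distribution (measure M A)) j"
      by (simp add: D_def measure_pmf_single)
    finally show ?thesis .
  qed
  ultimately show ?thesis by (simp add: pmf_poisson_distribution)
qed

lemma laplace_law_imp_poisson_law:
  assumes P: "laplace_law M P"
  shows "poisson_law M P"
proof -
  interpret P: prob_space P using P by (simp add: laplace_law_def)
  note sp = laplace_law_space[OF P]
  note cyl = cylinder_sets_laplace_law[OF P]
  have fin: "A \<in> finite_sets M" if "A \<in> sets M" "emeasure M A < \<infinity>" for A
    using that by (simp add: finite_sets_def)
  have "P.indep_vars (\<lambda>_. borel) (\<lambda>i \<omega>. emeasure \<omega> (A i)) {..<n}"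
    if A: "\<And>i. i < n \<Longrightarrow> A i \<in> finite_sets M" and disj: "disjoint_family_on A {..<n}"
    for n :: nat and A
    unfolding P.indep_vars_def2
  proof
    show "\<forall>i\<in>{..<n}. (\<lambda>\<omega>. emeasure \<omega> (A i)) \<in> borel_measurable P"
      unfolding measurable_laplace_law[OF P] using A by (auto intro: measurable_emeasure_configuration)
    define E where "E i j = {\<omega> \<in> point_configurations M. emeasure \<omega> (A i) = of_nat j}" for i and j :: nat
    \<comment> \<open>The empty set makes the events {count = j} closed under intersection, since
      different values of j exclude each other.\<close>
    define G where "G i = insert {} (range (E i))" for i
    have E: "E i j = cylinder M [(A i, j)]" for i j by (auto simp: E_def cylinder_def)
    have "P.indep_sets G {..<n}"
    proof (rule P.indep_setsI)
      fix i assume "i \<in> {..<n}"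
      then show "G i \<subseteq> P.events" using A by (auto simp: G_def E intro!: cyl)
    next
      fix B J assume J: "J \<noteq> {}" "J \<subseteq> {..<n}" "finite J" and B: "\<forall>i\<in>J. B i \<in> G i"
      show "P.prob (\<Inter>i\<in>J. B i) = (\<Prod>i\<in>J. P.prob (B i))"
      proof (cases "\<exists>i\<in>J. B i = {}")
        case True
        then have "(\<Inter>i\<in>J. B i) = {}" by auto
        with True J show ?thesis by (auto simp: prod_zero_iff intro!: bexI)
      next
        case False
        then have "\<forall>i\<in>J. \<exists>j. B i = E i j" using B unfolding G_def by blast
        then obtain f where f: "\<And>i. i \<in> J \<Longrightarrow> B i = E i (f i)" by metis
        have key: "P.prob (cylinder M (map (\<lambda>i. (A i, f i)) is)) = (\<Prod>i\<in>set is. P.prob (E i (f i)))"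
          if "distinct is" "set is \<subseteq> {..<n}" for "is"
          using that
        proof (induction "is")
          case Nil
          have "cylinder M [] = space P" by (simp add: sp cylinder_def)
          then show ?case by (simp add: P.prob_space)
        next
          case (Cons i "is")
          have "P.prob (cylinder M (map (\<lambda>i. (A i, f i)) (i # is)))
              = P.prob (cylinder M [(A i, f i)] \<inter> cylinder M (map (\<lambda>i. (A i, f i)) is))"
            using cylinder_append[of M "[(A i, f i)]" "map (\<lambda>i. (A i, f i)) is"] by simp
          also have "\<dots> = P.prob (cylinder M [(A i, f i)]) * P.prob (cylinder M (map (\<lambda>i. (A i, f i)) is))"
          proof (rule laplace_law_indep_cylinders[OF P])
            show "\<Union>(fst ` set [(A i, f i)]) \<inter> \<Union>(fst ` set (map (\<lambda>i. (A i, f i)) is)) = {}"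
            proof -
              have "A i \<inter> A k = {}" if "k \<in> set is" for k
                using Cons.prems that by (intro disjoint_family_onD[OF disj]) auto
              then show ?thesis by auto
            qed
          qed (use Cons.prems A in auto)
          finally show ?case using Cons by (simp add: E)
        qed
        obtain "is" where "is": "distinct is" "set is = J" using finite_distinct_list[OF J(3)] by blast
        obtain i0 where "i0 \<in> J" using J(1) by blast
        then have "(\<Inter>i\<in>J. E i (f i)) = cylinder M (map (\<lambda>i. (A i, f i)) is)"
          using "is"(2) by (auto simp: E_def cylinder_def)
        then have "(\<Inter>i\<in>J. B i) = cylinder M (map (\<lambda>i. (A i, f i)) is)"
          using f by simp
        then show ?thesis using key[of "is"] "is" J f by simp
      qed
    qed
    moreover have "Int_stable (G i)" for i
      by (auto simp: Int_stable_def G_def E_def)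
    ultimately have "P.indep_sets (\<lambda>i. sigma_sets (space P) (G i)) {..<n}"
      by (intro P.indep_sets_sigma)
    then show "P.indep_sets (\<lambda>i. {(\<lambda>\<omega>. emeasure \<omega> (A i)) -` B \<inter> space P |B. B \<in> sets borel}) {..<n}"
    proof (rule P.indep_sets_mono_sets)
      fix i assume "i \<in> {..<n}"
      have "{\<omega> \<in> point_configurations M. emeasure \<omega> (A i) = of_nat j} \<in> G i" for j :: nat
        by (auto simp: G_def E_def)
      then show "{(\<lambda>\<omega>. emeasure \<omega> (A i)) -` B \<inter> space P |B. B \<in> sets borel} \<subseteq> sigma_sets (space P) (G i)"
        unfolding sp by (auto intro!: vimage_emeasure_sigma_sets)
    qed
  qed
  then show ?thesis
    unfolding poisson_law_def
    using P.prob_space_axioms sp P laplace_law_poisson[OF P] fin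
    by (auto simp: laplace_law_def)
qed

section \<open>Suspensions and mixing\<close>

lemma measure_preserving_flowD:
  assumes "measure_preserving_flow M T"
  shows "T t \<in> M \<rightarrow>\<^sub>M M" "distr M M (T t) = M" "x \<in> space M \<Longrightarrow> T 0 x = x"
    "x \<in> space M \<Longrightarrow> T (s + t) x = T s (T t x)"
proof -
  have "(\<lambda>(t, x). T t x) \<circ> (\<lambda>x. (t, x)) \<in> M \<rightarrow>\<^sub>M M"
    using assms by (intro measurable_comp[where N="borel \<Otimes>\<^sub>M M"]) (auto simp: measure_preserving_flow_def)
  then show "T t \<in> M \<rightarrow>\<^sub>M M" by (simp add: comp_def)
qed (use assms in \<open>auto simp: measure_preserving_flow_def\<close>)

lemma emeasure_flow_vimage:
  assumes "measure_preserving_flow M T" "A \<in> sets M"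
  shows "emeasure M (T t -` A \<inter> space M) = emeasure M A"
  using emeasure_distr[OF measure_preserving_flowD(1)[OF assms(1)] assms(2), of t]
    measure_preserving_flowD(2)[OF assms(1)] by simp

lemma finite_sets_flow_vimage:
  assumes "measure_preserving_flow M T" "A \<in> finite_sets M"
  shows "T t -` A \<inter> space M \<in> finite_sets M"
  using assms emeasure_flow_vimage[OF assms(1), of A t]
  by (auto simp: finite_sets_def intro: measurable_sets measure_preserving_flowD(1))

lemma emeasure_suspension:
  assumes "measure_preserving_flow M T" "\<omega> \<in> point_configurations M" "A \<in> sets M"
  shows "emeasure (suspension M T t \<omega>) A = emeasure \<omega> (T t -` A \<inter> space M)"
proof -
  have "T t \<in> \<omega> \<rightarrow>\<^sub>M M"
    using measure_preserving_flowD(1)[OF assms(1)] measurable_cong_sets[OF sets_point_configuration[OF assms(2)] refl] by blast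
  then show ?thesis
    unfolding suspension_def using assms sets_eq_imp_space_eq[OF sets_point_configuration[OF assms(2)]]
    by (simp add: emeasure_distr)
qed

lemma suspension_in_point_configurations:
  assumes "measure_preserving_flow M T" "\<omega> \<in> point_configurations M"
  shows "suspension M T t \<omega> \<in> point_configurations M"
proof -
  obtain I :: "nat set" and x where \<omega>: "\<omega> = distr (count_space I) M x" and x: "x \<in> I \<rightarrow> space M"
    using assms(2) by (auto simp: point_configurations_def)
  note T = measure_preserving_flowD(1)[OF assms(1), of t]
  have "suspension M T t \<omega> = distr (count_space I) M (T t \<circ> x)"
    unfolding suspension_def \<omega> using x T by (intro distr_distr) auto
  moreover have "T t \<circ> x \<in> I \<rightarrow> space M" using x measurable_space[OF T] by (auto simp: Pi_iff)
  ultimately show ?thesis unfolding point_configurations_def by blast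
qed

lemma suspension_inverse:
  assumes T: "measure_preserving_flow M T" and \<omega>: "\<omega> \<in> point_configurations M"
  shows "suspension M T t (suspension M T (- t) \<omega>) = \<omega>"
proof (rule measure_eqI)
  note s1 = suspension_in_point_configurations[OF T \<omega>, of "- t"]
  show "sets (suspension M T t (suspension M T (- t) \<omega>)) = sets \<omega>"
    using sets_point_configuration[OF \<omega>] by (simp add: suspension_def)
  fix A assume "A \<in> sets (suspension M T t (suspension M T (- t) \<omega>))"
  then have A: "A \<in> sets M" by (simp add: suspension_def)
  have "T (- t) -` (T t -` A \<inter> space M) \<inter> space M = A"
    using measure_preserving_flowD(3)[OF T] measure_preserving_flowD(4)[OF T, of _ t "- t"]
      measurable_space[OF measure_preserving_flowD(1)[OF T]] sets.sets_into_space[OF A] by auto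
  then show "emeasure (suspension M T t (suspension M T (- t) \<omega>)) A = emeasure \<omega> A"
    using A measurable_sets[OF measure_preserving_flowD(1)[OF T] A]
    by (simp add: emeasure_suspension[OF T s1] emeasure_suspension[OF T \<omega>])
qed

lemma suspension_vimage_cylinder:
  assumes T: "measure_preserving_flow M T" and xs: "fst ` set xs \<subseteq> finite_sets M"
  shows "suspension M T t -` cylinder M xs \<inter> point_configurations M
    = cylinder M (map (\<lambda>(A, j). (T t -` A \<inter> space M, j)) xs)"
proof (rule set_eqI)
  fix \<omega>
  have "(\<forall>x\<in>set xs. emeasure (suspension M T t \<omega>) (fst x) = of_nat (snd x))
      \<longleftrightarrow> (\<forall>x\<in>set xs. emeasure \<omega> (T t -` fst x \<inter> space M) = of_nat (snd x))"
    if "\<omega> \<in> point_configurations M"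
    using xs emeasure_suspension[OF T that] by (intro ball_cong) (auto simp: finite_sets_def image_subset_iff)
  then show "\<omega> \<in> suspension M T t -` cylinder M xs \<inter> point_configurations M
      \<longleftrightarrow> \<omega> \<in> cylinder M (map (\<lambda>(A, j). (T t -` A \<inter> space M, j)) xs)"
    using suspension_in_point_configurations[OF T] by (auto simp: cylinder_def case_prod_beta)
qed

lemma measurable_suspension:
  assumes T: "measure_preserving_flow M T"
  shows "suspension M T t \<in> configuration_space M \<rightarrow>\<^sub>M configuration_space M"
proof (rule measurable_sigma_sets[OF sets_configuration_space])
  show "cylinders M \<subseteq> Pow (point_configurations M)" by (auto simp: cylinders_def cylinder_def)
  show "suspension M T t \<in> space (configuration_space M) \<rightarrow> point_configurations M"
    using suspension_in_point_configurations[OF T] by auto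
  fix X assume "X \<in> cylinders M"
  then obtain xs where X: "X = cylinder M xs" and xs: "fst ` set xs \<subseteq> finite_sets M"
    by (auto simp: cylinders_def)
  have "cylinder M (map (\<lambda>(A, j). (T t -` A \<inter> space M, j)) xs) \<in> cylinders M"
    unfolding cylinders_def using xs finite_sets_flow_vimage[OF T]
    by (intro CollectI exI[of _ "map (\<lambda>(A, j). (T t -` A \<inter> space M, j)) xs"]) (auto simp: image_subset_iff)
  then show "suspension M T t -` X \<inter> space (configuration_space M) \<in> sets (configuration_space M)"
    unfolding X sets_configuration_space space_configuration_space suspension_vimage_cylinder[OF T xs] by auto
qed

lemma laplace_suspension:
  assumes "measure_preserving_flow M T" "set As \<subseteq> finite_sets M" "\<omega> \<in> point_configurations M"
  shows "laplace As (suspension M T t \<omega>) = laplace (map (\<lambda>A. T t -` A \<inter> space M) As) \<omega>"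
  using assms(2) unfolding laplace_def
  by (induction As) (auto simp: emeasure_suspension[OF assms(1,3)] finite_sets_def)

text \<open>The image law has the same Laplace functionals, because pulling the test sets back by
  \<open>T t\<close> does not change the integral of \<open>covered As\<close>; uniqueness then
  identifies it with P.\<close>

lemma laplace_law_suspension:
  assumes T: "measure_preserving_flow M T" and P: "laplace_law M P"
  shows "distr P P (suspension M T t) = P"
proof (rule laplace_law_unique[OF _ P])
  interpret P: prob_space P using P by (simp add: laplace_law_def)
  have S: "suspension M T t \<in> P \<rightarrow>\<^sub>M P"
    using measurable_suspension[OF T] measurable_cong_sets P unfolding laplace_law_def by blast
  show "laplace_law M (distr P P (suspension M T t))"
    unfolding laplace_law_def
  proof (intro conjI allI impI)
    show "prob_space (distr P P (suspension M T t))" using S by (rule P.prob_space_distr)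
    show "sets (distr P P (suspension M T t)) = sets (configuration_space M)"
      using P by (simp add: laplace_law_def)
    fix As assume As: "set As \<subseteq> finite_sets M"
    let ?As = "map (\<lambda>A. T t -` A \<inter> space M) As"
    have As': "set ?As \<subseteq> finite_sets M" using As finite_sets_flow_vimage[OF T] by auto
    have "laplace As \<in> borel_measurable P"
      unfolding measurable_laplace_law[OF P] using As by (rule measurable_laplace)
    then have "(\<integral>\<omega>. laplace As \<omega> \<partial>distr P P (suspension M T t)) = (\<integral>\<omega>. laplace As (suspension M T t \<omega>) \<partial>P)"
      using S by (rule integral_distr[rotated])
    also have "\<dots> = (\<integral>\<omega>. laplace ?As \<omega> \<partial>P)"
      by (intro Bochner_Integration.integral_cong) (auto simp: laplace_law_space[OF P] laplace_suspension[OF T As])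
    also have "\<dots> = exp (- (\<integral>x. covered ?As x \<partial>M))"
      using P As' unfolding laplace_law_def by blast
    also have "(\<integral>x. covered ?As x \<partial>M) = (\<integral>x. covered As (T t x) \<partial>M)"
    proof (intro Bochner_Integration.integral_cong refl)
      fix x assume "x \<in> space M"
      then show "covered ?As x = covered As (T t x)"
        unfolding covered_def by (induction As) (auto simp: indicator_def comp_def)
    qed
    also have "\<dots> = (\<integral>x. covered As x \<partial>distr M M (T t))"
      using As by (intro integral_distr[symmetric] measure_preserving_flowD(1)[OF T] measurable_covered)
        (auto simp: finite_sets_def)
    also have "\<dots> = (\<integral>x. covered As x \<partial>M)" by (simp add: measure_preserving_flowD(2)[OF T])
    finally show "(\<integral>\<omega>. laplace As \<omega> \<partial>distr P P (suspension M T t)) = exp (- (\<integral>x. covered As x \<partial>M))" .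
  qed
qed

text \<open>The good sets form a Dynkin system. The point is the countable disjoint union:
  domination by N makes the tail \<open>R k\<close> small for all n at once, so finitely many pieces
  decide the limit. This serves for mixing and for \<open>tendsto_first_piece\<close>.\<close>

lemma tendsto_measure_generator:
  fixes m :: "nat \<Rightarrow> 'a set \<Rightarrow> real"
  assumes N: "finite_measure N"
    and gen: "sets N = sigma_sets \<Omega> G" "Int_stable G" "G \<subseteq> Pow \<Omega>" "\<Omega> \<in> G"
    and nonneg: "\<And>n A. A \<in> sets N \<Longrightarrow> 0 \<le> m n A"
    and dom: "\<And>n A. A \<in> sets N \<Longrightarrow> m n A \<le> measure N A"
    and additive: "\<And>n A B. A \<in> sets N \<Longrightarrow> B \<in> sets N \<Longrightarrow> A \<inter> B = {} \<Longrightarrow> m n (A \<union> B) = m n A + m n B"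
    and conv: "\<And>A. A \<in> G \<Longrightarrow> (\<lambda>n. m n A) \<longlonglongrightarrow> c * measure N A"
    and A: "A \<in> sets N"
  shows "(\<lambda>n. m n A) \<longlonglongrightarrow> c * measure N A"
  using gen(2,3) A[unfolded gen(1)]
proof (induction rule: sigma_sets_induct_disjoint)
  case (basic A)
  then show ?case by (rule conv)
next
  case empty
  have "m n {} = 0" for n using nonneg[of "{}" n] dom[of "{}" n] by simp
  then show ?case by simp
next
  interpret finite_measure N by fact
  have sp: "space N = \<Omega>" using gen(1,3) sets_measure_of[OF gen(3), of "\<lambda>_. 0"]
    by (metis sets_eq_imp_space_eq space_measure_of)
  case (compl A)
  have A: "A \<in> sets N" and O: "\<Omega> \<in> sets N" using compl gen by auto
  have sub: "A \<subseteq> \<Omega>" using A sets.sets_into_space sp by auto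
  have "m n (\<Omega> - A) = m n \<Omega> - m n A" for n
    using additive[of "\<Omega> - A" A n] A O sub by (simp add: Un_absorb2 Diff_disjoint Int_commute[of "\<Omega> - A"])
  moreover have "measure N (\<Omega> - A) = measure N \<Omega> - measure N A"
    using A O sub by (intro finite_measure_Diff)
  ultimately show ?case
    using tendsto_diff[OF conv[OF gen(4)] compl(2)] by (simp add: right_diff_distrib)
next
  interpret finite_measure N by fact
  case (union A)
  have A: "A i \<in> sets N" for i using union gen by auto
  define R where "R k = (\<Union>i. A (i + k))" for k
  have R: "R k \<in> sets N" for k using A unfolding R_def by auto
  have split: "(\<Union>i. A i) = (\<Union>i<k. A i) \<union> R k" "(\<Union>i<k. A i) \<inter> R k = {}" for k
  proof -
    have "i < k \<or> (\<exists>j. i = j + k)" for i using le_Suc_ex[of k i] by (cases "i < k") (auto simp: add.commute)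
    then show "(\<Union>i. A i) = (\<Union>i<k. A i) \<union> R k" unfolding R_def by blast
    have "A i \<inter> A (j + k) = {}" if "i < k" for i j
      using disjoint_family_onD[OF union(1), of i "j + k"] that by auto
    then show "(\<Union>i<k. A i) \<inter> R k = {}" unfolding R_def by blast
  qed
  have fin: "f (\<Union>i<k. A i) = (\<Sum>i<k. f (A i))"
    if f0: "f {} = (0::real)" and f: "\<And>B C. B \<in> sets N \<Longrightarrow> C \<in> sets N \<Longrightarrow> B \<inter> C = {} \<Longrightarrow> f (B \<union> C) = f B + f C" for f k
  proof (induction k)
    case (Suc k)
    have "A i \<inter> A k = {}" if "i < k" for i
      using disjoint_family_onD[OF union(1), of i k] that by auto
    then have "(\<Union>i<k. A i) \<inter> A k = {}" by blast
    then have "f ((\<Union>i<k. A i) \<union> A k) = f (\<Union>i<k. A i) + f (A k)" using A by (intro f) auto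
    then show ?case using Suc by (simp add: lessThan_Suc Un_commute add.commute)
  qed (simp add: f0)
  have m0: "m n {} = 0" for n using nonneg[of "{}" n] dom[of "{}" n] by simp
  have U: "(\<Union>i<k. A i) \<in> sets N" for k using A by auto
  have finm: "m n (\<Union>i<k. A i) = (\<Sum>i<k. m n (A i))" for n k
    by (rule fin) (auto intro: m0 additive)
  have finN: "measure N (\<Union>i<k. A i) = (\<Sum>i<k. measure N (A i))" for k
    by (rule fin) (auto intro: finite_measure_Union)
  have Rlim: "(\<lambda>k. measure N (R k)) \<longlonglongrightarrow> 0"
  proof -
    have "(\<lambda>k. \<Sum>i<k. measure N (A i)) \<longlonglongrightarrow> measure N (\<Union>i. A i)"
      using finite_measure_UNION[of A] A union(1) unfolding sums_def by auto
    moreover have "measure N (R k) = measure N (\<Union>i. A i) - (\<Sum>i<k. measure N (A i))" for k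
      unfolding split(1)[of k] finite_measure_Union[OF U R split(2)] finN by simp
    ultimately show ?thesis
      using tendsto_diff[OF tendsto_const[of "measure N (\<Union>i. A i)" sequentially], of _ "measure N (\<Union>i. A i)"]
      by simp
  qed
  show ?case
  proof (rule LIMSEQ_I)
    fix r :: real assume r: "0 < r"
    have "(\<lambda>k. (1 + \<bar>c\<bar>) * measure N (R k)) \<longlonglongrightarrow> (1 + \<bar>c\<bar>) * 0" by (intro tendsto_mult_left Rlim)
    then have "eventually (\<lambda>k. (1 + \<bar>c\<bar>) * measure N (R k) < r / 2) sequentially"
      by (rule order_tendstoD(2)) (use r in simp)
    then obtain k where k: "(1 + \<bar>c\<bar>) * measure N (R k) < r / 2"
      by (auto simp: eventually_sequentially)
    have "(\<lambda>n. \<Sum>i<k. m n (A i)) \<longlonglongrightarrow> (\<Sum>i<k. c * measure N (A i))"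
      by (intro tendsto_sum union)
    from LIMSEQ_D[OF this half_gt_zero[OF r]] obtain n0 where
      n0: "\<And>n. n \<ge> n0 \<Longrightarrow> \<bar>(\<Sum>i<k. m n (A i)) - (\<Sum>i<k. c * measure N (A i))\<bar> < r / 2"
      unfolding real_norm_def by blast
    show "\<exists>n0. \<forall>n\<ge>n0. norm (m n (\<Union>i. A i) - c * measure N (\<Union>i. A i)) < r"
    proof (intro exI allI impI)
      fix n assume "n \<ge> n0"
      note n = n0[OF this]
      have "m n (\<Union>i. A i) = (\<Sum>i<k. m n (A i)) + m n (R k)"
        unfolding split(1)[of k] additive[OF U R split(2)] finm ..
      moreover have "measure N (\<Union>i. A i) = (\<Sum>i<k. measure N (A i)) + measure N (R k)"
        unfolding split(1)[of k] finite_measure_Union[OF U R split(2)] finN ..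
      ultimately have "m n (\<Union>i. A i) - c * measure N (\<Union>i. A i) =
          ((\<Sum>i<k. m n (A i)) - (\<Sum>i<k. c * measure N (A i))) + (m n (R k) - c * measure N (R k))"
        by (simp add: sum_distrib_left algebra_simps)
      moreover have "\<bar>m n (R k) - c * measure N (R k)\<bar> \<le> (1 + \<bar>c\<bar>) * measure N (R k)"
      proof -
        have "\<bar>m n (R k) - c * measure N (R k)\<bar> \<le> \<bar>m n (R k)\<bar> + \<bar>c\<bar> * measure N (R k)"
          using abs_triangle_ineq4[of "m n (R k)" "c * measure N (R k)"] by (simp add: abs_mult)
        then show ?thesis using nonneg[OF R[of k], of n] dom[OF R[of k], of n] by (simp add: algebra_simps)
      qed
      ultimately show "norm (m n (\<Union>i. A i) - c * measure N (\<Union>i. A i)) < r"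
        unfolding real_norm_def using n k by linarith
    qed
  qed
qed

section \<open>Mixing of the suspension along a sequence of times\<close>

locale mixing_base =
  fixes M :: "'a measure" and T :: "real \<Rightarrow> 'a \<Rightarrow> 'a" and P :: "'a measure measure" and \<tau> :: "nat \<Rightarrow> real"
  assumes T: "measure_preserving_flow M T" and P: "laplace_law M P"
    and zero_type: "\<And>A B. A \<in> finite_sets M \<Longrightarrow> B \<in> finite_sets M \<Longrightarrow>
      (\<lambda>n. measure M (A \<inter> (T (\<tau> n) -` B \<inter> space M))) \<longlonglongrightarrow> 0"
begin

sublocale P: prob_space P
  using P by (simp add: laplace_law_def)

abbreviation "S \<equiv> suspension M T"

lemma space_P: "space P = point_configurations M"
  by (rule laplace_law_space[OF P])

lemma measurable_S [measurable]: "S t \<in> P \<rightarrow>\<^sub>M P"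
  using measurable_suspension[OF T] measurable_cong_sets P unfolding laplace_law_def by blast

lemma distr_S: "distr P P (S t) = P"
  by (rule laplace_law_suspension[OF T P])

lemma measurable_laplace_P: "set As \<subseteq> finite_sets M \<Longrightarrow> laplace As \<in> borel_measurable P"
  unfolding measurable_laplace_law[OF P] by (rule measurable_laplace)

lemma measure_S_vimage:
  assumes "A \<in> sets P"
  shows "measure P (S t -` A \<inter> space P) = measure P A"
  using measure_distr[OF measurable_S assms, of t] by (simp add: distr_S)

text \<open>By \<open>laplace_law_append\<close> the covariance is at most the measure of the part
  of one finite set that is carried into another at time \<tau> n, and \<open>zero_type\<close>
  makes this vanish.\<close>

lemma laplace_mixing:
  assumes As: "set As \<subseteq> finite_sets M" and Bs: "set Bs \<subseteq> finite_sets M"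
  shows "(\<lambda>n. \<integral>\<omega>. laplace As \<omega> * laplace Bs (S (\<tau> n) \<omega>) \<partial>P) \<longlonglongrightarrow>
    (\<integral>\<omega>. laplace As \<omega> \<partial>P) * (\<integral>\<omega>. laplace Bs \<omega> \<partial>P)"
proof -
  define Cs where "Cs n = map (\<lambda>A. T (\<tau> n) -` A \<inter> space M) Bs" for n
  have Cs: "set (Cs n) \<subseteq> finite_sets M" for n
    using Bs finite_sets_flow_vimage[OF T] by (auto simp: Cs_def)
  have 1: "(\<integral>\<omega>. laplace As \<omega> * laplace Bs (S (\<tau> n) \<omega>) \<partial>P) = (\<integral>\<omega>. laplace As \<omega> * laplace (Cs n) \<omega> \<partial>P)" for n
    by (intro Bochner_Integration.integral_cong) (auto simp: space_P laplace_suspension[OF T Bs] Cs_def)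
  have 2: "(\<integral>\<omega>. laplace (Cs n) \<omega> \<partial>P) = (\<integral>\<omega>. laplace Bs \<omega> \<partial>P)" for n
  proof -
    have "(\<integral>\<omega>. laplace (Cs n) \<omega> \<partial>P) = (\<integral>\<omega>. laplace Bs (S (\<tau> n) \<omega>) \<partial>P)"
      by (intro Bochner_Integration.integral_cong) (auto simp: space_P laplace_suspension[OF T Bs] Cs_def)
    also have "\<dots> = (\<integral>\<omega>. laplace Bs \<omega> \<partial>distr P P (S (\<tau> n)))"
      by (intro integral_distr[symmetric] measurable_laplace_P Bs measurable_S)
    finally show ?thesis by (simp add: distr_S)
  qed
  have 3: "\<bar>(\<integral>\<omega>. laplace As \<omega> * laplace (Cs n) \<omega> \<partial>P) - (\<integral>\<omega>. laplace As \<omega> \<partial>P) * (\<integral>\<omega>. laplace Bs \<omega> \<partial>P)\<bar>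
      \<le> measure M (\<Union>(set As) \<inter> (T (\<tau> n) -` \<Union>(set Bs) \<inter> space M))" for n
  proof -
    have "\<Union>(set (Cs n)) = T (\<tau> n) -` \<Union>(set Bs) \<inter> space M" by (auto simp: Cs_def)
    with laplace_law_append[OF P As Cs[of n]] show ?thesis by (simp add: 2)
  qed
  have "(\<lambda>n. (\<integral>\<omega>. laplace As \<omega> * laplace (Cs n) \<omega> \<partial>P) - (\<integral>\<omega>. laplace As \<omega> \<partial>P) * (\<integral>\<omega>. laplace Bs \<omega> \<partial>P)) \<longlonglongrightarrow> 0"
    by (rule Lim_null_comparison[OF _ zero_type[OF Union_finite_sets[OF As] Union_finite_sets[OF Bs]]])
      (use 3 in auto)
  then show ?thesis unfolding 1 by (simp add: LIM_zero_iff)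
qed

lemma integral_laplace_bounds:
  assumes "set As \<subseteq> finite_sets M"
  shows "0 \<le> (\<integral>\<omega>. laplace As \<omega> \<partial>P) \<and> (\<integral>\<omega>. laplace As \<omega> \<partial>P) \<le> 1"
proof
  show "0 \<le> (\<integral>\<omega>. laplace As \<omega> \<partial>P)" by (intro Bochner_Integration.integral_nonneg) (simp add: laplace_bounds)
  have "(\<integral>\<omega>. laplace As \<omega> \<partial>P) \<le> (\<integral>\<omega>. 1 \<partial>P)"
    using measurable_laplace_P[OF assms]
    by (intro Bochner_Integration.integral_mono P.integrable_const_bound[where B=1]) (auto simp: laplace_bounds)
  then show "(\<integral>\<omega>. laplace As \<omega> \<partial>P) \<le> 1" by (simp add: P.prob_space)
qed

text \<open>Indicators are substituted in the factor that is not composed with the flow. Once the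
  first factor is done, invariance under \<open>S (- \<tau> n)\<close> moves the flow to the other
  factor, so that the same substitution applies to what remains; hence the negative times.\<close>

lemma cylinder_mixing:
  assumes xs: "fst ` set xs \<subseteq> finite_sets M" and ys: "fst ` set ys \<subseteq> finite_sets M"
  shows "(\<lambda>n. measure P (cylinder M ys \<inter> (S (- \<tau> n) -` cylinder M xs \<inter> space P))) \<longlonglongrightarrow>
    measure P (cylinder M xs) * measure P (cylinder M ys)"
proof -
  note cyl = cylinder_sets_laplace_law[OF P]
  have [measurable]: "cylinder M xs \<in> sets P" using cyl[OF xs] .
  have step: "(\<lambda>n. \<integral>\<omega>. laplace Bs \<omega> * indicator (cylinder M xs) (S (- \<tau> n) \<omega>) \<partial>P) \<longlonglongrightarrow>
      measure P (cylinder M xs) * (\<integral>\<omega>. laplace Bs \<omega> \<partial>P)"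
    if Bs: "set Bs \<subseteq> finite_sets M" for Bs
  proof -
    have [measurable]: "laplace Bs \<in> borel_measurable P" using Bs by (rule measurable_laplace_P)
    have "(\<lambda>n. \<integral>\<omega>. indicator (cylinder M xs) \<omega> * laplace Bs (S (\<tau> n) \<omega>) \<partial>P) \<longlonglongrightarrow>
        (\<integral>\<omega>. laplace Bs \<omega> \<partial>P) * measure P (cylinder M xs)"
    proof (rule tendsto_integral_cylinder[OF P P.prob_space_axioms refl subset_refl _ _ _ _ xs])
      fix As assume "set As \<subseteq> finite_sets M"
      from laplace_mixing[OF this Bs]
      show "(\<lambda>n. \<integral>\<omega>. laplace As \<omega> * laplace Bs (S (\<tau> n) \<omega>) \<partial>P) \<longlonglongrightarrow>
          (\<integral>\<omega>. laplace Bs \<omega> \<partial>P) * (\<integral>\<omega>. laplace As \<omega> \<partial>P)" by (simp add: mult.commute)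
    qed (use Bs integral_laplace_bounds in \<open>auto simp: laplace_bounds\<close>)
    moreover have "(\<integral>\<omega>. indicator (cylinder M xs) \<omega> * laplace Bs (S (\<tau> n) \<omega>) \<partial>P)
        = (\<integral>\<omega>. laplace Bs \<omega> * indicator (cylinder M xs) (S (- \<tau> n) \<omega>) \<partial>P)" for n
    proof -
      have "(\<integral>\<omega>. indicator (cylinder M xs) \<omega> * laplace Bs (S (\<tau> n) \<omega>) \<partial>P)
          = (\<integral>\<omega>. indicator (cylinder M xs) \<omega> * laplace Bs (S (\<tau> n) \<omega>) \<partial>distr P P (S (- \<tau> n)))"
        by (simp add: distr_S)
      also have "\<dots> = (\<integral>\<omega>. indicator (cylinder M xs) (S (- \<tau> n) \<omega>) * laplace Bs (S (\<tau> n) (S (- \<tau> n) \<omega>)) \<partial>P)"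
        by (rule integral_distr) measurable
      also have "\<dots> = (\<integral>\<omega>. laplace Bs \<omega> * indicator (cylinder M xs) (S (- \<tau> n) \<omega>) \<partial>P)"
        by (intro Bochner_Integration.integral_cong) (auto simp: space_P suspension_inverse[OF T])
      finally show ?thesis .
    qed
    ultimately show ?thesis by (simp add: mult.commute)
  qed
  have "(\<lambda>n. \<integral>\<omega>. indicator (cylinder M ys) \<omega> * indicator (cylinder M xs) (S (- \<tau> n) \<omega>) \<partial>P) \<longlonglongrightarrow>
      measure P (cylinder M xs) * measure P (cylinder M ys)"
    by (rule tendsto_integral_cylinder[OF P P.prob_space_axioms refl subset_refl _ _ _ _ ys])
      (use step in \<open>auto simp: indicator_def\<close>)
  moreover have "(\<integral>\<omega>. indicator (cylinder M ys) \<omega> * indicator (cylinder M xs) (S (- \<tau> n) \<omega>) \<partial>P)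
      = measure P (cylinder M ys \<inter> (S (- \<tau> n) -` cylinder M xs \<inter> space P))" for n
  proof -
    have "(\<integral>\<omega>. indicator (cylinder M ys) \<omega> * indicator (cylinder M xs) (S (- \<tau> n) \<omega>) \<partial>P)
        = (\<integral>\<omega>. indicat_real (cylinder M ys \<inter> (S (- \<tau> n) -` cylinder M xs \<inter> space P)) \<omega> \<partial>P)"
      by (intro Bochner_Integration.integral_cong) (auto simp: indicator_def)
    then show ?thesis
      using sets.sets_into_space[OF cyl[OF ys]] by (simp add: Int_absorb2 le_infI1)
  qed
  ultimately show ?thesis by simp
qed

end

text \<open>Two applications of \<open>tendsto_measure_generator\<close>, one in each argument. The
  generators are the cylinders for P and the rectangles for the product of P with itself.\<close>

lemma mixing_generator:
  fixes S :: "nat \<Rightarrow> 'b \<Rightarrow> 'b"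
  assumes N: "prob_space N"
    and gen: "sets N = sigma_sets \<Omega> G" "Int_stable G" "G \<subseteq> Pow \<Omega>" "\<Omega> \<in> G"
    and S: "\<And>n. S n \<in> N \<rightarrow>\<^sub>M N" "\<And>n A. A \<in> sets N \<Longrightarrow> measure N (S n -` A \<inter> space N) = measure N A"
    and conv: "\<And>A B. A \<in> G \<Longrightarrow> B \<in> G \<Longrightarrow>
      (\<lambda>n. measure N (A \<inter> (S n -` B \<inter> space N))) \<longlonglongrightarrow> measure N B * measure N A"
    and A: "A \<in> sets N" and B: "B \<in> sets N"
  shows "(\<lambda>n. measure N (A \<inter> (S n -` B \<inter> space N))) \<longlonglongrightarrow> measure N B * measure N A"
proof -
  interpret prob_space N by fact
  have G: "G \<subseteq> sets N" using gen by auto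
  have V: "S n -` B \<inter> space N \<in> sets N" if "B \<in> sets N" for B n
    using measurable_sets[OF S(1) that] .
  have 1: "(\<lambda>n. measure N (A \<inter> (S n -` B \<inter> space N))) \<longlonglongrightarrow> measure N B * measure N A"
    if "A \<in> sets N" "B \<in> G" for A B
  proof (rule tendsto_measure_generator[OF finite_measure_axioms gen, where m="\<lambda>n A. measure N (A \<inter> (S n -` B \<inter> space N))"])
    have B: "S n -` B \<inter> space N \<in> sets N" for n using V that G by blast
    fix n A assume A: "A \<in> sets N"
    show "measure N (A \<inter> (S n -` B \<inter> space N)) \<le> measure N A"
      using A by (intro finite_measure_mono) auto
    fix A' assume A': "A' \<in> sets N" "A \<inter> A' = {}"
    show "measure N ((A \<union> A') \<inter> (S n -` B \<inter> space N))
        = measure N (A \<inter> (S n -` B \<inter> space N)) + measure N (A' \<inter> (S n -` B \<inter> space N))"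
      unfolding Int_Un_distrib2 using A A' B[of n] by (intro finite_measure_Union) auto
  qed (use that conv in auto)
  have "(\<lambda>n. measure N (A \<inter> (S n -` B \<inter> space N))) \<longlonglongrightarrow> measure N A * measure N B"
  proof (rule tendsto_measure_generator[OF finite_measure_axioms gen, where m="\<lambda>n B. measure N (A \<inter> (S n -` B \<inter> space N))"])
    fix n B assume B: "B \<in> sets N"
    have "measure N (A \<inter> (S n -` B \<inter> space N)) \<le> measure N (S n -` B \<inter> space N)"
      using V[OF B] by (intro finite_measure_mono) auto
    then show "measure N (A \<inter> (S n -` B \<inter> space N)) \<le> measure N B" by (simp add: S(2)[OF B])
    fix B' assume B': "B' \<in> sets N" "B \<inter> B' = {}"
    have "measure N ((A \<inter> (S n -` B \<inter> space N)) \<union> (A \<inter> (S n -` B' \<inter> space N)))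
        = measure N (A \<inter> (S n -` B \<inter> space N)) + measure N (A \<inter> (S n -` B' \<inter> space N))"
      using A V[OF B, of n] V[OF B'(1), of n] B' by (intro finite_measure_Union) auto
    moreover have "A \<inter> (S n -` (B \<union> B') \<inter> space N) = (A \<inter> (S n -` B \<inter> space N)) \<union> (A \<inter> (S n -` B' \<inter> space N))"
      by auto
    ultimately show "measure N (A \<inter> (S n -` (B \<union> B') \<inter> space N))
        = measure N (A \<inter> (S n -` B \<inter> space N)) + measure N (A \<inter> (S n -` B' \<inter> space N))" by simp
  next
    fix B assume "B \<in> G"
    from 1[OF A this] show "(\<lambda>n. measure N (A \<inter> (S n -` B \<inter> space N))) \<longlonglongrightarrow> measure N A * measure N B"
      by (simp add: mult.commute)
  qed (use B in auto)
  then show ?thesis by (simp add: mult.commute)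
qed

context mixing_base
begin

lemma mixing:
  assumes "A \<in> sets P" "B \<in> sets P"
  shows "(\<lambda>n. measure P (A \<inter> (S (- \<tau> n) -` B \<inter> space P))) \<longlonglongrightarrow> measure P B * measure P A"
proof (rule mixing_generator[OF P.prob_space_axioms _ Int_stable_cylinders _ space_in_cylinders _ _ _ assms])
  show "sets P = sigma_sets (point_configurations M) (cylinders M)"
    using P by (simp add: laplace_law_def sets_configuration_space)
  show "cylinders M \<subseteq> Pow (point_configurations M)" by (auto simp: cylinders_def cylinder_def)
qed (auto simp: cylinders_def measure_S_vimage intro: cylinder_mixing)

text \<open>Mixing along common times passes to the square because everything factorises on
  rectangles. An invariant set of measure m then satisfies m = m * m.\<close>

lemma weakly_mixing: "weakly_mixing_flow P S"
  unfolding weakly_mixing_flow_def ergodic_flow_def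
proof (intro ballI impI)
  let ?N = "P \<Otimes>\<^sub>M P"
  let ?S = "\<lambda>t (x, y). (S t x, S t y)"
  interpret PP: pair_prob_space P P ..
  have S2 [measurable]: "?S t \<in> ?N \<rightarrow>\<^sub>M ?N" for t by measurable
  have distr2: "distr ?N ?N (?S t) = ?N" for t
    using pair_measure_distr[of "S t" P P "S t" P P] distr_S
    by (simp add: P.prob_space_axioms prob_space_imp_sigma_finite)
  have mS: "measure ?N (?S t -` A \<inter> space ?N) = measure ?N A" if "A \<in> sets ?N" for A t
    using measure_distr[OF S2 that, of t] by (simp add: distr2)
  have mT: "measure ?N (a \<times> b) = measure P a * measure P b" if "a \<in> sets P" "b \<in> sets P" for a b
    using that by (simp add: measure_def P.emeasure_pair_measure_Times enn2real_mult)
  fix A assume A: "A \<in> sets ?N" and inv: "\<forall>t. AE x in ?N. (?S t x \<in> A) = (x \<in> A)"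
  have "(\<lambda>n. measure ?N (A \<inter> (?S (- \<tau> n) -` A \<inter> space ?N))) \<longlonglongrightarrow> measure ?N A * measure ?N A"
  proof (rule mixing_generator[OF PP.prob_space_axioms sets_pair_measure Int_stable_pair_measure_generator _ _ S2 mS _ A A])
    show "{a \<times> b |a b. a \<in> sets P \<and> b \<in> sets P} \<subseteq> Pow (space P \<times> space P)"
      using sets.sets_into_space by blast
    show "space P \<times> space P \<in> {a \<times> b |a b. a \<in> sets P \<and> b \<in> sets P}" by blast
    fix B C assume "B \<in> {a \<times> b |a b. a \<in> sets P \<and> b \<in> sets P}" "C \<in> {a \<times> b |a b. a \<in> sets P \<and> b \<in> sets P}"
    then obtain a b c d where B: "B = a \<times> b" and C: "C = c \<times> d"
      and s: "a \<in> sets P" "b \<in> sets P" "c \<in> sets P" "d \<in> sets P" by auto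
    have "B \<inter> (?S (- \<tau> n) -` C \<inter> space ?N) =
        (a \<inter> (S (- \<tau> n) -` c \<inter> space P)) \<times> (b \<inter> (S (- \<tau> n) -` d \<inter> space P))" for n
      unfolding B C by (auto simp: space_pair_measure)
    then have "measure ?N (B \<inter> (?S (- \<tau> n) -` C \<inter> space ?N)) =
        measure P (a \<inter> (S (- \<tau> n) -` c \<inter> space P)) * measure P (b \<inter> (S (- \<tau> n) -` d \<inter> space P))" for n
      using s measurable_sets[OF measurable_S] by (simp add: mT sets.Int)
    moreover have "(\<lambda>n. measure P (a \<inter> (S (- \<tau> n) -` c \<inter> space P)) * measure P (b \<inter> (S (- \<tau> n) -` d \<inter> space P)))
        \<longlonglongrightarrow> (measure P c * measure P a) * (measure P d * measure P b)"
      by (intro tendsto_mult mixing s)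
    ultimately show "(\<lambda>n. measure ?N (B \<inter> (?S (- \<tau> n) -` C \<inter> space ?N))) \<longlonglongrightarrow> measure ?N C * measure ?N B"
      using s by (simp add: B C mT mult.commute mult.left_commute)
  qed
  moreover have "measure ?N (A \<inter> (?S t -` A \<inter> space ?N)) = measure ?N A" for t
  proof (rule measure_eq_AE)
    show "AE x in ?N. (x \<in> A \<inter> (?S t -` A \<inter> space ?N)) = (x \<in> A)"
      using inv[rule_format, of t] AE_space by eventually_elim auto
    show "A \<inter> (?S t -` A \<inter> space ?N) \<in> sets ?N" using A measurable_sets[OF S2 A] by blast
  qed (rule A)
  ultimately have "measure ?N A = measure ?N A * measure ?N A"
    by (simp add: LIMSEQ_const_iff)
  then have "measure ?N A = 1 \<or> measure ?N A = 0" by auto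
  then show "(AE x in ?N. x \<in> A) \<or> (AE x in ?N. x \<notin> A)"
    using PP.prob_eq_1[OF A] PP.prob_eq_0[OF A] by auto
qed

end

section \<open>Existence of the Poisson law\<close>

lemma nn_integral_PiM_prod_coordinates:
  fixes N :: "'i \<Rightarrow> 'b measure"
  assumes N: "\<And>i. prob_space (N i)" and J: "finite J"
    and f: "\<And>i. i \<in> J \<Longrightarrow> f i \<in> borel_measurable (N i)"
  shows "(\<integral>\<^sup>+\<omega>. (\<Prod>i\<in>J. f i (\<omega> i)) \<partial>PiM UNIV N) = (\<Prod>i\<in>J. \<integral>\<^sup>+x. f i x \<partial>N i)"
proof -
  interpret product_prob_space N UNIV using N by (simp add: product_prob_spaceI)
  have m1: "(\<lambda>\<omega>. \<Prod>i\<in>J. f i (\<omega> i)) \<in> borel_measurable (PiM J N)"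
  proof (rule borel_measurable_prod_ennreal)
    fix i assume i: "i \<in> J"
    show "(\<lambda>\<omega>. f i (\<omega> i)) \<in> borel_measurable (PiM J N)"
      using measurable_compose[OF measurable_component_singleton[of i J N, OF i] f[OF i]] by simp
  qed
  have m2: "(\<lambda>x. restrict x J) \<in> PiM UNIV N \<rightarrow>\<^sub>M PiM J N"
    by (rule measurable_restrict_subset) simp
  have "(\<Prod>i\<in>J. \<integral>\<^sup>+x. f i x \<partial>N i) = (\<integral>\<^sup>+\<omega>. (\<Prod>i\<in>J. f i (\<omega> i)) \<partial>PiM J N)"
    by (rule product_nn_integral_prod[symmetric]) (use J f in auto)
  also have "\<dots> = (\<integral>\<^sup>+\<omega>. (\<Prod>i\<in>J. f i (\<omega> i)) \<partial>distr (PiM UNIV N) (PiM J N) (\<lambda>x. restrict x J))"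
    using distr_PiM_restrict_finite[OF J subset_UNIV] by simp
  also have "\<dots> = (\<integral>\<^sup>+\<omega>. (\<Prod>i\<in>J. f i (restrict \<omega> J i)) \<partial>PiM UNIV N)"
    by (rule nn_integral_distr[OF m2]) (simp add: m1)
  also have "\<dots> = (\<integral>\<^sup>+\<omega>. (\<Prod>i\<in>J. f i (\<omega> i)) \<partial>PiM UNIV N)"
    by (intro nn_integral_cong prod.cong) auto
  finally show ?thesis ..
qed

text \<open>A Poisson process of finite intensity c * p: a Poisson number of points, taken from the
  start of an independent infinite i.i.d. sequence.\<close>

definition poisson_block :: "real \<Rightarrow> 'a measure \<Rightarrow> (nat \<times> (nat \<Rightarrow> 'a)) measure" where
  "poisson_block c p = measure_pmf (poisson_distribution c) \<Otimes>\<^sub>M PiM UNIV (\<lambda>_. p)"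

lemma measurable_poisson_block:
  assumes "\<And>n. (\<lambda>x. f (n, x)) \<in> PiM UNIV (\<lambda>_. p) \<rightarrow>\<^sub>M K"
  shows "f \<in> poisson_block c p \<rightarrow>\<^sub>M K"
proof -
  have "sets (poisson_block c p) = sets (count_space UNIV \<Otimes>\<^sub>M PiM UNIV (\<lambda>_::nat. p))"
    unfolding poisson_block_def by (intro sets_pair_measure_cong) auto
  then show ?thesis
    using measurable_pair_measure_countable1[of UNIV f "PiM UNIV (\<lambda>_. p)" K] assms measurable_cong_sets by blast
qed

lemma prob_space_poisson_block:
  assumes "prob_space p"
  shows "prob_space (poisson_block c p)"
proof -
  interpret p: prob_space p by fact
  interpret Pi: prob_space "PiM UNIV (\<lambda>_::nat. p)" by (intro prob_space_PiM) (rule p.prob_space_axioms)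
  interpret pair_prob_space "measure_pmf (poisson_distribution c)" "PiM UNIV (\<lambda>_::nat. p)" ..
  show ?thesis unfolding poisson_block_def by (rule prob_space_axioms)
qed

text \<open>Given that there are n points, the product has expectation (\<integral>g dp)^n, and
  averaging over n evaluates the generating function of the Poisson distribution.\<close>

lemma nn_integral_poisson_block:
  fixes g :: "'a \<Rightarrow> real"
  assumes p: "prob_space p" and c: "0 \<le> c" and g: "g \<in> borel_measurable p" "\<And>x. 0 \<le> g x" "\<And>x. g x \<le> 1"
  shows "(\<integral>\<^sup>+\<omega>. (\<Prod>j<fst \<omega>. ennreal (g (snd \<omega> j))) \<partial>poisson_block c p)
    = ennreal (exp (c * ((\<integral>x. g x \<partial>p) - 1)))"
proof -
  interpret p: prob_space p by fact
  interpret Pi: prob_space "PiM UNIV (\<lambda>_::nat. p)" by (intro prob_space_PiM) (rule p.prob_space_axioms)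
  note g(1)[measurable]
  have m: "(\<lambda>\<omega>. \<Prod>j<fst \<omega>. ennreal (g (snd \<omega> j))) \<in> borel_measurable (poisson_block c p)"
    by (rule measurable_poisson_block) simp
  have int: "integrable p g" using g by (intro p.integrable_const_bound[where B=1]) auto
  have "(\<integral>\<^sup>+\<omega>. (\<Prod>j<fst \<omega>. ennreal (g (snd \<omega> j))) \<partial>poisson_block c p)
      = (\<integral>\<^sup>+n. \<integral>\<^sup>+x. (\<Prod>j<n. ennreal (g (x j))) \<partial>PiM UNIV (\<lambda>_. p) \<partial>measure_pmf (poisson_distribution c))"
    using m unfolding poisson_block_def by (subst Pi.nn_integral_fst[symmetric]) auto
  also have "\<dots> = (\<integral>\<^sup>+n. ennreal (\<integral>x. g x \<partial>p) ^ n \<partial>measure_pmf (poisson_distribution c))"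
  proof (intro nn_integral_cong)
    fix n
    have "(\<integral>\<^sup>+x. (\<Prod>j<n. ennreal (g (x j))) \<partial>PiM UNIV (\<lambda>_::nat. p)) = (\<Prod>j<n. \<integral>\<^sup>+x. ennreal (g x) \<partial>p)"
      by (rule nn_integral_PiM_prod_coordinates[OF p]) auto
    also have "(\<integral>\<^sup>+x. ennreal (g x) \<partial>p) = ennreal (\<integral>x. g x \<partial>p)"
      using int g by (intro nn_integral_eq_integral) auto
    finally show "(\<integral>\<^sup>+x. (\<Prod>j<n. ennreal (g (x j))) \<partial>PiM UNIV (\<lambda>_. p)) = ennreal (\<integral>x. g x \<partial>p) ^ n"
      by simp
  qed
  also have "\<dots> = ennreal (exp (c * ((\<integral>x. g x \<partial>p) - 1)))"
    using c g by (intro nn_integral_poisson_distribution) auto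
  finally show ?thesis .
qed

text \<open>Points are indexed by pairs (block, position in the block), coded by
  \<open>prod_decode\<close>, because a point configuration has to be an image of the counting
  measure on a set of naturals.\<close>

definition superposition :: "'a measure \<Rightarrow> (nat \<Rightarrow> nat \<times> (nat \<Rightarrow> 'a)) \<Rightarrow> 'a measure" where
  "superposition M \<omega> = distr (count_space {i. snd (prod_decode i) < fst (\<omega> (fst (prod_decode i)))}) M
     (\<lambda>i. snd (\<omega> (fst (prod_decode i))) (snd (prod_decode i)))"

lemma superposition_in_point_configurations:
  assumes "\<And>k j. snd (\<omega> k) j \<in> space M"
  shows "superposition M \<omega> \<in> point_configurations M"
  using assms unfolding superposition_def point_configurations_def by blast

lemma emeasure_superposition:
  assumes x: "\<And>k j. snd (\<omega> k) j \<in> space M" and A: "A \<in> sets M"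
  shows "emeasure (superposition M \<omega>) A = (\<Sum>k. \<Sum>j<fst (\<omega> k). indicator A (snd (\<omega> k) j))"
proof -
  let ?I = "{i. snd (prod_decode i) < fst (\<omega> (fst (prod_decode i)))}"
  let ?x = "\<lambda>i. snd (\<omega> (fst (prod_decode i))) (snd (prod_decode i))"
  let ?h = "\<lambda>kj. if snd kj < fst (\<omega> (fst kj)) then indicator A (snd (\<omega> (fst kj)) (snd kj)) else 0 :: ennreal"
  have "emeasure (superposition M \<omega>) A = (\<integral>\<^sup>+y. indicator A y \<partial>superposition M \<omega>)"
    using A by (simp add: superposition_def)
  also have "\<dots> = (\<integral>\<^sup>+i. indicator A (?x i) \<partial>count_space ?I)"
    unfolding superposition_def using x A by (intro nn_integral_distr) auto
  also have "\<dots> = (\<integral>\<^sup>+i. indicator A (?x i) * indicator ?I i \<partial>count_space UNIV)"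
    by (subst nn_integral_count_space_indicator) simp_all
  also have "\<dots> = (\<integral>\<^sup>+i. ?h (prod_decode i) \<partial>count_space UNIV)"
    by (intro nn_integral_cong) (auto simp: indicator_def)
  also have "\<dots> = (\<integral>\<^sup>+kj. ?h kj \<partial>count_space UNIV)"
    by (rule nn_integral_bij_count_space) (rule bij_prod_decode)
  also have "\<dots> = (\<integral>\<^sup>+k. \<integral>\<^sup>+j. ?h (k, j) \<partial>count_space UNIV \<partial>count_space UNIV)"
    by (rule nn_integral_fst_count_space[symmetric])
  also have "\<dots> = (\<Sum>k. \<Sum>j<fst (\<omega> k). indicator A (snd (\<omega> k) j))"
    unfolding nn_integral_count_space_nat
  proof (intro suminf_cong)
    fix k
    have "(\<Sum>j. ?h (k, j)) = (\<Sum>j<fst (\<omega> k). ?h (k, j))" by (intro suminf_finite) auto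
    then show "(\<Sum>j. ?h (k, j)) = (\<Sum>j<fst (\<omega> k). indicator A (snd (\<omega> k) j))" by simp
  qed
  finally show ?thesis .
qed

text \<open>The counts of a superposition are infinite sums that may diverge; continuity at infinity
  lets the Laplace functional be computed from partial sums in that case as well.\<close>

lemma tendsto_lexp:
  assumes X: "(X \<longlongrightarrow> x) F"
  shows "((\<lambda>n. lexp (X n)) \<longlongrightarrow> lexp x) F"
proof (cases "x = \<top>")
  case False
  then have "((\<lambda>n. exp (- enn2real (X n))) \<longlongrightarrow> exp (- enn2real x)) F"
    using X by (intro tendsto_intros tendsto_enn2real) (auto simp: less_top)
  moreover have "eventually (\<lambda>n. lexp (X n) = exp (- enn2real (X n))) F"
    using order_tendstoD(2)[OF X, of \<top>] False by (auto simp: lexp_def less_top elim: eventually_mono)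
  ultimately show ?thesis using False by (simp add: lexp_def tendsto_cong)
next
  case True
  show ?thesis
  proof (rule tendstoI)
    fix e :: real assume e: "0 < e"
    define r where "r = max 0 (1 - ln e)"
    have r: "0 \<le> r" "1 - ln e \<le> r" by (auto simp: r_def)
    have "eventually (\<lambda>n. ennreal r < X n) F"
      using order_tendstoD(1)[OF X, of "ennreal r"] True by auto
    then show "eventually (\<lambda>n. dist (lexp (X n)) (lexp x) < e) F"
    proof eventually_elim
      case (elim n)
      show ?case
      proof (cases "X n = \<top>")
        case False
        then have "r < enn2real (X n)"
          using elim r(1) by (cases "X n") (auto simp: ennreal_less_iff)
        then have "exp (- enn2real (X n)) < exp (ln e)" using r(2) by simp
        then show ?thesis using e False True by (simp add: lexp_def)
      qed (use e True in simp)
    qed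
  qed
qed

lemma lexp_sum: "finite J \<Longrightarrow> lexp (\<Sum>j\<in>J. f j) = (\<Prod>j\<in>J. lexp (f j))"
  by (induction J rule: finite_induct) (auto simp: lexp_add)

lemma prod_list_lexp_indicator: "(\<Prod>A\<leftarrow>As. lexp (indicator A x)) = 1 - covered As x"
  using lexp_of_nat[of 1] by (induction As) (auto simp: covered_def indicator_def mult_exp_exp algebra_simps)

lemma prod_list_prod:
  fixes f :: "'b \<Rightarrow> 'i \<Rightarrow> real"
  shows "(\<Prod>A\<leftarrow>As. \<Prod>i\<in>I. f A i) = (\<Prod>i\<in>I. \<Prod>A\<leftarrow>As. f A i)"
  by (induction As) (auto simp: prod.distrib)

lemma tendsto_prod_list:
  fixes f :: "'b \<Rightarrow> 'c \<Rightarrow> real"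
  assumes "\<And>A. A \<in> set As \<Longrightarrow> (f A \<longlongrightarrow> l A) F"
  shows "((\<lambda>n. \<Prod>A\<leftarrow>As. f A n) \<longlongrightarrow> (\<Prod>A\<leftarrow>As. l A)) F"
  using assms by (induction As) (auto intro!: tendsto_mult)

lemma laplace_superposition:
  assumes x: "\<And>k j. snd (\<omega> k) j \<in> space M" and As: "set As \<subseteq> sets M"
  shows "(\<lambda>K. \<Prod>k<K. \<Prod>j<fst (\<omega> k). 1 - covered As (snd (\<omega> k) j)) \<longlonglongrightarrow> laplace As (superposition M \<omega>)"
proof -
  define s where "s A K = (\<Sum>k<K. \<Sum>j<fst (\<omega> k). indicator A (snd (\<omega> k) j) :: ennreal)" for A K
  have lim: "(\<lambda>K. lexp (s A K)) \<longlonglongrightarrow> lexp (emeasure (superposition M \<omega>) A)" if "A \<in> set As" for A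
  proof (rule tendsto_lexp)
    have "A \<in> sets M" using that As by auto
    then show "s A \<longlonglongrightarrow> emeasure (superposition M \<omega>) A"
      unfolding s_def emeasure_superposition[OF x \<open>A \<in> sets M\<close>] by (intro summable_LIMSEQ) simp
  qed
  have "(\<lambda>K. \<Prod>A\<leftarrow>As. lexp (s A K)) \<longlonglongrightarrow> laplace As (superposition M \<omega>)"
    unfolding laplace_def by (rule tendsto_prod_list) (rule lim)
  moreover have "(\<Prod>A\<leftarrow>As. lexp (s A K)) = (\<Prod>k<K. \<Prod>j<fst (\<omega> k). 1 - covered As (snd (\<omega> k) j))" for K
    unfolding s_def by (simp add: lexp_sum prod_list_prod prod_list_lexp_indicator)
  ultimately show ?thesis by simp
qed

lemma measurable_superposition:
  assumes p: "\<And>k. sets (p k) = sets M"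
  shows "superposition M \<in> PiM UNIV (\<lambda>k. poisson_block (c k) (p k)) \<rightarrow>\<^sub>M configuration_space M"
proof -
  let ?\<Omega> = "PiM UNIV (\<lambda>k. poisson_block (c k) (p k))"
  have sp: "space (p k) = space M" for k using p by (rule sets_eq_imp_space_eq)
  have x: "snd (\<omega> k) j \<in> space M" if "\<omega> \<in> space ?\<Omega>" for \<omega> k j
    using that sp by (auto simp: space_PiM poisson_block_def space_pair_measure PiE_iff mem_Times_iff)
  have pc: "superposition M \<omega> \<in> point_configurations M" if "\<omega> \<in> space ?\<Omega>" for \<omega>
    by (rule superposition_in_point_configurations) (rule x[OF that])
  have m: "(\<lambda>\<omega>. emeasure (superposition M \<omega>) A) \<in> borel_measurable ?\<Omega>" if A: "A \<in> sets M" for A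
  proof -
    have "(\<lambda>b. \<Sum>j<fst b. indicator A (snd b j) :: ennreal) \<in> borel_measurable (poisson_block (c k) (p k))" for k
    proof (rule measurable_poisson_block)
      have [measurable]: "A \<in> sets (p k)" using A p by simp
      show "(\<lambda>x. \<Sum>j<fst (n, x). indicator A (snd (n, x) j) :: ennreal) \<in> borel_measurable (PiM UNIV (\<lambda>_. p k))" for n
        by simp
    qed
    note block = this
    have "(\<lambda>\<omega>. \<Sum>j<fst (\<omega> k). indicator A (snd (\<omega> k) j) :: ennreal) \<in> borel_measurable ?\<Omega>" for k
      using measurable_compose[OF measurable_component_singleton[of k UNIV "\<lambda>k. poisson_block (c k) (p k)"] block[of k]]
      by simp
    then have "(\<lambda>\<omega>. \<Sum>k. \<Sum>j<fst (\<omega> k). indicator A (snd (\<omega> k) j) :: ennreal) \<in> borel_measurable ?\<Omega>"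
      by (rule borel_measurable_suminf_order)
    then show ?thesis
      by (rule measurable_cong[THEN iffD2, rotated]) (rule emeasure_superposition[OF _ A], rule x)
  qed
  show ?thesis
    unfolding configuration_space_def
  proof (rule measurable_measure_of)
    show "superposition M \<in> space ?\<Omega> \<rightarrow> point_configurations M"
      using pc by auto
    fix y assume "y \<in> {(\<lambda>\<omega>. emeasure \<omega> A) -` B \<inter> point_configurations M |A B.
        A \<in> sets M \<and> emeasure M A < \<infinity> \<and> B \<in> sets borel}"
    then obtain A B where y: "y = (\<lambda>\<omega>. emeasure \<omega> A) -` B \<inter> point_configurations M"
      and A: "A \<in> sets M" and B: "B \<in> sets borel" by auto
    have "superposition M -` y \<inter> space ?\<Omega> = (\<lambda>\<omega>. emeasure (superposition M \<omega>) A) -` B \<inter> space ?\<Omega>"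
      unfolding y using pc by auto
    then show "superposition M -` y \<inter> space ?\<Omega> \<in> sets ?\<Omega>"
      using measurable_sets[OF m[OF A] B] by simp
  qed auto
qed

text \<open>The classical construction: M is cut into disjoint pieces of finite measure, each piece
  carries an independent Poisson process, and these are superposed. The Laplace functional of the
  first K pieces is a finite product, and dominated convergence, once over configurations and once
  over M, lets K tend to infinity.\<close>

lemma laplace_law_exists:
  assumes "sigma_finite_measure M" and nz: "emeasure M (space M) \<noteq> 0"
  shows "\<exists>P. laplace_law M P"
proof -
  interpret sigma_finite_measure M by fact
  obtain B :: "nat \<Rightarrow> 'a set" where B: "range B \<subseteq> sets M" "(\<Union>i. B i) = space M"
    "\<And>i. emeasure M (B i) \<noteq> \<infinity>" "disjoint_family B"
    using sigma_finite_disjoint by blast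
  have Bs [measurable]: "B k \<in> sets M" for k using B by auto
  obtain k0 where k0: "emeasure M (B k0) \<noteq> 0"
  proof (rule ccontr)
    assume "\<not> thesis"
    then have "\<And>k. B k \<in> null_sets M" using that by (auto intro!: null_setsI)
    then have "(\<Union>k. B k) \<in> null_sets M" by (rule null_sets_UN)
    then show False using nz B(2) by auto
  qed
  define c where "c k = measure M (B k)" for k
  \<comment> \<open>A null piece has no normalised restriction. The measure on \<open>B k0\<close>
    stands in for it and contributes no points, since then c k = 0.\<close>
  define p where "p k = uniform_measure M (B (if emeasure M (B k) = 0 then k0 else k))" for k
  have p: "prob_space (p k)" for k
    unfolding p_def using k0 B(3) by (intro prob_space_uniform_measure) auto
  have sets_p: "sets (p k) = sets M" for k by (simp add: p_def)
  define \<Omega> where "\<Omega> = PiM UNIV (\<lambda>k. poisson_block (c k) (p k))"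
  interpret \<Omega>: prob_space \<Omega>
    unfolding \<Omega>_def by (intro prob_space_PiM prob_space_poisson_block p)
  have S: "superposition M \<in> \<Omega> \<rightarrow>\<^sub>M configuration_space M"
    unfolding \<Omega>_def by (rule measurable_superposition) (rule sets_p)
  have x: "snd (\<omega> k) j \<in> space M" if "\<omega> \<in> space \<Omega>" for \<omega> k j
    using that sets_eq_imp_space_eq[OF sets_p]
    by (auto simp: \<Omega>_def space_PiM poisson_block_def space_pair_measure PiE_iff mem_Times_iff)
  have "laplace_law M (distr \<Omega> (configuration_space M) (superposition M))"
    unfolding laplace_law_def
  proof (intro conjI allI impI)
    show "prob_space (distr \<Omega> (configuration_space M) (superposition M))" by (rule \<Omega>.prob_space_distr[OF S])
    fix As assume As: "set As \<subseteq> finite_sets M"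
    then have As': "set As \<subseteq> sets M" by (auto simp: finite_sets_def)
    define g where "g x = 1 - covered As x" for x
    have cov_m [measurable]: "covered As \<in> borel_measurable M" by (rule measurable_covered[OF As'])
    have gm [measurable]: "g \<in> borel_measurable M" unfolding g_def by measurable
    have g01: "0 \<le> g x" "g x \<le> 1" for x
      using covered_bounds[of As x] by (auto simp: g_def covered_def)
    have gp: "g \<in> borel_measurable (p k)" for k using gm measurable_cong_sets[OF sets_p refl] by blast
    have iC: "integrable M (covered As)" by (rule integrable_covered[OF As])
    have iB: "integrable M (\<lambda>x. covered As x * indicator (B k) x)" for k
      by (rule Bochner_Integration.integrable_bound[OF iC]) (auto simp: covered_bounds indicator_def abs_mult)
    have block: "c k * ((\<integral>x. g x \<partial>p k) - 1) = - (\<integral>x. covered As x * indicator (B k) x \<partial>M)" for k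
    proof (cases "emeasure M (B k) = 0")
      case True
      then have "AE x in M. covered As x * indicator (B k) x = 0"
        by (intro AE_I[of _ _ "B k"]) (auto simp: indicator_def)
      then have "(\<integral>x. covered As x * indicator (B k) x \<partial>M) = 0"
        by (subst integral_cong_AE[where g="\<lambda>_. 0"]) auto
      then show ?thesis using True by (simp add: c_def measure_def)
    next
      case False
      interpret pk: prob_space "p k" by (rule p)
      have m: "covered As \<in> borel_measurable (p k)" using cov_m measurable_cong_sets[OF sets_p refl] by blast
      have ip: "integrable (p k) (covered As)"
        using m covered_bounds[of As] g01 by (intro pk.integrable_const_bound[where B=1]) (auto simp: g_def)
      have "ennreal (\<integral>x. covered As x \<partial>p k) = (\<integral>\<^sup>+x. covered As x \<partial>p k)"
        using ip by (intro nn_integral_eq_integral[symmetric]) (auto simp: covered_bounds)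
      also have "\<dots> = (\<integral>\<^sup>+x. ennreal (covered As x) * indicator (B k) x \<partial>M) / emeasure M (B k)"
        unfolding p_def using False by (simp add: nn_integral_uniform_measure)
      also have "(\<integral>\<^sup>+x. ennreal (covered As x) * indicator (B k) x \<partial>M) = (\<integral>\<^sup>+x. ennreal (covered As x * indicator (B k) x) \<partial>M)"
        by (intro nn_integral_cong) (auto simp: indicator_def)
      also have "\<dots> = ennreal (\<integral>x. covered As x * indicator (B k) x \<partial>M)"
        using iB by (intro nn_integral_eq_integral) (auto simp: covered_bounds indicator_def)
      also have "emeasure M (B k) = ennreal (c k)"
        using B(3) by (simp add: c_def emeasure_eq_ennreal_measure)
      also have "ennreal (\<integral>x. covered As x * indicator (B k) x \<partial>M) / ennreal (c k)
          = ennreal ((\<integral>x. covered As x * indicator (B k) x \<partial>M) / c k)"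
        using False B(3)[of k]
        by (intro divide_ennreal Bochner_Integration.integral_nonneg)
          (auto simp: covered_bounds c_def measure_def enn2real_positive_iff less_top zero_less_iff_neq_zero)
      finally have "(\<integral>x. covered As x \<partial>p k) = (\<integral>x. covered As x * indicator (B k) x \<partial>M) / c k"
        by (subst (asm) ennreal_inj)
          (auto intro!: Bochner_Integration.integral_nonneg divide_nonneg_nonneg simp: covered_bounds c_def)
      moreover have "c k \<noteq> 0"
        using False B(3)[of k] by (simp add: c_def measure_def enn2real_eq_0_iff)
      moreover have "(\<integral>x. g x \<partial>p k) = 1 - (\<integral>x. covered As x \<partial>p k)"
        unfolding g_def using ip by (simp add: pk.prob_space)
      ultimately show ?thesis by simp
    qed
    define Y where "Y K \<omega> = (\<Prod>k<K. \<Prod>j<fst (\<omega> k). g (snd (\<omega> k) j))" for K :: nat and \<omega> :: "nat \<Rightarrow> nat \<times> (nat \<Rightarrow> 'a)"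
    have Y01: "0 \<le> Y K \<omega>" "Y K \<omega> \<le> 1" for K \<omega>
      unfolding Y_def by (auto intro!: prod_nonneg prod_le_1 simp: g01)
    have blockm: "(\<lambda>b. \<Prod>j<fst b. g (snd b j)) \<in> borel_measurable (poisson_block (c k) (p k))" for k
      by (rule measurable_poisson_block) (use gp[of k] in simp)
    have Ym: "Y K \<in> borel_measurable \<Omega>" for K
      unfolding Y_def \<Omega>_def
    proof (rule borel_measurable_prod)
      fix k
      show "(\<lambda>\<omega>. \<Prod>j<fst (\<omega> k). g (snd (\<omega> k) j)) \<in> borel_measurable (PiM UNIV (\<lambda>k. poisson_block (c k) (p k)))"
        using measurable_compose[OF measurable_component_singleton[of k UNIV "\<lambda>k. poisson_block (c k) (p k)"] blockm[of k]]
        by simp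
    qed
    have EY: "(\<integral>\<omega>. Y K \<omega> \<partial>\<Omega>) = exp (- (\<Sum>k<K. \<integral>x. covered As x * indicator (B k) x \<partial>M))" for K
    proof -
      have "(\<integral>\<^sup>+\<omega>. ennreal (Y K \<omega>) \<partial>\<Omega>)
          = (\<integral>\<^sup>+\<omega>. (\<Prod>k<K. ennreal (\<Prod>j<fst (\<omega> k). g (snd (\<omega> k) j))) \<partial>\<Omega>)"
        unfolding Y_def by (intro nn_integral_cong) (auto simp: prod_ennreal g01 prod_nonneg)
      also have "\<dots> = (\<Prod>k<K. \<integral>\<^sup>+b. ennreal (\<Prod>j<fst b. g (snd b j)) \<partial>poisson_block (c k) (p k))"
        unfolding \<Omega>_def using blockm
        by (intro nn_integral_PiM_prod_coordinates[where f="\<lambda>k b. ennreal (\<Prod>j<fst b. g (snd b j))"]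
            prob_space_poisson_block p) auto
      also have "\<dots> = (\<Prod>k<K. ennreal (exp (- (\<integral>x. covered As x * indicator (B k) x \<partial>M))))"
      proof (intro prod.cong refl)
        fix k
        have "(\<integral>\<^sup>+b. ennreal (\<Prod>j<fst b. g (snd b j)) \<partial>poisson_block (c k) (p k))
            = (\<integral>\<^sup>+b. (\<Prod>j<fst b. ennreal (g (snd b j))) \<partial>poisson_block (c k) (p k))"
          by (intro nn_integral_cong) (auto simp: prod_ennreal g01)
        also have "\<dots> = ennreal (exp (c k * ((\<integral>x. g x \<partial>p k) - 1)))"
          by (rule nn_integral_poisson_block[OF p _ gp]) (auto simp: c_def g01)
        finally show "(\<integral>\<^sup>+b. ennreal (\<Prod>j<fst b. g (snd b j)) \<partial>poisson_block (c k) (p k))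
            = ennreal (exp (- (\<integral>x. covered As x * indicator (B k) x \<partial>M)))"
          by (simp add: block)
      qed
      also have "\<dots> = ennreal (exp (- (\<Sum>k<K. \<integral>x. covered As x * indicator (B k) x \<partial>M)))"
        by (simp add: prod_ennreal exp_sum[symmetric] sum_negf)
      finally show ?thesis
        using Y01 Ym by (intro integral_eq_nn_integral[THEN trans]) auto
    qed
    have lim1: "(\<lambda>K. \<integral>\<omega>. Y K \<omega> \<partial>\<Omega>) \<longlonglongrightarrow> (\<integral>\<omega>. laplace As (superposition M \<omega>) \<partial>\<Omega>)"
    proof (rule integral_dominated_convergence[where w="\<lambda>_. 1"])
      show "(\<lambda>\<omega>. laplace As (superposition M \<omega>)) \<in> borel_measurable \<Omega>"
        by (rule measurable_compose[OF S measurable_laplace[OF As]])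
      show "AE \<omega> in \<Omega>. (\<lambda>K. Y K \<omega>) \<longlonglongrightarrow> laplace As (superposition M \<omega>)"
        unfolding Y_def g_def by (intro AE_I2 laplace_superposition x As')
    qed (use Y01 Ym in auto)
    have lim2: "(\<lambda>K. \<Sum>k<K. \<integral>x. covered As x * indicator (B k) x \<partial>M) \<longlonglongrightarrow> (\<integral>x. covered As x \<partial>M)"
    proof -
      have "(\<lambda>K. \<integral>x. (\<Sum>k<K. covered As x * indicator (B k) x) \<partial>M) \<longlonglongrightarrow> (\<integral>x. covered As x \<partial>M)"
      proof (rule integral_dominated_convergence[where w="covered As"])
        \<comment> \<open>The pieces are disjoint and cover the space, so x lies in exactly one of
          them and the partial sums jump once, from 0 to their final value.\<close>
        have one: "x \<in> space M \<Longrightarrow> \<exists>k0. \<forall>K. (\<Sum>k<K. covered As x * indicator (B k) x) = (if k0 < K then covered As x else 0)" for x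
        proof -
          assume "x \<in> space M"
          then obtain k0 where k0: "x \<in> B k0" using B(2) by blast
          have "indicator (B k) x = (if k = k0 then 1 else 0 :: real)" for k
            using k0 disjoint_family_onD[OF B(4), of k k0] by (auto simp: indicator_def)
          then have "(\<Sum>k<K. covered As x * indicator (B k) x) = (if k0 < K then covered As x else 0)" for K
          proof -
            have "(\<Sum>k<K. covered As x * indicator (B k) x) = (\<Sum>k<K. if k = k0 then covered As x else 0)"
              using \<open>\<And>k. indicator (B k) x = _\<close> by (intro sum.cong) simp_all
            then show ?thesis by simp
          qed
          then show ?thesis by blast
        qed
        show "AE x in M. (\<lambda>K. \<Sum>k<K. covered As x * indicator (B k) x) \<longlonglongrightarrow> covered As x"
        proof (rule AE_I2)
          fix x assume "x \<in> space M"
          from one[OF this] obtain k0 where k0: "\<And>K. (\<Sum>k<K. covered As x * indicator (B k) x) = (if k0 < K then covered As x else 0)"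
            by blast
          show "(\<lambda>K. \<Sum>k<K. covered As x * indicator (B k) x) \<longlonglongrightarrow> covered As x"
            unfolding k0 by (rule tendsto_eventually, rule eventually_mono[OF eventually_gt_at_top[of k0]]) simp
        qed
        show "AE x in M. norm (\<Sum>k<K. covered As x * indicator (B k) x) \<le> covered As x" for K
        proof (rule AE_I2)
          fix x assume "x \<in> space M"
          from one[OF this] obtain k0 where k0: "\<And>K. (\<Sum>k<K. covered As x * indicator (B k) x) = (if k0 < K then covered As x else 0)"
            by blast
          show "norm (\<Sum>k<K. covered As x * indicator (B k) x) \<le> covered As x"
            unfolding k0 by (simp add: covered_bounds)
        qed
      qed (use iC in auto)
      then show ?thesis by (subst (asm) Bochner_Integration.integral_sum[OF iB])
    qed
    have "(\<lambda>K. \<integral>\<omega>. Y K \<omega> \<partial>\<Omega>) \<longlonglongrightarrow> exp (- (\<integral>x. covered As x \<partial>M))"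
      unfolding EY by (intro tendsto_intros lim2)
    then have "(\<integral>\<omega>. laplace As (superposition M \<omega>) \<partial>\<Omega>) = exp (- (\<integral>x. covered As x \<partial>M))"
      using lim1 by (rule LIMSEQ_unique[rotated])
    then show "(\<integral>\<omega>. laplace As \<omega> \<partial>distr \<Omega> (configuration_space M) (superposition M)) = exp (- (\<integral>x. covered As x \<partial>M))"
      using integral_distr[OF S measurable_laplace[OF As]] by simp
  qed simp
  then show ?thesis by blast
qed

section \<open>Restricted infinite products of circles\<close>

text \<open>Rotation by \<open>u\<close> on a circle of length \<open>q\<close>, performed inside each interval
  \<open>[i q, (i + 1) q)\<close> so that it is an action on the whole line.\<close>

definition rot :: "real \<Rightarrow> real \<Rightarrow> real \<Rightarrow> real" where
  "rot q u x = x + u - q * of_int (\<lfloor>(x + u) / q\<rfloor> - \<lfloor>x / q\<rfloor>)"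

lemma rot_0 [simp]: "rot q 0 x = x"
  by (simp add: rot_def)

lemma floor_rot:
  assumes "0 < q"
  shows "\<lfloor>rot q u x / q\<rfloor> = \<lfloor>x / q\<rfloor>"
proof -
  have "rot q u x / q = (x + u) / q - of_int (\<lfloor>(x + u) / q\<rfloor> - \<lfloor>x / q\<rfloor>)"
    using assms by (simp add: rot_def diff_divide_distrib)
  then show ?thesis by (simp only: floor_diff_of_int)
qed

lemma rot_add:
  assumes q: "0 < q"
  shows "rot q (s + t) x = rot q s (rot q t x)"
proof -
  have "(rot q t x + s) / q = (x + (s + t)) / q - of_int (\<lfloor>(x + t) / q\<rfloor> - \<lfloor>x / q\<rfloor>)"
    using q by (simp add: rot_def diff_divide_distrib add_divide_distrib)
  then have "\<lfloor>(rot q t x + s) / q\<rfloor> = \<lfloor>(x + (s + t)) / q\<rfloor> - (\<lfloor>(x + t) / q\<rfloor> - \<lfloor>x / q\<rfloor>)"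
    by (simp only: floor_diff_of_int)
  then show ?thesis
    using floor_rot[OF q, of t x] by (simp add: rot_def[of q s "rot q t x"]) (simp add: rot_def algebra_simps)
qed

lemma rot_add_multiple:
  assumes "0 < q"
  shows "rot q (u + q * of_int k) x = rot q u x"
proof -
  have "(x + (u + q * of_int k)) / q = (x + u) / q + of_int k"
    using assms by (simp add: add_divide_distrib)
  then have "\<lfloor>(x + (u + q * of_int k)) / q\<rfloor> = \<lfloor>(x + u) / q\<rfloor> + k" by simp
  then show ?thesis by (simp add: rot_def algebra_simps)
qed

lemma floor_divide_eq_0: "0 \<le> x \<Longrightarrow> x < q \<Longrightarrow> \<lfloor>x / q\<rfloor> = 0" for x q :: real
  by (simp add: floor_eq_iff)

lemma rot_eq_add:
  assumes "0 \<le> x" "x < q" "0 \<le> x + u" "x + u < q"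
  shows "rot q u x = x + u"
  using assms by (simp add: rot_def floor_divide_eq_0)

lemma rot_minus:
  assumes "0 < q"
  shows "rot q (- u) (rot q u x) = x" "rot q u (rot q (- u) x) = x"
  using rot_add[OF assms, of "- u" u x] rot_add[OF assms, of u "- u" x] by auto

lemma measurable_rot [measurable]: "(\<lambda>(u, x). rot q u x) \<in> borel \<Otimes>\<^sub>M borel \<rightarrow>\<^sub>M borel"
  unfolding rot_def by measurable

lemma measurable_rot_fixed [measurable]: "rot q u \<in> borel \<rightarrow>\<^sub>M borel"
  unfolding rot_def[abs_def] by measurable

lemma emeasure_lborel_translate:
  fixes c :: real
  assumes "B \<in> sets borel"
  shows "emeasure lborel ((\<lambda>x. x + c) -` B) = emeasure lborel B"
proof -
  have "emeasure (distr lborel borel ((+) c)) B = emeasure lborel ((+) c -` B \<inter> space lborel)"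
    using assms by (intro emeasure_distr) auto
  then show ?thesis by (simp add: lborel_distr_plus add.commute[of c] vimage_def)
qed

lemma emeasure_rot_vimage:
  assumes q: "0 < q" and B: "B \<in> sets borel"
  shows "emeasure lborel ({0..<q} \<inter> rot q u -` B) = emeasure lborel ({0..<q} \<inter> B)"
proof -
  \<comment> \<open>Rotations depend only on u modulo q. For 0 \<le> v < q the rotation of [0, q)
    exchanges two intervals, so it consists of two translations.\<close>
  define v where "v = u - q * of_int \<lfloor>u / q\<rfloor>"
  have uv: "rot q u = rot q v"
    using rot_add_multiple[OF q, of v "\<lfloor>u / q\<rfloor>"] by (auto simp: v_def fun_eq_iff)
  have v: "0 \<le> v" "v < q"
  proof -
    show "0 \<le> v" "v < q"
      using floor_divide_lower[OF q, of u] floor_divide_upper[OF q, of u]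
      by (simp_all add: v_def algebra_simps)
  qed
  have low: "rot q v x = x + v" if "x \<in> {0..<q}" "x + v < q" for x
    using that v by (intro rot_eq_add) auto
  have high: "rot q v x = x + (v - q)" if "x \<in> {0..<q}" "q \<le> x + v" for x
  proof -
    have "rot q v x = rot q (v - q) x"
      using rot_add_multiple[OF q, of "v - q" 1] by simp
    also have "\<dots> = x + (v - q)" using that v by (intro rot_eq_add) auto
    finally show ?thesis .
  qed
  let ?B1 = "B \<inter> {v..<q}" and ?B2 = "B \<inter> {0..<v}"
  have split: "{0..<q} \<inter> rot q u -` B = (\<lambda>x. x + v) -` ?B1 \<union> (\<lambda>x. x + (v - q)) -` ?B2"
  proof (intro set_eqI)
    fix x
    show "x \<in> {0..<q} \<inter> rot q u -` B \<longleftrightarrow> x \<in> (\<lambda>x. x + v) -` ?B1 \<union> (\<lambda>x. x + (v - q)) -` ?B2"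
    proof (cases "x \<in> {0..<q}")
      case True
      then show ?thesis using low[OF True] high[OF True] v unfolding uv by (cases "x + v < q") auto
    next
      case False
      then show ?thesis using v by auto
    qed
  qed
  have m: "(\<lambda>x. x + c) -` (B \<inter> {a..<b}) \<in> sets lborel" for a b c :: real
    using measurable_sets[of "\<lambda>x. x + c" borel borel "B \<inter> {a..<b}"] B by simp
  have "emeasure lborel ({0..<q} \<inter> rot q u -` B)
      = emeasure lborel ((\<lambda>x. x + v) -` ?B1) + emeasure lborel ((\<lambda>x. x + (v - q)) -` ?B2)"
    unfolding split using m by (intro plus_emeasure[symmetric]) auto
  also have "\<dots> = emeasure lborel ?B1 + emeasure lborel ?B2"
    using B by (intro arg_cong2[where f="(+)"] emeasure_lborel_translate) auto
  also have "\<dots> = emeasure lborel (?B1 \<union> ?B2)"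
    using B by (intro plus_emeasure) auto
  also have "?B1 \<union> ?B2 = {0..<q} \<inter> B" using v by auto
  finally show ?thesis .
qed

lemma emeasure_rot_swap:
  assumes q: "0 < q" and [measurable]: "X \<in> sets borel" "Y \<in> sets borel"
  shows "emeasure lborel ({0..<q} \<inter> (X \<inter> rot q u -` Y)) = emeasure lborel ({0..<q} \<inter> (rot q (- u) -` X \<inter> Y))"
proof -
  have [measurable]: "rot q (- u) -` X \<in> sets borel"
    using measurable_sets[OF measurable_rot_fixed, of X q "- u"] by simp
  have "{0..<q} \<inter> (X \<inter> rot q u -` Y) = {0..<q} \<inter> rot q u -` (rot q (- u) -` X \<inter> Y)"
    using rot_minus[OF q] by auto
  also have "emeasure lborel \<dots> = emeasure lborel ({0..<q} \<inter> (rot q (- u) -` X \<inter> Y))"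
    by (rule emeasure_rot_vimage[OF q]) simp
  finally show ?thesis .
qed

text \<open>The flow at time \<open>gap n\<close> fixes the coordinates below \<open>n\<close>, because \<open>gap n\<close> is a multiple of
  their circle lengths.  Coordinate \<open>n\<close> controls the times between \<open>ell n\<close> and \<open>ell (n + 1)\<close>.\<close>

definition ell :: "nat \<Rightarrow> real" where "ell n = 4 ^ ((2 * n)\<^sup>2)"
definition gap :: "nat \<Rightarrow> real" where "gap n = 4 ^ ((2 * n + 1)\<^sup>2)"
definition circ :: "nat \<Rightarrow> real" where "circ n = 4 * ell (n + 1)"

lemma ell_ge_1: "1 \<le> ell n"
  by (simp add: ell_def)

lemma ell_pos [simp]: "0 < ell n" and gap_pos [simp]: "0 < gap n" and circ_pos [simp]: "0 < circ n"
  by (auto simp: ell_def gap_def circ_def)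

lemma nonneg_nonzero [simp]:
  "0 \<le> ell n" "0 \<le> gap n" "0 \<le> circ n" "ell n \<noteq> 0" "gap n \<noteq> 0" "circ n \<noteq> 0"
  by (auto simp: ell_def gap_def circ_def)

lemma gap_eq: "gap n = 4 ^ (4 * n + 1) * ell n"
  unfolding gap_def ell_def power_add[symmetric] by (intro arg_cong[where f="\<lambda>k. 4 ^ k"]) (simp add: power2_eq_square algebra_simps)

lemma ell_Suc_eq: "ell (Suc n) = 4 ^ (4 * n + 3) * gap n"
  unfolding gap_def ell_def power_add[symmetric] by (intro arg_cong[where f="\<lambda>k. 4 ^ k"]) (simp add: power2_eq_square algebra_simps)

lemma four_ell_le_gap: "4 * ell n \<le> gap n"
  unfolding gap_eq by (intro mult_right_mono) (auto simp: power_add)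

lemma four_gap_le_ell: "4 * gap n \<le> ell (Suc n)"
  unfolding ell_Suc_eq by (intro mult_right_mono) (auto simp: power_add intro: order_trans[OF _ mult_mono[of 1 16 1]])

lemma ell_mono_strict: "strict_mono ell"
proof (rule strict_mono_Suc_iff[THEN iffD2], intro allI)
  fix n
  show "ell n < ell (Suc n)"
    using four_ell_le_gap[of n] four_gap_le_ell[of n] ell_pos[of n] gap_pos[of n] by linarith
qed

lemma ell_ge_power: "4 ^ n \<le> ell n"
  unfolding ell_def by (intro power_increasing) (auto simp: power2_eq_square)

lemma gap_multiple_circ:
  assumes "m < n"
  shows "\<exists>k::int. gap n = circ m * of_int k"
proof -
  \<comment> \<open>The summand 1 in the exponent is the factor 4 in \<open>circ m\<close>; there is
    room for it because (2m + 3)^2 exceeds (2m + 2)^2.\<close>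
  have "(2 * (m + 1))\<^sup>2 + 1 \<le> (2 * n + 1)\<^sup>2"
  proof -
    have "(2 * (m + 1) + 1)\<^sup>2 \<le> (2 * n + 1)\<^sup>2" using assms by (intro power_mono) auto
    then show ?thesis by (simp add: power2_eq_square)
  qed
  then obtain d where d: "(2 * n + 1)\<^sup>2 = ((2 * (m + 1))\<^sup>2 + 1) + d" using le_Suc_ex by blast
  have "gap n = circ m * of_int (4 ^ d)"
    unfolding gap_def circ_def ell_def d by (simp add: power_add)
  then show ?thesis by blast
qed

section \<open>Consistent product measures on the levels\<close>

definition base :: "nat \<Rightarrow> real set" where
  "base n = {0..<ell n} \<union> {gap n..<gap n + ell n} \<union> {3 * gap n..<3 * gap n + ell n}"

lemma base_subset: "base n \<subseteq> {0..<3 * gap n + ell n}" "base n \<subseteq> {0..<circ n}"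
proof -
  show *: "base n \<subseteq> {0..<3 * gap n + ell n}"
    using ell_pos[of n] gap_pos[of n] by (auto simp: base_def)
  have "3 * gap n + ell n \<le> circ n"
    using four_ell_le_gap[of n] four_gap_le_ell[of n] gap_pos[of n] ell_pos[of n]
    unfolding circ_def Suc_eq_plus1 by linarith
  then show "base n \<subseteq> {0..<circ n}" using * by auto
qed

lemma base_sets [measurable, simp]: "base n \<in> sets borel"
  by (simp add: base_def)

lemma emeasure_base: "emeasure lborel (base n) = ennreal (3 * ell n)"
proof -
  have le: "ell n < gap n" using four_ell_le_gap[of n] ell_pos[of n] by linarith
  have "emeasure lborel (base n) = emeasure lborel ({0..<ell n} \<union> {gap n..<gap n + ell n}) + emeasure lborel {3 * gap n..<3 * gap n + ell n}"
    unfolding base_def using le ell_pos[of n] by (intro plus_emeasure[symmetric]) auto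
  also have "emeasure lborel ({0..<ell n} \<union> {gap n..<gap n + ell n}) = emeasure lborel {0..<ell n} + emeasure lborel {gap n..<gap n + ell n}"
    using le ell_pos[of n] by (intro plus_emeasure[symmetric]) auto
  finally show ?thesis
    by (simp add: ennreal_plus[symmetric] del: ennreal_plus)
qed

text \<open>The product over n is the uniform law on points whose coordinates from N on lie in
  \<open>base\<close>, the earlier ones being free on their circles. These laws turn out to be the
  normalised restrictions of the infinite measure to the sets \<open>tail N\<close>.\<close>

definition factor :: "nat \<Rightarrow> nat \<Rightarrow> real measure" where
  "factor N n = uniform_measure lborel (if n < N then {0..<circ n} else base n)"

lemma sets_factor [simp, measurable_cong]: "sets (factor N n) = sets borel"
  and space_factor [simp]: "space (factor N n) = UNIV"
  by (auto simp: factor_def)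

lemma prob_space_factor: "prob_space (factor N n)"
  unfolding factor_def using circ_pos[of n] ell_pos[of n]
  by (intro prob_space_uniform_measure) (auto simp: emeasure_base less_imp_le)

definition level :: "nat \<Rightarrow> (nat \<Rightarrow> real) measure" where
  "level N = PiM UNIV (factor N)"

interpretation level: product_prob_space "factor N" UNIV for N
  by (intro product_prob_spaceI prob_space_factor)

lemma sets_level [simp, measurable_cong]: "sets (level N) = sets borel"
proof -
  have "sets (level N) = sets (PiM UNIV (\<lambda>_. borel :: real measure))"
    unfolding level_def by (intro sets_PiM_cong) auto
  then show ?thesis by (simp add: sets_PiM_equal_borel)
qed

lemma space_level [simp]: "space (level N) = UNIV"
  using sets_eq_imp_space_eq[OF sets_level] by simp

lemma prob_space_level: "prob_space (level N)"
  unfolding level_def by (rule prob_space_PiM) (rule prob_space_factor)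

lemma emeasure_level_cylinder:
  assumes "finite J" "\<And>i. i \<in> J \<Longrightarrow> X i \<in> sets borel"
  shows "emeasure (level N) {x. \<forall>i\<in>J. x i \<in> X i} = (\<Prod>i\<in>J. emeasure (factor N i) (X i))"
  using level.emeasure_PiM_Collect[of J X N] assms by (simp add: level_def space_PiM)

text \<open>The factor by which the total mass grows when coordinate n is released from
  \<open>base n\<close>, of length 3 * ell n, to the full circle. With \<open>level_mass\<close> as
  total masses the levels extend each other, and level 0 has mass 1.\<close>

definition weight :: "nat \<Rightarrow> real" where "weight n = circ n / (3 * ell n)"
definition level_mass :: "nat \<Rightarrow> real" where "level_mass N = (\<Prod>n<N. weight n)"

lemma weight_pos: "0 < weight n"
  by (simp add: weight_def)

lemma level_mass_pos: "0 < level_mass N"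
  by (simp add: level_mass_def weight_pos prod_pos)

definition irp_flow :: "real \<Rightarrow> (nat \<Rightarrow> real) \<Rightarrow> nat \<Rightarrow> real" where
  "irp_flow u x n = rot (circ n) u (x n)"

lemma irp_flow_0 [simp]: "irp_flow 0 x = x"
  by (simp add: irp_flow_def fun_eq_iff)

lemma irp_flow_add: "irp_flow (s + t) x = irp_flow s (irp_flow t x)"
  by (simp add: irp_flow_def fun_eq_iff rot_add)

lemma irp_flow_minus: "irp_flow (- u) (irp_flow u x) = x" "irp_flow u (irp_flow (- u) x) = x"
  using irp_flow_add[of "- u" u x] irp_flow_add[of u "- u" x] by auto

lemma measurable_coordinate [measurable]: "(\<lambda>x::nat \<Rightarrow> real. x n) \<in> borel \<rightarrow>\<^sub>M borel"
  by (intro borel_measurable_continuous_onI continuous_intros) simp_all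

lemma measurable_sequenceI:
  assumes "\<And>n. (\<lambda>x. f x n) \<in> M \<rightarrow>\<^sub>M borel"
  shows "f \<in> M \<rightarrow>\<^sub>M (borel :: (nat \<Rightarrow> real) measure)"
  using assms by (rule measurable_coordinatewise_then_product)

lemma measurable_irp_flow_pair [measurable]: "(\<lambda>(u, x). irp_flow u x) \<in> borel \<Otimes>\<^sub>M borel \<rightarrow>\<^sub>M borel"
proof (rule measurable_sequenceI)
  show "(\<lambda>p. (case p of (u, x) \<Rightarrow> irp_flow u x) n) \<in> borel \<Otimes>\<^sub>M borel \<rightarrow>\<^sub>M borel" for n
    unfolding irp_flow_def case_prod_beta by measurable
qed

lemma measurable_irp_flow [measurable]: "irp_flow u \<in> borel \<rightarrow>\<^sub>M borel"
  unfolding irp_flow_def[abs_def] by (rule measurable_sequenceI) measurable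

definition tail :: "nat \<Rightarrow> (nat \<Rightarrow> real) set" where
  "tail N = {x. \<forall>n\<ge>N. x n \<in> base n}"

lemma tail_sets [measurable, simp]: "tail N \<in> sets borel"
proof -
  have "tail N = (\<Inter>n\<in>{N..}. (\<lambda>x. x n) -` base n)" by (auto simp: tail_def)
  moreover have "(\<lambda>x::nat \<Rightarrow> real. x n) -` base n \<in> sets borel" for n
    using measurable_sets[OF measurable_coordinate base_sets, of n n] by simp
  ultimately show ?thesis by auto
qed

lemma tail_mono: "N \<le> L \<Longrightarrow> tail N \<subseteq> tail L"
  by (auto simp: tail_def)

lemma emeasure_factor:
  assumes "X \<in> sets borel"
  shows "emeasure (factor N n) X = (if n < N then emeasure lborel ({0..<circ n} \<inter> X) / ennreal (circ n)
    else emeasure lborel (base n \<inter> X) / ennreal (3 * ell n))"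
  using assms by (simp add: factor_def emeasure_base)

lemma ennreal_weight_mult:
  assumes "0 < c" "0 < d"
  shows "ennreal (c / d) * (e / ennreal c) = e / ennreal d"
proof (cases e)
  case (real r)
  then show ?thesis using assms by (simp add: divide_ennreal ennreal_mult[symmetric])
next
  case top
  then show ?thesis using assms by (simp add: ennreal_top_divide ennreal_mult_top)
qed

lemma base_Int_circle: "base n \<inter> X = {0..<circ n} \<inter> (base n \<inter> X)"
  using base_subset(2)[of n] by blast

text \<open>The one-coordinate form of invariance. Below N, and from L on, both sides have the same
  normalisation and rotation invariance on the circle is enough. For N \<le> n < L the left side is
  normalised by the base and the right side by the circle, and the weight on the right makes up for
  the difference.\<close>

lemma weight_factor_rot:
  assumes NL: "N \<le> L" and X [measurable]: "X \<in> sets borel"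
  shows "(if n < N then ennreal (weight n) else 1) *
      emeasure (factor N n) {x. rot (circ n) u x \<in> X \<and> (L \<le> n \<longrightarrow> rot (circ n) u x \<in> base n)}
    = (if n < L then ennreal (weight n) else 1) *
      emeasure (factor L n) {y. y \<in> X \<and> (N \<le> n \<longrightarrow> rot (circ n) (- u) y \<in> base n)}"
proof -
  note q = circ_pos[of n]
  have rv [measurable]: "rot (circ n) v -` Y \<in> sets borel" if "Y \<in> sets borel" for v Y
    using measurable_sets[OF measurable_rot_fixed that, of "circ n" v] by simp
  have w: "ennreal (weight n) * (e / ennreal (circ n)) = e / ennreal (3 * ell n)" for e
    unfolding weight_def by (rule ennreal_weight_mult) auto
  consider "n < N" | "N \<le> n" "n < L" | "L \<le> n" by linarith
  then show ?thesis
  proof cases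
    case 1
    have s1: "{x. rot (circ n) u x \<in> X \<and> (L \<le> n \<longrightarrow> rot (circ n) u x \<in> base n)} = rot (circ n) u -` X"
      and s2: "{y. y \<in> X \<and> (N \<le> n \<longrightarrow> rot (circ n) (- u) y \<in> base n)} = X"
      using 1 NL by auto
    show ?thesis
      unfolding s1 s2 using 1 NL rv[OF X] by (simp add: emeasure_factor emeasure_rot_vimage[OF q X])
  next
    case 2
    have s1: "{x. rot (circ n) u x \<in> X \<and> (L \<le> n \<longrightarrow> rot (circ n) u x \<in> base n)} = rot (circ n) u -` X"
      and s2: "{y. y \<in> X \<and> (N \<le> n \<longrightarrow> rot (circ n) (- u) y \<in> base n)} = rot (circ n) (- u) -` base n \<inter> X"
      using 2 by auto
    have "emeasure lborel (base n \<inter> rot (circ n) u -` X)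
        = emeasure lborel ({0..<circ n} \<inter> (rot (circ n) (- u) -` base n \<inter> X))"
      by (subst base_Int_circle) (rule emeasure_rot_swap[OF q], auto)
    then show ?thesis
      unfolding s1 s2 using 2 rv by (simp add: emeasure_factor w)
  next
    case 3
    have s1: "{x. rot (circ n) u x \<in> X \<and> (L \<le> n \<longrightarrow> rot (circ n) u x \<in> base n)} = rot (circ n) u -` (X \<inter> base n)"
      and s2: "{y. y \<in> X \<and> (N \<le> n \<longrightarrow> rot (circ n) (- u) y \<in> base n)} = rot (circ n) (- u) -` base n \<inter> X"
      using 3 NL by auto
    have "emeasure lborel (base n \<inter> rot (circ n) u -` (X \<inter> base n))
        = emeasure lborel ({0..<circ n} \<inter> (rot (circ n) (- u) -` base n \<inter> (X \<inter> base n)))"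
      by (subst base_Int_circle) (rule emeasure_rot_swap[OF q], auto)
    also have "{0..<circ n} \<inter> (rot (circ n) (- u) -` base n \<inter> (X \<inter> base n)) = base n \<inter> (rot (circ n) (- u) -` base n \<inter> X)"
      using base_subset(2)[of n] by blast
    finally show ?thesis
      unfolding s1 s2 using 3 NL rv by (simp add: emeasure_factor)
  qed
qed

lemma level_mass_eq_prod:
  assumes "N \<le> m"
  shows "ennreal (level_mass N) = (\<Prod>n<m. if n < N then ennreal (weight n) else 1)"
proof -
  have "(\<Prod>n<m. if n < N then ennreal (weight n) else 1) = (\<Prod>n<N. ennreal (weight n))"
    using assms by (intro prod.mono_neutral_cong_right) auto
  then show ?thesis by (simp add: level_mass_def prod_ennreal weight_pos less_imp_le)
qed

lemma emeasure_level_initial: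
  assumes "\<And>n. X n \<in> sets borel"
  shows "emeasure (level N) {x. \<forall>n<m. x n \<in> X n} = (\<Prod>n<m. emeasure (factor N n) (X n))"
  using emeasure_level_cylinder[of "{..<m}" X N] assms by (simp add: Ball_def)

lemma tendsto_emeasure_level:
  assumes "\<And>n. X n \<in> sets borel"
  shows "(\<lambda>m. \<Prod>n<m. emeasure (factor N n) (X n)) \<longlonglongrightarrow> emeasure (level N) {x. \<forall>n. x n \<in> X n}"
proof -
  interpret prob_space "level N" by (rule prob_space_level)
  let ?A = "\<lambda>m. {x::nat \<Rightarrow> real. \<forall>n<m. x n \<in> X n}"
  have s: "(\<lambda>x::nat \<Rightarrow> real. x n) -` X n \<in> sets borel" for n
    using measurable_sets[OF measurable_coordinate assms, of n n] by simp
  have "?A m = (\<Inter>n\<in>{..<m}. (\<lambda>x. x n) -` X n)" for m by auto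
  moreover have "(\<Inter>n\<in>{..<m}. (\<lambda>x. x n) -` X n) \<in> sets borel" for m
    using s by (cases m) auto
  ultimately have "(\<lambda>m. emeasure (level N) (?A m)) \<longlonglongrightarrow> emeasure (level N) (\<Inter>m. ?A m)"
    by (intro Lim_emeasure_decseq) (auto simp: decseq_def)
  moreover have "(\<Inter>m. ?A m) = {x. \<forall>n. x n \<in> X n}" by auto
  ultimately show ?thesis using emeasure_level_initial[OF assms] by simp
qed

lemma vimage_irp_flow_sets [measurable]: "B \<in> sets borel \<Longrightarrow> irp_flow u -` B \<in> sets borel"
  using measurable_sets[OF measurable_irp_flow, of B u] by simp

text \<open>Invariance of the infinite measure, expressed through its levels: mass leaving
  \<open>tail N\<close> for B inside \<open>tail L\<close> is compared with the mass there that
  comes from \<open>tail N\<close>. Both sides are measures in B; on cylinder sets each is a limit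
  of finite products that agree factor by factor.\<close>

lemma level_irp_flow:
  assumes NL: "N \<le> L" and B: "B \<in> sets borel"
  shows "ennreal (level_mass N) * emeasure (level N) (irp_flow u -` (B \<inter> tail L))
    = ennreal (level_mass L) * emeasure (level L) (B \<inter> irp_flow (- u) -` tail N)"
proof -
  interpret lN: prob_space "level N" by (rule prob_space_level)
  interpret lL: prob_space "level L" by (rule prob_space_level)
  define P where "P = scale_measure (ennreal (level_mass N)) (distr (density (level N) (indicator (irp_flow u -` tail L))) borel (irp_flow u))"
  define Q where "Q = scale_measure (ennreal (level_mass L)) (density (level L) (indicator (irp_flow (- u) -` tail N)))"
  have P: "emeasure P B = ennreal (level_mass N) * emeasure (level N) (irp_flow u -` (B \<inter> tail L))" if "B \<in> sets borel" for B
  proof -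
    have "irp_flow u \<in> density (level N) (indicator (irp_flow u -` tail L)) \<rightarrow>\<^sub>M borel"
      by simp
    then show ?thesis using that unfolding P_def
      by (simp add: emeasure_scale_measure emeasure_distr emeasure_restricted vimage_irp_flow_sets Int_commute)
  qed
  have Q: "emeasure Q B = ennreal (level_mass L) * emeasure (level L) (B \<inter> irp_flow (- u) -` tail N)" if "B \<in> sets borel" for B
    using that unfolding Q_def
    by (simp add: emeasure_scale_measure emeasure_restricted vimage_irp_flow_sets Int_commute)
  have "P = Q"
  proof (rule measure_eqI_PiM_infinite[where I=UNIV and M="\<lambda>_. borel :: real measure"])
    show "sets P = sets (PiM UNIV (\<lambda>_. borel))" "sets Q = sets (PiM UNIV (\<lambda>_. borel))"
      by (auto simp: P_def Q_def sets_PiM_equal_borel)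
    show "finite_measure P"
    proof
      have "space P = UNIV" by (simp add: P_def space_scale_measure)
      then show "emeasure P (space P) \<noteq> \<infinity>"
        using P[of UNIV] lN.emeasure_finite by (simp add: ennreal_mult_eq_top_iff)
    qed
    fix J and A :: "nat \<Rightarrow> real set"
    assume J: "finite J" and A: "\<And>i. i \<in> J \<Longrightarrow> A i \<in> sets borel"
    define X where "X n = (if n \<in> J then A n else UNIV)" for n
    have X [measurable]: "X n \<in> sets borel" for n using A by (auto simp: X_def)
    define Z where "Z = {x. \<forall>n. x n \<in> X n}"
    have "prod_emb UNIV (\<lambda>_. borel) J (PiE J A) = Z"
      by (auto simp: prod_emb_def Z_def X_def PiE_iff restrict_def)
    have Z: "Z \<in> sets borel"
    proof -
      have "(\<lambda>x::nat \<Rightarrow> real. x n) -` X n \<in> sets borel" for n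
        using measurable_sets[OF measurable_coordinate X, of n n] by simp
      moreover have "Z = (\<Inter>n. (\<lambda>x. x n) -` X n)" by (auto simp: Z_def)
      ultimately show ?thesis by auto
    qed
    let ?X1 = "\<lambda>n. {x. rot (circ n) u x \<in> X n \<and> (L \<le> n \<longrightarrow> rot (circ n) u x \<in> base n)}"
    let ?X2 = "\<lambda>n. {y. y \<in> X n \<and> (N \<le> n \<longrightarrow> rot (circ n) (- u) y \<in> base n)}"
    have rv: "rot (circ n) v -` Y \<in> sets borel" if "Y \<in> sets borel" for v Y n
      using measurable_sets[OF measurable_rot_fixed that, of "circ n" v] by simp
    have "?X1 n = rot (circ n) u -` (if L \<le> n then X n \<inter> base n else X n)" for n by auto
    then have m1: "?X1 n \<in> sets borel" for n using rv by simp
    have "?X2 n = X n \<inter> (if N \<le> n then rot (circ n) (- u) -` base n else UNIV)" for n by auto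
    then have m2: "?X2 n \<in> sets borel" for n using rv by simp
    have s1: "irp_flow u -` (Z \<inter> tail L) = {x. \<forall>n. x n \<in> ?X1 n}"
      by (auto simp: Z_def tail_def irp_flow_def)
    have s2: "Z \<inter> irp_flow (- u) -` tail N = {x. \<forall>n. x n \<in> ?X2 n}"
      by (auto simp: Z_def tail_def irp_flow_def)
    have l1: "(\<lambda>m. ennreal (level_mass N) * (\<Prod>n<m. emeasure (factor N n) (?X1 n))) \<longlonglongrightarrow> emeasure P Z"
      unfolding P[OF Z] s1 by (intro ennreal_tendsto_cmult tendsto_emeasure_level m1) simp
    have l2: "(\<lambda>m. ennreal (level_mass L) * (\<Prod>n<m. emeasure (factor L n) (?X2 n))) \<longlonglongrightarrow> emeasure Q Z"
      unfolding Q[OF Z] s2 by (intro ennreal_tendsto_cmult tendsto_emeasure_level m2) simp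
    have "ennreal (level_mass N) * (\<Prod>n<m. emeasure (factor N n) (?X1 n))
        = ennreal (level_mass L) * (\<Prod>n<m. emeasure (factor L n) (?X2 n))" if "L \<le> m" for m
    proof -
      have "N \<le> m" using that NL by simp
      show ?thesis
        unfolding level_mass_eq_prod[OF \<open>N \<le> m\<close>] level_mass_eq_prod[OF that] prod.distrib[symmetric]
        by (intro prod.cong refl weight_factor_rot[OF NL X])
    qed
    then have "eventually (\<lambda>m. ennreal (level_mass N) * (\<Prod>n<m. emeasure (factor N n) (?X1 n))
        = ennreal (level_mass L) * (\<Prod>n<m. emeasure (factor L n) (?X2 n))) sequentially"
      by (auto simp: eventually_sequentially)
    from Lim_transform_eventually[OF l1 this] have "emeasure P Z = emeasure Q Z"
      using l2 by (rule LIMSEQ_unique)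
    then show "emeasure P (prod_emb UNIV (\<lambda>_. borel) J (PiE J A)) = emeasure Q (prod_emb UNIV (\<lambda>_. borel) J (PiE J A))"
      using \<open>prod_emb UNIV (\<lambda>_. borel) J (PiE J A) = Z\<close> by simp
  qed
  then show ?thesis using P[OF B] Q[OF B] by simp
qed

section \<open>Escape estimates and the infinite invariant measure\<close>

lemma emeasure_level_exists_ge:
  assumes "N \<le> L" and X: "\<And>n. X n \<in> sets borel"
  shows "emeasure (level N) {x. \<exists>n\<ge>L. x n \<in> X n} \<le> (\<Sum>n. emeasure (factor N (n + L)) (X (n + L)))"
proof -
  have eq: "{x. \<exists>n\<ge>L. x n \<in> X n} = (\<Union>n. {x::nat \<Rightarrow> real. \<forall>i\<in>{n + L}. x i \<in> X i})"
    by (auto simp: le_iff_add add.commute)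
  have "{x::nat \<Rightarrow> real. \<forall>i\<in>{n + L}. x i \<in> X i} = (\<lambda>x. x (n + L)) -` X (n + L)" for n
    by auto
  then have "{x::nat \<Rightarrow> real. \<forall>i\<in>{n + L}. x i \<in> X i} \<in> sets borel" for n
    using measurable_sets[OF measurable_coordinate X, of "n + L" "n + L"] by simp
  then have "emeasure (level N) (\<Union>n. {x. \<forall>i\<in>{n + L}. x i \<in> X i})
      \<le> (\<Sum>n. emeasure (level N) {x. \<forall>i\<in>{n + L}. x i \<in> X i})"
    by (intro emeasure_subadditive_countably) auto
  also have "\<dots> = (\<Sum>n. emeasure (factor N (n + L)) (X (n + L)))"
    by (subst emeasure_level_cylinder) (auto intro: X)
  finally show ?thesis unfolding eq .
qed

lemma ell_add_ge: "4 ^ k * ell n \<le> ell (k + n)"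
proof (induction k)
  case (Suc k)
  have "4 * ell (k + n) \<le> ell (Suc (k + n))"
    using four_ell_le_gap[of "k + n"] four_gap_le_ell[of "k + n"] gap_pos[of "k + n"] by linarith
  with Suc show ?case by simp
qed simp

lemma suminf_inverse_ell_le:
  assumes "0 \<le> c"
  shows "(\<Sum>n. ennreal (c / ell (n + L))) \<le> ennreal (2 * c / ell L)"
proof -
  have "(\<lambda>n. (c / ell L) * (1 / 4) ^ n) sums ((c / ell L) * (1 / (1 - 1 / 4)))"
    by (intro sums_mult geometric_sums) simp
  then have s: "(\<Sum>n. ennreal ((c / ell L) * (1 / 4) ^ n)) = ennreal ((c / ell L) * (4 / 3))"
    using assms by (intro suminf_ennreal_eq) auto
  have "(\<Sum>n. ennreal (c / ell (n + L))) \<le> (\<Sum>n. ennreal ((c / ell L) * (1 / 4) ^ n))"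
  proof (intro suminf_le ennreal_leI)
    fix n
    have "c / ell (n + L) \<le> c / (4 ^ n * ell L)"
      using assms by (intro divide_left_mono ell_add_ge) auto
    then show "c / ell (n + L) \<le> (c / ell L) * (1 / 4) ^ n" by (simp add: field_simps power_one_over)
  qed auto
  also have "\<dots> \<le> ennreal (2 * c / ell L)"
    unfolding s using assms by (intro ennreal_leI) (auto simp: field_simps)
  finally show ?thesis .
qed

lemma measurable_rot_Collect:
  assumes "X \<in> sets borel"
  shows "{x. rot q u x \<in> X} \<in> sets borel" "{x. rot q u x \<notin> X} \<in> sets borel"
  using measurable_sets[OF measurable_rot_fixed assms, of q u] measurable_sets[OF measurable_rot_fixed, of "- X" q u] assms
  by (auto simp: vimage_def)

lemma emeasure_interval_escape:
  fixes a l u :: real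
  shows "emeasure lborel {x \<in> {a..<a + l}. x + u \<notin> {a..<a + l}} \<le> ennreal \<bar>u\<bar>"
proof (cases "0 \<le> u")
  case True
  have "emeasure lborel {x \<in> {a..<a + l}. x + u \<notin> {a..<a + l}} \<le> emeasure lborel {a + l - u..a + l}"
    using True by (intro emeasure_mono) auto
  then show ?thesis using True by simp
next
  case False
  have "emeasure lborel {x \<in> {a..<a + l}. x + u \<notin> {a..<a + l}} \<le> emeasure lborel {a..a - u}"
    using False by (intro emeasure_mono) auto
  then show ?thesis using False by simp
qed

text \<open>Only points within distance |u| of an end of one of the three intervals can leave
  \<open>base n\<close>, and the base has total length 3 * ell n.\<close>

lemma emeasure_factor_escape:
  assumes "N \<le> n"
  shows "emeasure (factor N n) {x. rot (circ n) u x \<notin> base n} \<le> ennreal (\<bar>u\<bar> / ell n)"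
proof -
  let ?E = "\<lambda>a. {x \<in> {a..<a + ell n}. x + u \<notin> {a..<a + ell n}}"
  have E: "?E a \<in> sets lborel" for a
  proof -
    have "?E a = {a..<a + ell n} - {a - u..<a + ell n - u}" by auto
    then show ?thesis by simp
  qed
  have sub: "base n \<inter> {x. rot (circ n) u x \<notin> base n} \<subseteq> ?E 0 \<union> ?E (gap n) \<union> ?E (3 * gap n)"
  proof
    fix x assume x: "x \<in> base n \<inter> {x. rot (circ n) u x \<notin> base n}"
    have "x + u \<notin> base n"
    proof
      assume "x + u \<in> base n"
      then have "rot (circ n) u x = x + u"
        using x base_subset(2)[of n] by (intro rot_eq_add) auto
      then show False using x \<open>x + u \<in> base n\<close> by simp
    qed
    then show "x \<in> ?E 0 \<union> ?E (gap n) \<union> ?E (3 * gap n)" using x by (auto simp: base_def)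
  qed
  have "emeasure lborel (base n \<inter> {x. rot (circ n) u x \<notin> base n})
      \<le> emeasure lborel (?E 0 \<union> ?E (gap n) \<union> ?E (3 * gap n))"
    using E by (intro emeasure_mono sub) auto
  also have "\<dots> \<le> emeasure lborel (?E 0 \<union> ?E (gap n)) + emeasure lborel (?E (3 * gap n))"
    using E by (intro emeasure_subadditive) auto
  also have "\<dots> \<le> (emeasure lborel (?E 0) + emeasure lborel (?E (gap n))) + emeasure lborel (?E (3 * gap n))"
    using E by (intro add_mono emeasure_subadditive) auto
  also have "\<dots> \<le> (ennreal \<bar>u\<bar> + ennreal \<bar>u\<bar>) + ennreal \<bar>u\<bar>"
    by (intro add_mono emeasure_interval_escape)
  also have "\<dots> = ennreal (3 * \<bar>u\<bar>)" by (simp add: ennreal_plus[symmetric] del: ennreal_plus)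
  finally have "emeasure lborel (base n \<inter> {x. rot (circ n) u x \<notin> base n}) / ennreal (3 * ell n)
      \<le> ennreal (3 * \<bar>u\<bar>) / ennreal (3 * ell n)"
    by (rule divide_right_mono_ennreal)
  also have "\<dots> = ennreal (\<bar>u\<bar> / ell n)" by (simp add: divide_ennreal)
  finally show ?thesis
    using assms by (simp add: emeasure_factor measurable_rot_Collect)
qed

text \<open>The escape probabilities are summable over the coordinates. This keeps the flow inside
  the restricted product: after time u almost every point still has all but finitely many
  coordinates in \<open>base\<close>.\<close>

lemma emeasure_level_escape:
  assumes "N \<le> L"
  shows "emeasure (level N) (- (irp_flow u -` tail L)) \<le> ennreal (2 * \<bar>u\<bar> / ell L)"
proof -
  have "- (irp_flow u -` tail L) = {x. \<exists>n\<ge>L. x n \<in> {y. rot (circ n) u y \<notin> base n}}"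
    by (auto simp: tail_def irp_flow_def)
  then have "emeasure (level N) (- (irp_flow u -` tail L))
      \<le> (\<Sum>n. emeasure (factor N (n + L)) {y. rot (circ (n + L)) u y \<notin> base (n + L)})"
    using emeasure_level_exists_ge[OF assms, of "\<lambda>n. {y. rot (circ n) u y \<notin> base n}"]
    by (simp add: measurable_rot_Collect)
  also have "\<dots> \<le> (\<Sum>n. ennreal (\<bar>u\<bar> / ell (n + L)))"
    using assms by (intro suminf_le emeasure_factor_escape) auto
  also have "\<dots> \<le> ennreal (2 * \<bar>u\<bar> / ell L)" by (rule suminf_inverse_ell_le) simp
  finally show ?thesis .
qed

lemma AE_level_tail: "N \<le> L \<Longrightarrow> AE x in level N. x \<in> tail L"
proof -
  assume "N \<le> L"
  from emeasure_level_escape[OF this, of 0] have "emeasure (level N) (- tail L) = 0"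
    by (simp add: vimage_def)
  then show ?thesis by (intro AE_I[of _ _ "- tail L"]) auto
qed

text \<open>Consistency of the levels is invariance at time 0.\<close>

lemma level_tail:
  assumes "N \<le> L" and B: "B \<in> sets borel"
  shows "ennreal (level_mass N) * emeasure (level N) B = ennreal (level_mass L) * emeasure (level L) (B \<inter> tail N)"
proof -
  have "emeasure (level N) (B \<inter> tail L) = emeasure (level N) B"
    using AE_level_tail[OF assms(1)] B by (intro emeasure_eq_AE) auto
  moreover have id: "irp_flow 0 = id" by (simp add: fun_eq_iff)
  ultimately show ?thesis using level_irp_flow[OF assms, of 0] by simp
qed

text \<open>The measures \<open>level_mass N * level N\<close> extend each other: the one at level \<open>N\<close> is the restriction of
  every later one to the points whose coordinates from \<open>N\<close> on lie in \<open>base\<close>.\<close>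

definition irp :: "(nat \<Rightarrow> real) measure" where
  "irp = (SUP N. scale_measure (ennreal (level_mass N)) (level N))"

lemma level_mass_mono:
  assumes "N \<le> L" "B \<in> sets borel"
  shows "ennreal (level_mass N) * emeasure (level N) B \<le> ennreal (level_mass L) * emeasure (level L) B"
  unfolding level_tail[OF assms] using assms by (intro mult_left_mono emeasure_mono) auto

lemma sets_irp [simp, measurable_cong]: "sets irp = sets borel"
  unfolding irp_def by (subst sets_SUP[where N=borel]) auto

lemma space_irp [simp]: "space irp = UNIV"
  using sets_eq_imp_space_eq[OF sets_irp] by simp

lemma emeasure_irp:
  assumes "B \<in> sets borel"
  shows "emeasure irp B = (SUP N. ennreal (level_mass N) * emeasure (level N) B)"
proof -
  let ?m = "\<lambda>N. scale_measure (ennreal (level_mass N)) (level N)"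
  have mono: "?m N \<le> ?m L" if "N \<le> L" for N L
    using level_mass_mono[OF that] by (subst le_measure) auto
  have "Complete_Partial_Order.chain (\<le>) (range ?m)"
    unfolding Complete_Partial_Order.chain_def
  proof (intro ballI)
    fix x y assume "x \<in> range ?m" "y \<in> range ?m"
    then obtain N L where "x = ?m N" "y = ?m L" by blast
    then show "x \<le> y \<or> y \<le> x" using mono[of N L] mono[of L N] linear[of N L] by auto
  qed
  then show ?thesis
    unfolding irp_def using assms by (subst emeasure_SUP_chain[where N=borel]) auto
qed

lemma emeasure_irp_tail:
  assumes B: "B \<in> sets borel"
  shows "emeasure irp (B \<inter> tail N) = ennreal (level_mass N) * emeasure (level N) B"
proof -
  have Bt: "B \<inter> tail N \<in> sets borel" using B by simp
  have eq: "ennreal (level_mass L) * emeasure (level L) (B \<inter> tail N) = ennreal (level_mass N) * emeasure (level N) B" if "N \<le> L" for L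
    using level_tail[OF that B] by simp
  show ?thesis
    unfolding emeasure_irp[OF Bt]
  proof (rule antisym)
    show "(SUP L. ennreal (level_mass L) * emeasure (level L) (B \<inter> tail N)) \<le> ennreal (level_mass N) * emeasure (level N) B"
    proof (rule SUP_least)
      fix L
      show "ennreal (level_mass L) * emeasure (level L) (B \<inter> tail N) \<le> ennreal (level_mass N) * emeasure (level N) B"
      proof (cases "N \<le> L")
        case True
        then show ?thesis using eq by simp
      next
        case False
        then show ?thesis using level_mass_mono[of L N, OF _ Bt] eq[of N] by simp
      qed
    qed
    show "ennreal (level_mass N) * emeasure (level N) B \<le> (SUP L. ennreal (level_mass L) * emeasure (level L) (B \<inter> tail N))"
      using eq[of N] by (intro SUP_upper2[of N]) auto
  qed
qed

text \<open>The part of \<open>tail N\<close> that is sent into B either lands in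
  \<open>tail L\<close>, where \<open>level_irp_flow\<close> compares it with B, or misses
  \<open>tail L\<close>, with mass at most level_mass N * (2 |u| / ell L). Letting L grow with N
  fixed removes the second part. Time -u supplies the reverse inequality afterwards.\<close>

lemma emeasure_irp_vimage_le:
  assumes B: "B \<in> sets borel"
  shows "emeasure irp (irp_flow u -` B) \<le> emeasure irp B"
  unfolding emeasure_irp[OF vimage_irp_flow_sets[OF B]]
proof (rule SUP_least)
  fix N
  interpret prob_space "level N" by (rule prob_space_level)
  have bound: "ennreal (level_mass N) * emeasure (level N) (irp_flow u -` B)
      \<le> emeasure irp B + ennreal (level_mass N * (2 * \<bar>u\<bar> / ell L))" if "N \<le> L" for L
  proof -
    have "emeasure (level N) (irp_flow u -` B)
        \<le> emeasure (level N) (irp_flow u -` (B \<inter> tail L) \<union> - (irp_flow u -` tail L))"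
      using B vimage_irp_flow_sets[of "B \<inter> tail L" u] vimage_irp_flow_sets[of "tail L" u]
      by (intro emeasure_mono) (auto simp: Compl_eq_Diff_UNIV)
    also have "\<dots> \<le> emeasure (level N) (irp_flow u -` (B \<inter> tail L)) + emeasure (level N) (- (irp_flow u -` tail L))"
      using B vimage_irp_flow_sets[of "B \<inter> tail L" u] vimage_irp_flow_sets[of "tail L" u]
      by (intro emeasure_subadditive) (auto simp: Compl_eq_Diff_UNIV)
    also have "\<dots> \<le> emeasure (level N) (irp_flow u -` (B \<inter> tail L)) + ennreal (2 * \<bar>u\<bar> / ell L)"
      using emeasure_level_escape[OF that] by (intro add_mono) auto
    finally have "ennreal (level_mass N) * emeasure (level N) (irp_flow u -` B)
        \<le> ennreal (level_mass N) * (emeasure (level N) (irp_flow u -` (B \<inter> tail L)) + ennreal (2 * \<bar>u\<bar> / ell L))"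
      by (intro mult_left_mono) auto
    also have "\<dots> = ennreal (level_mass L) * emeasure (level L) (B \<inter> irp_flow (- u) -` tail N) + ennreal (level_mass N * (2 * \<bar>u\<bar> / ell L))"
      unfolding distrib_left level_irp_flow[OF that B, of u] ennreal_mult'[OF less_imp_le[OF level_mass_pos]] ..
    also have "ennreal (level_mass L) * emeasure (level L) (B \<inter> irp_flow (- u) -` tail N) \<le> ennreal (level_mass L) * emeasure (level L) B"
      using B by (intro mult_left_mono emeasure_mono) auto
    also have "\<dots> \<le> emeasure irp B"
      unfolding emeasure_irp[OF B] by (intro SUP_upper) auto
    finally show ?thesis by (simp add: add_mono)
  qed
  have "(\<lambda>L. 2 * \<bar>u\<bar> / ell L) \<longlonglongrightarrow> 0"
  proof (rule tendsto_sandwich[of "\<lambda>_. 0"])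
    show "eventually (\<lambda>L. 2 * \<bar>u\<bar> / ell L \<le> 2 * \<bar>u\<bar> * (1 / 4) ^ L) sequentially"
    proof (intro always_eventually allI)
      fix L
      have "2 * \<bar>u\<bar> / ell L \<le> 2 * \<bar>u\<bar> / 4 ^ L" by (intro divide_left_mono ell_ge_power) auto
      then show "2 * \<bar>u\<bar> / ell L \<le> 2 * \<bar>u\<bar> * (1 / 4) ^ L" by (simp add: power_one_over)
    qed
    have "(\<lambda>L. 2 * \<bar>u\<bar> * (1 / 4) ^ L) \<longlonglongrightarrow> 2 * \<bar>u\<bar> * 0"
      by (intro tendsto_mult_left LIMSEQ_power_zero) simp
    then show "(\<lambda>L. 2 * \<bar>u\<bar> * (1 / 4) ^ L) \<longlonglongrightarrow> 0" by simp
  qed (auto intro!: always_eventually)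
  then have "(\<lambda>L. level_mass N * (2 * \<bar>u\<bar> / ell L)) \<longlonglongrightarrow> level_mass N * 0" by (rule tendsto_mult_left)
  then have "(\<lambda>L. emeasure irp B + ennreal (level_mass N * (2 * \<bar>u\<bar> / ell L))) \<longlonglongrightarrow> emeasure irp B + ennreal (level_mass N * 0)"
    by (intro tendsto_add tendsto_const tendsto_ennrealI)
  then have "(\<lambda>L. emeasure irp B + ennreal (level_mass N * (2 * \<bar>u\<bar> / ell L))) \<longlonglongrightarrow> emeasure irp B" by simp
  then show "ennreal (level_mass N) * emeasure (level N) (irp_flow u -` B) \<le> emeasure irp B"
    by (rule LIMSEQ_le_const) (use bound in blast)
qed

lemma emeasure_irp_vimage:
  assumes B: "B \<in> sets borel"
  shows "emeasure irp (irp_flow u -` B) = emeasure irp B"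
proof (rule antisym[OF emeasure_irp_vimage_le[OF B]])
  have "irp_flow (- u) -` (irp_flow u -` B) = B" using irp_flow_minus by auto
  then show "emeasure irp B \<le> emeasure irp (irp_flow u -` B)"
    using emeasure_irp_vimage_le[OF vimage_irp_flow_sets[OF B], of "- u" u] by simp
qed

lemma AE_irp_tail: "AE x in irp. \<exists>N. x \<in> tail N"
proof -
  have s: "- (\<Union>N. tail N) \<in> sets borel" by auto
  have "emeasure (level N) (- (\<Union>N. tail N)) = 0" for N
  proof -
    have "AE x in level N. x \<notin> - (\<Union>N. tail N)" using AE_level_tail[OF order_refl, of N] by eventually_elim auto
    then show ?thesis using s by (subst (asm) AE_iff_measurable[where N="- (\<Union>N. tail N)"]) auto
  qed
  then have "emeasure irp (- (\<Union>N. tail N)) = 0" using s by (simp add: emeasure_irp)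
  then show ?thesis using s by (intro AE_I[of _ _ "- (\<Union>N. tail N)"]) auto
qed

lemma emeasure_irp_tail_finite: "emeasure irp (tail N) < \<infinity>"
proof -
  interpret prob_space "level N" by (rule prob_space_level)
  have "emeasure irp (UNIV \<inter> tail N) = ennreal (level_mass N) * emeasure (level N) UNIV"
    by (rule emeasure_irp_tail) simp
  then show ?thesis using emeasure_space_1 by simp
qed

lemma sigma_finite_irp: "sigma_finite_measure irp"
proof
  let ?A = "insert (- (\<Union>N. tail N)) (range tail)"
  have s: "- (\<Union>N. tail N) \<in> sets borel" by auto
  have "emeasure irp (- (\<Union>N. tail N)) = 0"
    using AE_irp_tail s by (subst AE_iff_measurable[symmetric, where P="\<lambda>x. \<exists>N. x \<in> tail N"]) auto
  then have "\<forall>a\<in>?A. emeasure irp a \<noteq> \<infinity>" using emeasure_irp_tail_finite by (auto simp: less_top)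
  then show "\<exists>A. countable A \<and> A \<subseteq> sets irp \<and> \<Union>A = space irp \<and> (\<forall>a\<in>A. emeasure irp a \<noteq> \<infinity>)"
    using s by (intro exI[of _ ?A]) auto
qed

section \<open>Return times and partial rigidity\<close>

lemma ell_bracket:
  assumes "ell N \<le> v"
  obtains m where "N \<le> m" "ell m \<le> v" "v < ell (Suc m)"
proof -
  obtain k where k: "v < 4 ^ k" using real_arch_pow[of 4 v] by auto
  have ex: "\<exists>k. v < ell k" using less_le_trans[OF k ell_ge_power] by blast
  define k0 where "k0 = (LEAST k. v < ell k)"
  have k0: "v < ell k0" unfolding k0_def using ex by (rule LeastI_ex)
  have "N < k0"
  proof (rule ccontr)
    assume "\<not> N < k0"
    then have "ell k0 \<le> ell N" using strict_mono_mono[OF ell_mono_strict] by (simp add: mono_def)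
    then show False using k0 assms by simp
  qed
  then obtain m where m: "k0 = Suc m" "N \<le> m" by (cases k0) auto
  have "\<not> v < ell m" using not_less_Least[of m "\<lambda>k. v < ell k"] m by (simp add: k0_def)
  then show thesis using that m k0 by simp
qed

text \<open>\<open>base m\<close> lies in the first quarter of a circle of length 4 * ell (m + 1),
  so a displacement of at most three quarters that returns to it has not gone around. The bound 3
  accommodates the time 3 * v of \<open>triple_return\<close>.\<close>

lemma rot_base_eq_add:
  assumes y: "y \<in> base m" and v: "\<bar>v\<bar> \<le> 3 * ell (Suc m)" and r: "rot (circ m) v y \<in> base m"
  shows "rot (circ m) v y = y + v"
proof -
  have q: "circ m = 4 * ell (Suc m)" by (simp add: circ_def)
  have le: "3 * gap m + ell m \<le> ell (Suc m)"
    using four_ell_le_gap[of m] four_gap_le_ell[of m] ell_pos[of m] by linarith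
  have y0: "0 \<le> y" "y < 3 * gap m + ell m" using y base_subset(1)[of m] by auto
  show ?thesis
  proof (cases "0 \<le> y + v")
    case True
    then show ?thesis using y0 v le q by (intro rot_eq_add) auto
  next
    case False
    have "rot (circ m) v y = rot (circ m) (v + circ m * of_int 1) y"
      by (simp only: rot_add_multiple[OF circ_pos])
    also have "\<dots> = y + (v + circ m * of_int 1)"
      using y0 v le q False ell_pos[of "Suc m"] by (intro rot_eq_add) auto
    finally have "rot (circ m) v y \<ge> ell (Suc m)" using y0 v q by simp
    moreover have "rot (circ m) v y < 3 * gap m + ell m" using r base_subset(1)[of m] by auto
    ultimately show ?thesis using le by linarith
  qed
qed

lemma base_cases:
  assumes "y \<in> base m"
  obtains a e where "a = 0 \<or> a = 1 \<or> a = (3::real)" "y = a * gap m + e" "0 \<le> e" "e < ell m"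
proof -
  have "\<exists>a. (a = 0 \<or> a = 1 \<or> a = (3::real)) \<and> 0 \<le> y - a * gap m \<and> y - a * gap m < ell m"
    using assms by (auto simp: base_def)
  then obtain a where "a = 0 \<or> a = 1 \<or> a = (3::real)" "0 \<le> y - a * gap m" "y - a * gap m < ell m" by blast
  then show thesis using that[of a "y - a * gap m"] by simp
qed

text \<open>Among the points \<open>0, 1, 3\<close> the only configuration \<open>a, a + b, a + 3 * b\<close> with \<open>b \<noteq> 0\<close> is
  \<open>a = 0, b = 1\<close>; in particular \<open>b\<close> cannot be negative.  This is the source of the asymmetry of the
  flow under time reversal.\<close>

lemma triple_return:
  assumes x: "x \<in> tail N" "irp_flow v x \<in> tail N" "irp_flow (3 * v) x \<in> tail N" and v: "ell N \<le> \<bar>v\<bar>"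
  obtains m where "N \<le> m" "\<bar>v - gap m\<bar> < ell m"
proof -
  obtain m where m: "N \<le> m" "ell m \<le> \<bar>v\<bar>" "\<bar>v\<bar> < ell (Suc m)" using ell_bracket[OF v] .
  define y where "y = x m"
  have y: "y \<in> base m" "rot (circ m) v y \<in> base m" "rot (circ m) (3 * v) y \<in> base m"
    using x m(1) by (auto simp: tail_def irp_flow_def y_def)
  have y1: "y + v \<in> base m" using rot_base_eq_add[OF y(1) _ y(2)] y(2) m(3) by simp
  have y3: "y + 3 * v \<in> base m" using rot_base_eq_add[OF y(1) _ y(3)] y(3) m(3) by simp
  obtain a e where a: "a = 0 \<or> a = 1 \<or> a = 3" "y = a * gap m + e" "0 \<le> e" "e < ell m"
    using base_cases[OF y(1)] .
  obtain b f where b: "b = 0 \<or> b = 1 \<or> b = 3" "y + v = b * gap m + f" "0 \<le> f" "f < ell m"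
    using base_cases[OF y1] .
  obtain d g where d: "d = 0 \<or> d = 1 \<or> d = 3" "y + 3 * v = d * gap m + g" "0 \<le> g" "g < ell m"
    using base_cases[OF y3] .
  have le: "4 * ell m \<le> gap m" by (rule four_ell_le_gap)
  \<comment> \<open>The deviation of 3 (b - a) from d - a. It is an integer, and the offsets e, f, g
    account for less than 4 * ell m \<le> gap m, so it must vanish.\<close>
  define K where "K = 3 * b - 2 * a - d"
  have "K * gap m = g + 2 * e - 3 * f"
    using a(2) b(2) d(2) unfolding K_def by (simp add: algebra_simps)
  then have "\<bar>K * gap m\<bar> < gap m"
    using a(3,4) b(3,4) d(3,4) le by (simp add: abs_less_iff)
  then have "\<bar>K\<bar> < 1" by (simp add: abs_mult)
  moreover have "K = 0 \<or> 1 \<le> \<bar>K\<bar>"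
    unfolding K_def using a(1) b(1) d(1) by (elim disjE) simp_all
  ultimately have "K = 0" by linarith
  have v_eq: "v = (b - a) * gap m + (f - e)" using a(2) b(2) by (simp add: algebra_simps)
  have "b \<noteq> a"
  proof
    assume "b = a"
    then have "\<bar>v\<bar> < ell m" using v_eq a(3,4) b(3,4) by (simp add: abs_less_iff)
    then show False using m(2) by simp
  qed
  then have "a = 0 \<and> b = 1"
    using \<open>K = 0\<close> a(1) b(1) d(1) unfolding K_def by (elim disjE) simp_all
  then have "\<bar>v - gap m\<bar> < ell m" using v_eq a(3,4) b(3,4) by (simp add: abs_less_iff)
  then show thesis using that m(1) by blast
qed

text \<open>Such a v exceeds the extent of \<open>base m\<close> and is too short to go around the
  circle. The escape times of the labelled flow are chosen in this range.\<close>

lemma no_return: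
  assumes x: "x \<in> tail N" and m: "N \<le> m" and v: "4 * gap m \<le> v" "v \<le> 2 * ell (Suc m)"
  shows "irp_flow v x \<notin> tail N"
proof
  assume "irp_flow v x \<in> tail N"
  then have y: "x m \<in> base m" "rot (circ m) v (x m) \<in> base m"
    using x m by (auto simp: tail_def irp_flow_def)
  have "0 < gap m" "0 < ell (Suc m)" by simp_all
  then have "\<bar>v\<bar> \<le> 3 * ell (Suc m)" using v by linarith
  then have "rot (circ m) v (x m) = x m + v" by (intro rot_base_eq_add y)
  then have "x m + v < 3 * gap m + ell m" "0 \<le> x m" using y base_subset(1)[of m] by auto
  then show False using v four_ell_le_gap[of m] \<open>0 < gap m\<close> by linarith
qed

section \<open>Partial rigidity along the times gap n\<close>

definition first_piece :: "nat \<Rightarrow> (nat \<Rightarrow> real) set" where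
  "first_piece n = {x. x n \<in> {0..<ell n}}"

lemma first_piece_sets [measurable, simp]: "first_piece n \<in> sets borel"
  using measurable_sets[OF measurable_coordinate, of "{0..<ell n}" n] by (simp add: first_piece_def vimage_def)

definition boxes :: "(nat \<Rightarrow> real) set set" where
  "boxes = {{x. \<forall>i<k. x i \<in> X i} |k X. \<forall>i. X i \<in> sets borel}"

lemma box_sets:
  assumes "\<And>i. X i \<in> sets borel"
  shows "{x::nat \<Rightarrow> real. \<forall>i<(k::nat). x i \<in> X i} \<in> sets borel"
proof -
  have "{x::nat \<Rightarrow> real. \<forall>i<k. x i \<in> X i} = (\<Inter>i\<in>{..<k}. (\<lambda>x. x i) -` X i)" by auto
  moreover have "(\<lambda>x::nat \<Rightarrow> real. x i) -` X i \<in> sets borel" for i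
    using measurable_sets[OF measurable_coordinate assms, of i i] by simp
  ultimately show ?thesis by (cases k) auto
qed

lemma sets_boxes: "sets (borel :: (nat \<Rightarrow> real) measure) = sigma_sets UNIV boxes"
proof (rule antisym)
  have "sets (borel :: (nat \<Rightarrow> real) measure) = sets (PiM UNIV (\<lambda>_::nat. borel :: real measure))"
    by (simp add: sets_PiM_equal_borel)
  also have "\<dots> = sigma_sets UNIV {{f. f i \<in> A} |i A. A \<in> sets (borel :: real measure)}"
    unfolding sets_PiM_single by simp
  also have "\<dots> \<subseteq> sigma_sets UNIV boxes"
  proof (rule sigma_sets_mono, rule subsetI)
    fix B assume "B \<in> {{f. f i \<in> A} |(i::nat) A. A \<in> sets (borel :: real measure)}"
    then obtain i :: nat and A :: "real set" where B: "B = {f. f i \<in> A}" and A: "A \<in> sets borel" by blast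
    define X where "X j = (if j = i then A else UNIV)" for j
    have "B = {x. \<forall>j<Suc i. x j \<in> X j}" unfolding B by (auto simp: X_def)
    moreover have "\<forall>j. X j \<in> sets borel" using A by (simp add: X_def)
    ultimately have "B \<in> boxes" unfolding boxes_def by blast
    then show "B \<in> sigma_sets UNIV boxes" by (rule sigma_sets.Basic)
  qed
  finally show "sets (borel :: (nat \<Rightarrow> real) measure) \<subseteq> sigma_sets UNIV boxes" .
  have "boxes \<subseteq> sets borel" unfolding boxes_def using box_sets by blast
  then show "sigma_sets UNIV boxes \<subseteq> sets borel"
    using sets.sigma_sets_subset[of boxes borel] by simp
qed

lemma Int_stable_boxes: "Int_stable boxes"
proof (rule Int_stableI)
  fix a b assume "a \<in> boxes" "b \<in> boxes"
  then obtain k X l Y where a: "a = {x. \<forall>i<k. x i \<in> X i}" and b: "b = {x. \<forall>i<l. x i \<in> Y i}"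
    and X: "\<And>i. X i \<in> sets borel" and Y: "\<And>i. Y i \<in> sets borel" by (auto simp: boxes_def)
  let ?Z = "\<lambda>i. (if i < k then X i else UNIV) \<inter> (if i < l then Y i else UNIV)"
  have "a \<inter> b = {x. \<forall>i<max k l. x i \<in> ?Z i}" unfolding a b by (auto simp: less_max_iff_disj)
  moreover have "?Z i \<in> sets borel" for i using X Y by simp
  ultimately show "a \<inter> b \<in> boxes"
    unfolding boxes_def by (intro CollectI exI[of _ "max k l"] exI[of _ ?Z]) simp
qed

lemma emeasure_factor_piece:
  assumes "N \<le> n"
  shows "emeasure (factor N n) {0..<ell n} = ennreal (1 / 3)"
proof -
  have "base n \<inter> {0..<ell n} = {0..<ell n}" by (auto simp: base_def)
  then show ?thesis using assms by (simp add: emeasure_factor divide_ennreal)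
qed

text \<open>A box restricts finitely many coordinates, so for large n it is independent of
  \<open>first_piece n\<close>, which has probability 1/3. The first piece matters because from it
  the shifts by gap n and by 3 * gap n both stay in \<open>base n\<close>.\<close>

lemma tendsto_first_piece:
  assumes A: "A \<in> sets borel"
  shows "(\<lambda>n. measure (level N) (A \<inter> first_piece n)) \<longlonglongrightarrow> 1 / 3 * measure (level N) A"
proof -
  interpret prob_space "level N" by (rule prob_space_level)
  show ?thesis
  proof (rule tendsto_measure_generator[where N="level N" and G=boxes and \<Omega>=UNIV])
    show "finite_measure (level N)" by unfold_locales
    show "sets (level N) = sigma_sets UNIV boxes" by (simp add: sets_boxes)
    show "UNIV \<in> boxes"
      unfolding boxes_def by (intro CollectI exI[of _ 0] exI[of _ "\<lambda>_. UNIV"]) simp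
    show "measure (level N) (A \<inter> first_piece n) \<le> measure (level N) A" if "A \<in> sets (level N)" for n A
      using that by (intro finite_measure_mono) auto
    show "measure (level N) ((A \<union> B) \<inter> first_piece n)
        = measure (level N) (A \<inter> first_piece n) + measure (level N) (B \<inter> first_piece n)"
      if "A \<in> sets (level N)" "B \<in> sets (level N)" "A \<inter> B = {}" for n A B
      unfolding Int_Un_distrib2 using that by (intro finite_measure_Union) auto
    fix A assume "A \<in> boxes"
    then obtain k X where A: "A = {x. \<forall>i<k. x i \<in> X i}" and X: "\<And>i. X i \<in> sets borel"
      by (auto simp: boxes_def)
    have "measure (level N) (A \<inter> first_piece n) = 1 / 3 * measure (level N) A" if n: "max k N \<le> n" for n
    proof -
      let ?Y = "\<lambda>i. if i = n then {0..<ell n} else X i"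
      have "A \<inter> first_piece n = {x. \<forall>i\<in>insert n {..<k}. x i \<in> ?Y i}"
        using n by (auto simp: A first_piece_def)
      then have "emeasure (level N) (A \<inter> first_piece n) = (\<Prod>i\<in>insert n {..<k}. emeasure (factor N i) (?Y i))"
        using X by (simp only:) (rule emeasure_level_cylinder, auto)
      also have "\<dots> = emeasure (factor N n) {0..<ell n} * (\<Prod>i<k. emeasure (factor N i) (?Y i))"
        using n by simp
      also have "(\<Prod>i<k. emeasure (factor N i) (?Y i)) = (\<Prod>i<k. emeasure (factor N i) (X i))"
        using n by (intro prod.cong) auto
      also have "\<dots> = emeasure (level N) A" unfolding A by (rule emeasure_level_initial[OF X, symmetric])
      finally show ?thesis using n by (simp add: measure_def emeasure_factor_piece enn2real_mult)
    qed
    then show "(\<lambda>n. measure (level N) (A \<inter> first_piece n)) \<longlonglongrightarrow> 1 / 3 * measure (level N) A"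
      by (intro tendsto_eventually eventually_mono[OF eventually_ge_at_top[of "max k N"]])
  qed (use A Int_stable_boxes in auto)
qed

text \<open>The shift by c * gap n carries the first interval exactly onto another interval of the
  base; the extra c * e pushes out only a strip of that width at the right end.\<close>

lemma emeasure_piece_escape:
  assumes n: "N \<le> n" and c: "c = 1 \<or> c = 3" and e: "0 \<le> e" "e \<le> 1 / 3"
  shows "emeasure (factor N n) ({0..<ell n} \<inter> {x. rot (circ n) (c * (gap n + e)) x \<notin> base n}) \<le> ennreal (c * e / ell n)"
proof -
  let ?B = "{0..<ell n} \<inter> {x. rot (circ n) (c * (gap n + e)) x \<notin> base n}"
  have ce: "0 \<le> c * e" using c e by auto
  have sub: "?B \<subseteq> {ell n - c * e..ell n}"
  proof
    fix x assume x: "x \<in> ?B"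
    have "ell n - c * e \<le> x"
    proof (rule ccontr)
      assume "\<not> ell n - c * e \<le> x"
      then have lt: "x + c * e < ell n" by simp
      have "x + c * (gap n + e) \<in> base n"
        using c lt x ce by (auto simp: base_def algebra_simps)
      moreover have "x \<in> base n" using x by (auto simp: base_def)
      ultimately have "rot (circ n) (c * (gap n + e)) x \<in> base n"
        using subsetD[OF base_subset(2)[of n], of x] subsetD[OF base_subset(2)[of n], of "x + c * (gap n + e)"]
        by (subst rot_eq_add) auto
      then show False using x by simp
    qed
    then show "x \<in> {ell n - c * e..ell n}" using x by auto
  qed
  have Bs: "?B \<in> sets borel" by (simp add: measurable_rot_Collect)
  have "emeasure lborel (base n \<inter> ?B) \<le> emeasure lborel {ell n - c * e..ell n}"
    using sub by (intro emeasure_mono) auto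
  also have "\<dots> = ennreal (c * e)" using ce by simp
  finally have "emeasure lborel (base n \<inter> ?B) / ennreal (3 * ell n) \<le> ennreal (c * e) / ennreal (3 * ell n)"
    by (rule divide_right_mono_ennreal)
  also have "\<dots> \<le> ennreal (c * e / ell n)"
    using ce by (simp add: divide_ennreal) (intro ennreal_leI divide_left_mono, auto)
  finally show ?thesis using n Bs by (simp add: emeasure_factor)
qed

text \<open>There are three ranges of coordinates. Below n the time c * gap n is a whole number of
  turns, so only c * e acts; at n the first piece is used; above n the whole displacement is small
  compared with \<open>ell (Suc n)\<close>. The first two ranges together account for 6 * e.\<close>

lemma emeasure_level_piece_escape:
  assumes n: "N \<le> n" and c: "c = 1 \<or> c = 3" and e: "0 \<le> e" "e \<le> 1 / 3"
  shows "emeasure (level N) (first_piece n \<inter> - (irp_flow (c * (gap n + e)) -` tail N))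
    \<le> ennreal (6 * e + 6 * (gap n + e) / ell (Suc n))"
proof -
  let ?u = "c * (gap n + e)"
  let ?bad = "\<lambda>m. {x. rot (circ m) ?u x \<notin> base m}"
  define X where "X m = (if m < n then ?bad m else if m = n then {0..<ell n} \<inter> ?bad n else {})" for m
  have X: "X m \<in> sets borel" for m by (auto simp: X_def measurable_rot_Collect)
  have ce: "0 \<le> c * e" "c * e \<le> 3 * e" "c \<le> 3" "0 \<le> c" using c e by auto
  have sub: "first_piece n \<inter> - (irp_flow ?u -` tail N) \<subseteq> {x. \<exists>m\<ge>N. x m \<in> X m} \<union> - (irp_flow ?u -` tail (Suc n))"
  proof
    fix x assume x: "x \<in> first_piece n \<inter> - (irp_flow ?u -` tail N)"
    then obtain m where m: "N \<le> m" "rot (circ m) ?u (x m) \<notin> base m" by (auto simp: tail_def irp_flow_def)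
    show "x \<in> {x. \<exists>m\<ge>N. x m \<in> X m} \<union> - (irp_flow ?u -` tail (Suc n))"
    proof (cases "m \<le> n")
      case True
      then have "x m \<in> X m" using x m by (auto simp: X_def first_piece_def)
      then show ?thesis using m by blast
    next
      case False
      then show ?thesis using m by (auto simp: tail_def irp_flow_def Suc_le_eq)
    qed
  qed
  have s1: "{x. \<exists>m\<ge>N. x m \<in> X m} \<in> sets borel"
  proof -
    have "{x. \<exists>m\<ge>N. x m \<in> X m} = (\<Union>m\<in>{N..}. (\<lambda>x. x m) -` X m)" by auto
    moreover have "(\<lambda>x::nat \<Rightarrow> real. x m) -` X m \<in> sets borel" for m
      using measurable_sets[OF measurable_coordinate X, of m m] by simp
    ultimately show ?thesis by simp
  qed
  have s2: "- (irp_flow ?u -` tail (Suc n)) \<in> sets borel"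
    by (intro borel_comp vimage_irp_flow_sets tail_sets)
  have "emeasure (level N) (first_piece n \<inter> - (irp_flow ?u -` tail N))
      \<le> emeasure (level N) ({x. \<exists>m\<ge>N. x m \<in> X m} \<union> - (irp_flow ?u -` tail (Suc n)))"
    by (rule emeasure_mono[OF sub]) (unfold sets_level, rule sets.Un[OF s1 s2])
  also have "\<dots> \<le> emeasure (level N) {x. \<exists>m\<ge>N. x m \<in> X m} + emeasure (level N) (- (irp_flow ?u -` tail (Suc n)))"
    by (rule emeasure_subadditive) (unfold sets_level, rule s1, rule s2)
  also have "emeasure (level N) {x. \<exists>m\<ge>N. x m \<in> X m} \<le> ennreal (6 * e)"
  proof -
    have "emeasure (level N) {x. \<exists>m\<ge>N. x m \<in> X m} \<le> (\<Sum>k. emeasure (factor N (k + N)) (X (k + N)))"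
      using X by (rule emeasure_level_exists_ge[OF order_refl])
    also have "\<dots> \<le> (\<Sum>k. ennreal (c * e / ell (k + N)))"
    proof (intro suminf_le)
      fix k
      let ?m = "k + N"
      consider "?m < n" | "?m = n" | "n < ?m" by linarith
      then show "emeasure (factor N ?m) (X ?m) \<le> ennreal (c * e / ell ?m)"
      proof cases
        case 1
        obtain i :: int where i: "gap n = circ ?m * of_int i" using gap_multiple_circ[OF 1] by blast
        obtain ci :: int where ci: "c = of_int ci" using c by (metis of_int_1 of_int_numeral)
        have "?u = c * e + circ ?m * of_int (ci * i)" by (simp add: i ci algebra_simps)
        then have "rot (circ ?m) ?u = rot (circ ?m) (c * e)"
          by (intro ext) (simp only: rot_add_multiple[OF circ_pos])
        then have "X ?m = {x. rot (circ ?m) (c * e) x \<notin> base ?m}" using 1 by (simp add: X_def)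
        then show ?thesis using emeasure_factor_escape[of N ?m "c * e"] ce by simp
      next
        case 2
        then show ?thesis using emeasure_piece_escape[OF n c e] by (simp add: X_def)
      next
        case 3
        then show ?thesis by (simp add: X_def)
      qed
    qed auto
    also have "\<dots> \<le> ennreal (2 * (c * e) / ell N)" by (rule suminf_inverse_ell_le) (rule ce)
    also have "\<dots> \<le> ennreal (6 * e)"
    proof (rule ennreal_leI)
      have "2 * (c * e) / ell N \<le> 2 * (c * e) / 1"
        using ce ell_ge_1[of N] by (intro divide_left_mono) auto
      then show "2 * (c * e) / ell N \<le> 6 * e" using ce by simp
    qed
    finally show ?thesis .
  qed
  also have "emeasure (level N) (- (irp_flow ?u -` tail (Suc n))) \<le> ennreal (6 * (gap n + e) / ell (Suc n))"
  proof -
    have "emeasure (level N) (- (irp_flow ?u -` tail (Suc n))) \<le> ennreal (2 * \<bar>?u\<bar> / ell (Suc n))"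
      using n by (intro emeasure_level_escape) simp
    also have "\<dots> \<le> ennreal (6 * (gap n + e) / ell (Suc n))"
    proof (intro ennreal_leI divide_right_mono)
      have "0 \<le> gap n + e" using e by simp
      then show "2 * \<bar>?u\<bar> \<le> 6 * (gap n + e)" using c by (auto simp: abs_mult)
    qed auto
    finally show ?thesis .
  qed
  finally show ?thesis using e by (simp add: add_mono ennreal_plus[symmetric] del: ennreal_plus)
qed

text \<open>The intervals of \<open>rot\<close> are closed on the left and open on the right, so a
  small forward rotation is a translation, while a small backward one may jump. This is why the
  perturbations are taken nonnegative.\<close>

lemma tendsto_rot:
  assumes q: "0 < q" and u: "\<And>n. 0 \<le> u n" "u \<longlonglongrightarrow> 0"
  shows "(\<lambda>n. rot q (u n) y) \<longlonglongrightarrow> y"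
proof -
  define d where "d = q * (of_int \<lfloor>y / q\<rfloor> + 1) - y"
  have "0 < d" using floor_divide_upper[OF q, of y] by (simp add: d_def mult.commute)
  have "eventually (\<lambda>n. y + u n = rot q (u n) y) sequentially"
    using order_tendstoD(2)[OF u(2) \<open>0 < d\<close>]
  proof eventually_elim
    case (elim n)
    have "of_int \<lfloor>y / q\<rfloor> * q \<le> y" by (rule floor_divide_lower[OF q])
    then have "of_int \<lfloor>y / q\<rfloor> \<le> (y + u n) / q" using q u(1)[of n] by (simp add: pos_le_divide_eq)
    moreover have "(y + u n) / q < of_int \<lfloor>y / q\<rfloor> + 1"
      using q elim by (simp add: d_def pos_divide_less_eq mult.commute)
    ultimately have "\<lfloor>(y + u n) / q\<rfloor> = \<lfloor>y / q\<rfloor>" by (simp add: floor_eq_iff)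
    then show ?case by (simp add: rot_def)
  qed
  moreover have "(\<lambda>n. y + u n) \<longlonglongrightarrow> y + 0" by (intro tendsto_add tendsto_const u)
  ultimately show ?thesis by (simp add: Lim_transform_eventually)
qed

text \<open>As soon as n > m, coordinate m is rotated by c * e n alone, and convergence in the
  product topology is coordinatewise.\<close>

lemma tendsto_irp_flow:
  assumes c: "c = 1 \<or> c = 3" and e: "\<And>n. 0 \<le> e n" "e \<longlonglongrightarrow> 0"
  shows "(\<lambda>n. irp_flow (c * (gap n + e n)) x) \<longlonglongrightarrow> x"
proof -
  have coord: "(\<lambda>n. irp_flow (c * (gap n + e n)) x m) \<longlonglongrightarrow> x m" for m
  proof -
    have ce: "\<And>n. 0 \<le> c * e n" using c e by auto
    have "(\<lambda>n. c * e n) \<longlonglongrightarrow> c * 0" by (intro tendsto_mult_left e)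
    then have "(\<lambda>n. rot (circ m) (c * e n) (x m)) \<longlonglongrightarrow> x m"
      using ce by (intro tendsto_rot) auto
    moreover have "eventually (\<lambda>n. rot (circ m) (c * e n) (x m) = irp_flow (c * (gap n + e n)) x m) sequentially"
      using eventually_gt_at_top[of m]
    proof eventually_elim
      case (elim n)
      obtain i :: int where i: "gap n = circ m * of_int i" using gap_multiple_circ[OF elim] by blast
      obtain ci :: int where ci: "c = of_int ci" using c by (metis of_int_1 of_int_numeral)
      have "c * (gap n + e n) = c * e n + circ m * of_int (ci * i)" by (simp add: i ci algebra_simps)
      then show ?case unfolding irp_flow_def by (simp only: rot_add_multiple[OF circ_pos])
    qed
    ultimately show ?thesis by (rule Lim_transform_eventually)
  qed
  have "limitin (product_topology (\<lambda>_. euclidean) UNIV) (\<lambda>n. irp_flow (c * (gap n + e n)) x) x sequentially"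
    unfolding limitin_componentwise using coord by simp
  then show ?thesis by (simp only: euclidean_product_topology limitin_canonical_iff)
qed

lemma tendsto_measure_0:
  assumes P: "finite_measure P" and B: "\<And>n. B n \<in> sets P"
    and ev: "\<And>x. x \<in> space P \<Longrightarrow> eventually (\<lambda>n. x \<notin> B n) sequentially"
  shows "(\<lambda>n. measure P (B n)) \<longlonglongrightarrow> 0"
proof -
  interpret finite_measure P by fact
  have "(\<lambda>n. \<integral>x. indicat_real (B n) x \<partial>P) \<longlonglongrightarrow> (\<integral>x. 0 \<partial>P)"
  proof (rule integral_dominated_convergence[where w="\<lambda>_. 1"])
    show "AE x in P. (\<lambda>n. indicat_real (B n) x) \<longlonglongrightarrow> 0"
      by (intro AE_I2 tendsto_eventually, drule ev, erule eventually_mono) simp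
  qed (use B in auto)
  then show ?thesis using B by (simp add: sets.Int_space_eq2)
qed

lemma tendsto_gap_over_ell:
  assumes "\<And>n. 0 \<le> e n" "e \<longlonglongrightarrow> 0"
  shows "(\<lambda>n. 6 * e n + 6 * (gap n + e n) / ell (Suc n)) \<longlonglongrightarrow> 0"
proof -
  have "(\<lambda>n. gap n / ell (Suc n)) \<longlonglongrightarrow> 0"
  proof (rule tendsto_sandwich[of "\<lambda>_. 0"])
    show "eventually (\<lambda>n. gap n / ell (Suc n) \<le> (1 / 4) ^ n) sequentially"
    proof (intro always_eventually allI)
      fix n
      have "gap n / ell (Suc n) = 1 / 4 ^ (4 * n + 3)" unfolding ell_Suc_eq by simp
      also have "\<dots> \<le> 1 / 4 ^ n" by (intro divide_left_mono power_increasing) auto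
      finally show "gap n / ell (Suc n) \<le> (1 / 4) ^ n" by (simp add: power_one_over)
    qed
    show "(\<lambda>n. (1 / 4 :: real) ^ n) \<longlonglongrightarrow> 0" by (rule LIMSEQ_power_zero) simp
  qed (auto intro!: always_eventually)
  moreover have "(\<lambda>n. e n / ell (Suc n)) \<longlonglongrightarrow> 0"
  proof (rule tendsto_sandwich[OF _ _ tendsto_const assms(2)])
    show "eventually (\<lambda>n. e n / ell (Suc n) \<le> e n) sequentially"
    proof (intro always_eventually allI)
      fix n
      have "e n / ell (Suc n) \<le> e n / 1" using ell_ge_1 assms(1) by (intro divide_left_mono) auto
      then show "e n / ell (Suc n) \<le> e n" by simp
    qed
    show "eventually (\<lambda>n. 0 \<le> e n / ell (Suc n)) sequentially"
      using assms(1) by (intro always_eventually allI) simp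
  qed
  ultimately have "(\<lambda>n. 6 * e n + 6 * (gap n / ell (Suc n) + e n / ell (Suc n))) \<longlonglongrightarrow> 6 * 0 + 6 * (0 + 0)"
    using assms(2) by (intro tendsto_intros)
  then show ?thesis by (simp add: add_divide_distrib)
qed

text \<open>Inside one level, let B be the part of A in \<open>tail N\<close> and V a slightly
  larger open set. A point of the first piece of B that is not back in B at time c * (gap n + e n)
  has left V (rare, since the flow tends to the identity pointwise), or has left
  \<open>tail N\<close> (rare on the first piece), or has landed in V - B (small, by invariance). So
  a positive part of B returns at both times.\<close>

lemma partial_rigidity:
  assumes A: "A \<in> sets borel" and pos: "0 < emeasure irp A"
    and e: "\<And>n. 0 \<le> e n" "\<And>n. e n \<le> 1 / 3" "e \<longlonglongrightarrow> 0"
  shows "eventually (\<lambda>n. 0 < emeasure irp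
    (A \<inter> irp_flow (gap n + e n) -` A \<inter> irp_flow (3 * (gap n + e n)) -` A)) sequentially"
proof -
  obtain N where N: "0 < emeasure (level N) A"
  proof (rule ccontr)
    assume "\<not> thesis"
    then have "emeasure (level N) A = 0" for N using that by (auto simp: zero_less_iff_neq_zero)
    then show False using pos by (simp add: emeasure_irp[OF A])
  qed
  interpret prob_space "level N" by (rule prob_space_level)
  define B where "B = A \<inter> tail N"
  have B: "B \<in> sets borel" "B \<subseteq> tail N" "B \<subseteq> A" using A by (auto simp: B_def)
  have "emeasure (level N) B = emeasure (level N) A"
    unfolding B_def using AE_level_tail[OF order_refl, of N] A by (intro emeasure_eq_AE) auto
  then have \<alpha>: "0 < prob B" using N by (simp add: emeasure_eq_measure)
  \<comment> \<open>B meets the first piece in about prob B / 3 = 10 \<epsilon>. Each of the two bad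
    sets is covered by three parts of size at most \<epsilon>, so at least 9 \<epsilon> - 6
    \<epsilon> remains.\<close>
  define \<epsilon> where "\<epsilon> = prob B / 30"
  have \<epsilon>: "0 < \<epsilon>" using \<alpha> by (simp add: \<epsilon>_def)
  obtain V where V: "open V" "B \<subseteq> V" "prob V < prob B + \<epsilon>"
  proof -
    have "emeasure (level N) B = (INF U \<in> {U. B \<subseteq> U \<and> open U}. emeasure (level N) U)"
      using B(1) by (intro outer_regular) auto
    moreover have "emeasure (level N) B < ennreal (prob B + \<epsilon>)"
      using \<epsilon> by (simp add: emeasure_eq_measure ennreal_less_iff)
    ultimately have "(INF U \<in> {U. B \<subseteq> U \<and> open U}. emeasure (level N) U) < ennreal (prob B + \<epsilon>)" by simp
    then obtain U where "B \<subseteq> U" "open U" "emeasure (level N) U < ennreal (prob B + \<epsilon>)"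
      unfolding INF_less_iff by blast
    then show thesis using that[of U] by (simp add: emeasure_eq_measure ennreal_less_iff)
  qed
  have Vs: "V \<in> sets borel" using V(1) by simp
  define u where "u c n = c * (gap n + e n)" for c n
  define bad where "bad c n = B \<inter> first_piece n \<inter> - (irp_flow (u c n) -` B)" for c n
  have bad_sets: "bad c n \<in> sets borel" for c n
    unfolding bad_def using B(1) by (intro sets.Int borel_comp vimage_irp_flow_sets) auto
  have bad: "eventually (\<lambda>n. prob (bad c n) < 3 * \<epsilon>) sequentially" if c: "c = 1 \<or> c = 3" for c
  proof -
    let ?X1 = "\<lambda>n. B \<inter> - (irp_flow (u c n) -` V)"
    let ?X2 = "\<lambda>n. first_piece n \<inter> - (irp_flow (u c n) -` tail N)"
    let ?X3 = "\<lambda>n. irp_flow (u c n) -` ((V - B) \<inter> tail N)"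
    have s: "?X1 n \<in> events" "?X2 n \<in> events" "?X3 n \<in> events" for n
      unfolding sets_level
      by (intro sets.Int borel_comp vimage_irp_flow_sets sets.Diff first_piece_sets tail_sets B(1) Vs)+
    have "(\<lambda>n. prob (?X1 n)) \<longlonglongrightarrow> 0"
    proof (rule tendsto_measure_0[OF finite_measure_axioms s(1)])
      fix x
      show "eventually (\<lambda>n. x \<notin> ?X1 n) sequentially"
      proof (cases "x \<in> B")
        case True
        then have "eventually (\<lambda>n. irp_flow (u c n) x \<in> V) sequentially"
          using V topological_tendstoD[OF tendsto_irp_flow[OF c e(1,3), of x], of V] by (auto simp: u_def)
        then show ?thesis by eventually_elim auto
      qed simp
    qed
    then have 1: "eventually (\<lambda>n. prob (?X1 n) < \<epsilon>) sequentially" using \<epsilon> by (rule order_tendstoD(2))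
    have 2: "eventually (\<lambda>n. prob (?X2 n) < \<epsilon>) sequentially"
      using order_tendstoD(2)[OF tendsto_gap_over_ell[OF e(1,3)] \<epsilon>] eventually_ge_at_top[of N]
    proof eventually_elim
      case (elim n)
      have "emeasure (level N) (?X2 n) \<le> ennreal (6 * e n + 6 * (gap n + e n) / ell (Suc n))"
        unfolding u_def using elim c e by (intro emeasure_level_piece_escape) auto
      moreover have "0 \<le> 6 * e n + 6 * (gap n + e n) / ell (Suc n)"
        using e by (intro add_nonneg_nonneg divide_nonneg_pos) auto
      ultimately have "prob (?X2 n) \<le> 6 * e n + 6 * (gap n + e n) / ell (Suc n)"
        by (simp add: emeasure_eq_measure)
      then show ?case using elim by simp
    qed
    have 3: "prob (?X3 n) \<le> \<epsilon>" for n
    proof -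
      have VB: "V - B \<in> sets borel" using Vs B(1) by simp
      have m: "(V - B) \<inter> tail N \<in> sets borel" using VB by simp
      have "ennreal (level_mass N) * emeasure (level N) (?X3 n) = emeasure irp (?X3 n \<inter> tail N)"
        by (rule emeasure_irp_tail[OF vimage_irp_flow_sets[OF m], symmetric])
      also have "\<dots> \<le> emeasure irp (?X3 n)"
        by (rule emeasure_mono) (use vimage_irp_flow_sets[OF m] in auto)
      also have "\<dots> = emeasure irp ((V - B) \<inter> tail N)" by (rule emeasure_irp_vimage[OF m])
      also have "\<dots> = ennreal (level_mass N) * emeasure (level N) (V - B)" by (rule emeasure_irp_tail[OF VB])
      finally have "emeasure (level N) (?X3 n) \<le> emeasure (level N) (V - B)"
        using level_mass_pos[of N] by (subst (asm) ennreal_mult_le_mult_iff) auto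
      then have "prob (?X3 n) \<le> prob (V - B)" by (simp add: emeasure_eq_measure)
      also have "prob (V - B) = prob V - prob B" using V(2) Vs B(1) by (intro finite_measure_Diff) auto
      finally show ?thesis using V(3) by simp
    qed
    show ?thesis
      using 1 2
    proof eventually_elim
      case (elim n)
      have "bad c n \<subseteq> (?X1 n \<union> ?X2 n) \<union> ?X3 n" using B by (auto simp: bad_def)
      then have "prob (bad c n) \<le> prob ((?X1 n \<union> ?X2 n) \<union> ?X3 n)"
        using s[of n] by (intro finite_measure_mono sets.Un)
      also have "\<dots> \<le> prob (?X1 n \<union> ?X2 n) + prob (?X3 n)"
        using s[of n] by (intro measure_Un_le sets.Un)
      also have "prob (?X1 n \<union> ?X2 n) \<le> prob (?X1 n) + prob (?X2 n)"
        using s[of n] by (intro measure_Un_le)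
      finally show ?case using elim 3[of n] by simp
    qed
  qed
  have "eventually (\<lambda>n. 9 * \<epsilon> < prob (B \<inter> first_piece n)) sequentially"
    using \<alpha> by (intro order_tendstoD(1)[OF tendsto_first_piece[OF B(1)]]) (simp add: \<epsilon>_def)
  from this bad[of 1, simplified] bad[of 3, simplified] show ?thesis
  proof eventually_elim
    case (elim n)
    define G where "G = (B \<inter> first_piece n) - (bad 1 n \<union> bad 3 n)"
    have Bf: "B \<inter> first_piece n \<in> events" using B(1) by simp
    have Gs: "G \<in> sets borel" unfolding G_def using B(1) bad_sets by auto
    have "prob (bad 1 n \<union> bad 3 n) \<le> prob (bad 1 n) + prob (bad 3 n)"
      using bad_sets by (intro measure_Un_le) auto
    moreover have "prob G = prob (B \<inter> first_piece n) - prob (bad 1 n \<union> bad 3 n)"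
      unfolding G_def using Bf bad_sets by (intro finite_measure_Diff) (auto simp: bad_def)
    ultimately have "0 < prob G" using elim \<epsilon> by linarith
    then have "0 < ennreal (level_mass N) * emeasure (level N) G"
      using level_mass_pos[of N] by (simp add: emeasure_eq_measure ennreal_zero_less_mult_iff)
    also have "\<dots> = emeasure irp (G \<inter> tail N)" by (rule emeasure_irp_tail[OF Gs, symmetric])
    also have "\<dots> \<le> emeasure irp (A \<inter> irp_flow (gap n + e n) -` A \<inter> irp_flow (3 * (gap n + e n)) -` A)"
    proof (rule emeasure_mono)
      show "G \<inter> tail N \<subseteq> A \<inter> irp_flow (gap n + e n) -` A \<inter> irp_flow (3 * (gap n + e n)) -` A"
        using B by (auto simp: G_def bad_def u_def)
      show "A \<inter> irp_flow (gap n + e n) -` A \<inter> irp_flow (3 * (gap n + e n)) -` A \<in> sets irp"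
        unfolding sets_irp using A by (intro sets.Int vimage_irp_flow_sets)
    qed
    finally show ?case .
  qed
qed

section \<open>The labelled flow and its self-similarities\<close>

text \<open>Different gaps are separated from gap n by factors beyond 4^n, which \<rho> cannot
  bridge, so m = n. Then |\<rho> - 1| * gap n is below (1 + b) * ell n, and ell n is negligible
  against gap n.\<close>

lemma gap_ratio:
  fixes \<rho> u :: real
  assumes \<rho>: "\<bar>\<rho>\<bar> \<le> b" "1 \<le> \<bar>\<rho>\<bar> * 4 ^ n" and b: "b < 4 ^ n" and \<delta>: "1 + b < \<delta> * 4 ^ n"
    and u: "gap n \<le> u" "u \<le> gap n + 1" and m: "\<bar>\<rho> * u - gap m\<bar> < ell m"
  shows "\<bar>\<rho> - 1\<bar> < \<delta>"
proof -
  have em: "4 * ell m \<le> gap m" "0 < ell m" and en: "4 * ell n \<le> gap n" "1 \<le> ell n" "0 < gap n"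
    using four_ell_le_gap ell_ge_1 by auto
  have v: "3 * gap m < 4 * (\<rho> * u)" "4 * (\<rho> * u) < 5 * gap m" using m em by (auto simp: abs_less_iff)
  have u0: "0 < u" using u en by linarith
  have "0 < \<rho> * u" using v em by linarith
  then have \<rho>0: "0 < \<rho>" using u0 by (simp add: zero_less_mult_iff)
  have u2: "u \<le> 2 * gap n" using u en by linarith
  have "m = n"
  proof (rule ccontr)
    assume "m \<noteq> n"
    then consider "n < m" | "m < n" by linarith
    then show False
    proof cases
      case 1
      then have "ell (Suc n) \<le> ell m" using strict_mono_mono[OF ell_mono_strict] by (simp add: mono_def)
      then have "4 * ell (Suc n) \<le> gap m" using em by linarith
      moreover have "4 ^ n * gap n \<le> ell (Suc n)"
        unfolding ell_Suc_eq by (intro mult_right_mono power_increasing) auto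
      moreover have "\<rho> * u \<le> b * (2 * gap n)" using \<rho> \<rho>0 u2 u0 by (intro mult_mono) auto
      moreover have "b * gap n < 4 ^ n * gap n" using b en by (intro mult_strict_right_mono) auto
      moreover have "0 < 4 ^ n * gap n" by simp
      ultimately show False using v(1) by linarith
    next
      case 2
      then have "ell (Suc m) \<le> ell n" using strict_mono_mono[OF ell_mono_strict] by (simp add: mono_def)
      then have "4 * gap m \<le> ell n" using four_gap_le_ell[of m] by linarith
      moreover have "4 ^ n * ell n \<le> gap n"
        unfolding gap_eq by (intro mult_right_mono power_increasing) auto
      then have "\<rho> * (4 ^ n * ell n) \<le> \<rho> * u" using \<rho>0 u by (intro mult_left_mono) auto
      moreover have "1 * ell n \<le> (\<rho> * 4 ^ n) * ell n" using \<rho> \<rho>0 by (intro mult_right_mono) auto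
      ultimately have "4 * gap m \<le> \<rho> * u" unfolding mult_1 mult.assoc by linarith
      then show False using v(2) em by linarith
    qed
  qed
  have "\<bar>\<rho> - 1\<bar> * gap n = \<bar>(\<rho> - 1) * gap n\<bar>" using en by (simp add: abs_mult)
  also have "(\<rho> - 1) * gap n = (\<rho> * u - gap n) - \<rho> * (u - gap n)" by (simp add: algebra_simps)
  also have "\<bar>\<dots>\<bar> \<le> \<bar>\<rho> * u - gap n\<bar> + \<bar>\<rho> * (u - gap n)\<bar>" by (rule abs_triangle_ineq4)
  also have "\<bar>\<rho> * (u - gap n)\<bar> \<le> b * 1"
    unfolding abs_mult using \<rho> u by (intro mult_mono) auto
  also have "\<bar>\<rho> * u - gap n\<bar> + b * 1 < (1 + b) * ell n"
  proof -
    have "0 \<le> b" using \<rho> by linarith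
    then have "b * 1 \<le> b * ell n" using en by (intro mult_left_mono) auto
    then show ?thesis using m \<open>m = n\<close> by (simp add: algebra_simps)
  qed
  also have "(1 + b) * ell n \<le> (\<delta> * 4 ^ n) * ell n" using \<delta> en by (intro mult_right_mono) auto
  also have "\<dots> \<le> \<delta> * gap n"
  proof -
    have "0 \<le> b" using \<rho> by linarith
    then have "0 < \<delta> * 4 ^ n" using \<delta> by linarith
    then have "0 \<le> \<delta>" by (simp add: zero_less_mult_iff)
    moreover have "4 ^ n * ell n \<le> gap n"
      unfolding gap_eq by (intro mult_right_mono power_increasing) auto
    ultimately show ?thesis by (simp add: mult.assoc mult_left_mono)
  qed
  finally show ?thesis using en by simp
qed

text \<open>A point of A that is sent into B at a late time \<tau> n lies outside G N or is sent
  outside G N. Both parts are small for N large, because the sets G N exhaust the space and A and B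
  have finite measure.\<close>

lemma zero_type_criterion:
  fixes \<tau> :: "nat \<Rightarrow> real"
  assumes T: "measure_preserving_flow M T"
    and G: "\<And>N. G N \<in> sets M" "incseq G" "AE x in M. \<exists>N. x \<in> G N"
    and disj: "\<And>N. eventually (\<lambda>n. \<forall>x\<in>G N. T (\<tau> n) x \<notin> G N) sequentially"
    and A: "A \<in> finite_sets M" and B: "B \<in> finite_sets M"
  shows "(\<lambda>n. measure M (A \<inter> (T (\<tau> n) -` B \<inter> space M))) \<longlonglongrightarrow> 0"
proof -
  have lim: "(\<lambda>N. measure M (A - G N)) \<longlonglongrightarrow> 0" if A: "A \<in> finite_sets M" for A
  proof -
    have "(\<lambda>N. emeasure M (A - G N)) \<longlonglongrightarrow> emeasure M (\<Inter>N. A - G N)"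
    proof (rule Lim_emeasure_decseq)
      show "range (\<lambda>N. A - G N) \<subseteq> sets M" using A G by (auto simp: finite_sets_def)
      show "decseq (\<lambda>N. A - G N)" using G(2) by (fastforce simp: decseq_def incseq_def)
      have "emeasure M (A - G N) \<le> emeasure M A" for N
        using A by (intro emeasure_mono) (auto simp: finite_sets_def)
      then show "emeasure M (A - G N) \<noteq> \<infinity>" for N
        using A unfolding finite_sets_def by (metis (mono_tags) infinity_ennreal_def less_top mem_Collect_eq top.extremum_unique)
    qed
    moreover have "emeasure M (\<Inter>N. A - G N) = emeasure M {}"
    proof (rule emeasure_eq_AE)
      show "AE x in M. (x \<in> (\<Inter>N. A - G N)) = (x \<in> {})" using G(3) by eventually_elim auto
      show "(\<Inter>N. A - G N) \<in> sets M" using A G by (auto simp: finite_sets_def)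
    qed simp
    ultimately have "(\<lambda>N. emeasure M (A - G N)) \<longlonglongrightarrow> ennreal 0" by simp
    from tendsto_enn2real[OF this] show ?thesis unfolding measure_def by simp
  qed
  have fin: "A - G N \<in> finite_sets M" if "A \<in> finite_sets M" for A N
    using that G(1)[of N] emeasure_mono[of "A - G N" A M] by (auto simp: finite_sets_def)
  show ?thesis
  proof (rule LIMSEQ_I)
    fix r :: real assume r: "0 < r"
    have "eventually (\<lambda>N. measure M (A - G N) < r / 2 \<and> measure M (B - G N) < r / 2) sequentially"
      using order_tendstoD(2)[OF lim[OF A], of "r / 2"] order_tendstoD(2)[OF lim[OF B], of "r / 2"] r
      by (auto intro: eventually_conj)
    then obtain N where N: "measure M (A - G N) < r / 2" "measure M (B - G N) < r / 2"
      by (auto simp: eventually_sequentially)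
    obtain n0 where n0: "\<And>n x. n0 \<le> n \<Longrightarrow> x \<in> G N \<Longrightarrow> T (\<tau> n) x \<notin> G N"
      using disj[of N] by (auto simp: eventually_sequentially)
    show "\<exists>n0. \<forall>n\<ge>n0. norm (measure M (A \<inter> (T (\<tau> n) -` B \<inter> space M)) - 0) < r"
    proof (intro exI allI impI)
      fix n assume n: "n0 \<le> n"
      let ?V = "T (\<tau> n) -` (B - G N) \<inter> space M"
      have V: "?V \<in> finite_sets M" by (rule finite_sets_flow_vimage[OF T fin[OF B]])
      have "A \<inter> (T (\<tau> n) -` B \<inter> space M) \<subseteq> (A - G N) \<union> ?V" using n0[OF n] by auto
      then have "measure M (A \<inter> (T (\<tau> n) -` B \<inter> space M)) \<le> measure M ((A - G N) \<union> ?V)"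
        using V fin[OF A, of N] Union_finite_sets[of "[A - G N, ?V]" M]
        by (intro measure_mono_fmeasurable) (auto simp: fmeasurable_def finite_sets_def
            intro!: sets.Int finite_setsD(1)[OF A, simplified] measurable_sets[OF measure_preserving_flowD(1)[OF T] finite_setsD(1)[OF B]])
      also have "\<dots> \<le> measure M (A - G N) + measure M ?V"
        using V fin[OF A, of N] by (intro measure_Un_le) (auto simp: finite_sets_def)
      also have "measure M ?V = measure M (B - G N)"
        unfolding measure_def using fin[OF B, of N] by (subst emeasure_flow_vimage[OF T]) (auto simp: finite_sets_def)
      finally show "norm (measure M (A \<inter> (T (\<tau> n) -` B \<inter> space M)) - 0) < r" using N by simp
    qed
  qed
qed

text \<open>Conjugation by a bijective coding. It allows the isomorphism problem to be treated on a
  product space, where the labels are visible, and then moved to the space of sequences.\<close>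

lemma flow_isomorphic_transfer:
  assumes f: "f \<in> M \<rightarrow>\<^sub>M N" and g: "g \<in> N \<rightarrow>\<^sub>M M" and gf: "\<And>x. x \<in> space M \<Longrightarrow> g (f x) = x"
    and N: "distr M N f = N" and iso: "flow_isomorphic M S T"
    and fg: "\<And>y. y \<in> space N \<Longrightarrow> f (g y) = y"
    and T: "\<And>t x. x \<in> space M \<Longrightarrow> T t x \<in> space M"
  shows "flow_isomorphic N (\<lambda>t y. f (S t (g y))) (\<lambda>t y. f (T t (g y)))"
proof -
  obtain Q Q' where Q: "Q \<in> M \<rightarrow>\<^sub>M M" and Q': "Q' \<in> M \<rightarrow>\<^sub>M M"
    and inv: "AE x in M. Q' (Q x) = x" "AE x in M. Q (Q' x) = x"
    and d: "distr M M Q = M" "distr M M Q' = M"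
    and ST: "\<And>t. AE x in M. Q' (T t (Q x)) = S t x"
    using iso by (auto simp: flow_isomorphic_def invertible_mod_null_def)
  have M: "distr N M g = M"
  proof -
    have "distr N M g = distr (distr M N f) M g" by (simp add: N)
    also have "\<dots> = distr M M (g \<circ> f)" by (rule distr_distr[OF g f])
    also have "\<dots> = distr M M id" by (rule distr_cong) (auto simp: gf)
    finally show ?thesis by (simp add: id_def)
  qed
  have AE: "AE y in N. P (g y)" if "AE x in M. P x" for P
  proof -
    have "AE x in distr N M g. P x" using that by (simp only: M)
    then show ?thesis by (rule AE_distrD[OF g])
  qed
  have sp: "y \<in> space N \<Longrightarrow> g y \<in> space M" "x \<in> space M \<Longrightarrow> Q x \<in> space M" "x \<in> space M \<Longrightarrow> Q' x \<in> space M" for x y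
    using measurable_space[OF g] measurable_space[OF Q] measurable_space[OF Q'] by auto
  have dN: "distr N N (\<lambda>y. f (R (g y))) = N" if R: "R \<in> M \<rightarrow>\<^sub>M M" "distr M M R = M" for R
  proof -
    have "distr N N (\<lambda>y. f (R (g y))) = distr (distr (distr N M g) M R) N f"
      by (subst distr_distr[OF R(1) g], subst distr_distr[OF f measurable_comp[OF g R(1)]]) (simp add: comp_def)
    then show ?thesis by (simp add: M R N)
  qed
  have m: "(\<lambda>y. f (R (g y))) \<in> N \<rightarrow>\<^sub>M N" if R: "R \<in> M \<rightarrow>\<^sub>M M" for R
    using measurable_compose[OF measurable_compose[OF g R] f] .
  show ?thesis
    unfolding flow_isomorphic_def invertible_mod_null_def
  proof (intro exI conjI allI)
    show "(\<lambda>y. f (Q (g y))) \<in> N \<rightarrow>\<^sub>M N" "(\<lambda>y. f (Q' (g y))) \<in> N \<rightarrow>\<^sub>M N" using m Q Q' by auto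
    show "distr N N (\<lambda>y. f (Q (g y))) = N" "distr N N (\<lambda>y. f (Q' (g y))) = N" using dN Q Q' d by auto
    show "AE y in N. f (Q' (g (f (Q (g y))))) = y"
      using AE[OF inv(1)] AE_space by eventually_elim (simp add: gf fg sp)
    show "AE y in N. f (Q (g (f (Q' (g y))))) = y"
      using AE[OF inv(2)] AE_space by eventually_elim (simp add: gf fg sp)
    show "AE y in N. f (Q' (g (f (T t (g (f (Q (g y)))))))) = f (S t (g y))" for t
      using AE[OF ST[of t]] AE_space by eventually_elim (simp add: gf sp T)
  qed
qed

lemma second_countable_euclidean: "second_countable (euclidean :: 'a::second_countable_topology topology)"
proof -
  obtain \<B> :: "'a set set" where B: "countable \<B>" "topological_basis \<B>" using ex_countable_basis by blast
  then have "\<forall>U x. open U \<and> x \<in> U \<longrightarrow> (\<exists>V\<in>\<B>. x \<in> V \<and> V \<subseteq> U)" by (metis topological_basisE)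
  then show ?thesis
    unfolding second_countable_def using B topological_basis_open[OF B(2)] by auto
qed

lemma standard_borel_polish:
  fixes M :: "'a::polish_space measure"
  assumes "sets M = sets borel"
  shows "standard_borel M"
proof -
  have sp: "space M = UNIV" using sets_eq_imp_space_eq[OF assms] by simp
  show ?thesis
    unfolding standard_borel_def
    by (intro exI[of _ euclidean])
      (simp add: sp assms completely_metrizable_space_euclidean second_countable_euclidean borel_def)
qed

lemma measurable_irp_flow_compose [measurable (raw)]:
  assumes f: "f \<in> M \<rightarrow>\<^sub>M borel" and g: "g \<in> M \<rightarrow>\<^sub>M borel"
  shows "(\<lambda>p. irp_flow (f p) (g p)) \<in> M \<rightarrow>\<^sub>M borel"
  using measurable_compose[OF measurable_Pair[OF f g] measurable_irp_flow_pair] by simp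

lemma emeasure_irp_UNIV: "0 < emeasure irp UNIV"
proof -
  interpret prob_space "level 0" by (rule prob_space_level)
  have "ennreal (level_mass 0) * emeasure (level 0) UNIV = emeasure irp (UNIV \<inter> tail 0)"
    by (rule emeasure_irp_tail[symmetric]) simp
  also have "\<dots> \<le> emeasure irp UNIV" by (intro emeasure_mono) auto
  finally have "1 \<le> emeasure irp UNIV"
    using emeasure_space_1 by (simp add: level_mass_def)
  then show ?thesis by (rule less_le_trans[rotated]) simp
qed

interpretation irp: sigma_finite_measure irp
  by (rule sigma_finite_irp)

section \<open>The flow with labels and its escape times\<close>

definition fibre_flow :: "real \<Rightarrow> (real \<times> real) \<times> (nat \<Rightarrow> real) \<Rightarrow> (real \<times> real) \<times> (nat \<Rightarrow> real)" where
  "fibre_flow t z = (fst z, irp_flow (fst (fst z) * t) (snd z))"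

lemma fibre_flow_0 [simp]: "fibre_flow 0 z = z"
  by (simp add: fibre_flow_def)

lemma fibre_flow_add: "fibre_flow (s + t) z = fibre_flow s (fibre_flow t z)"
  by (simp add: fibre_flow_def distrib_left irp_flow_add)

text \<open>The label law lives on the whole real line, with positivity almost everywhere, so that
  the product spaces are built from Borel sigma-algebras of full types.\<close>

locale label_law = prob_space k for k :: "real measure" +
  assumes sets_k [measurable_cong]: "sets k = sets borel" and pos_k: "AE s in k. 0 < s"
begin

lemma space_k [simp]: "space k = UNIV"
  using sets_eq_imp_space_eq[OF sets_k] by simp

text \<open>The second coordinate carries no dynamics: rescaling it absorbs the density of one label law
  with respect to an equivalent one.\<close>

definition labels :: "(real \<times> real) measure" where
  "labels = k \<Otimes>\<^sub>M lborel"

definition fibred :: "((real \<times> real) \<times> (nat \<Rightarrow> real)) measure" where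
  "fibred = labels \<Otimes>\<^sub>M irp"

lemma sets_labels [measurable_cong]: "sets labels = sets (borel \<Otimes>\<^sub>M borel)"
  unfolding labels_def by (intro sets_pair_measure_cong sets_k) simp

lemma sets_fibred [measurable_cong]: "sets fibred = sets ((borel \<Otimes>\<^sub>M borel) \<Otimes>\<^sub>M borel)"
  unfolding fibred_def by (intro sets_pair_measure_cong sets_labels) simp

lemma space_labels [simp]: "space labels = UNIV" and space_fibred [simp]: "space fibred = UNIV"
  using sets_eq_imp_space_eq[OF sets_labels] sets_eq_imp_space_eq[OF sets_fibred]
  by (auto simp: space_pair_measure)

sublocale label_pair: pair_sigma_finite k lborel ..

lemma sigma_finite_labels: "sigma_finite_measure labels"
  unfolding labels_def by unfold_locales

sublocale fibred: pair_sigma_finite labels irp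
  unfolding pair_sigma_finite_def using sigma_finite_labels irp.sigma_finite_measure_axioms by simp

lemma sigma_finite_fibred: "sigma_finite_measure fibred"
  unfolding fibred_def by (rule fibred.sigma_finite_measure_axioms)

lemma measurable_fibre_flow_pair [measurable]: "(\<lambda>(t, z). fibre_flow t z) \<in> borel \<Otimes>\<^sub>M fibred \<rightarrow>\<^sub>M fibred"
  unfolding fibre_flow_def case_prod_beta fibred_def labels_def by measurable

lemma measurable_fibre_flow [measurable]: "fibre_flow t \<in> fibred \<rightarrow>\<^sub>M fibred"
  unfolding fibre_flow_def[abs_def] fibred_def labels_def by measurable

lemma emeasure_fibred:
  assumes "B \<in> sets fibred"
  shows "emeasure fibred B = (\<integral>\<^sup>+y. emeasure irp (Pair y -` B) \<partial>labels)"
  using assms unfolding fibred_def by (rule irp.emeasure_pair_measure_alt)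

lemma section_sets:
  assumes "B \<in> sets fibred"
  shows "Pair y -` B \<in> sets borel"
  using sets_Pair1[of B labels irp y] assms by (simp add: fibred_def)

lemma distr_fibre_flow: "distr fibred fibred (fibre_flow t) = fibred"
proof (rule measure_eqI)
  fix B assume "B \<in> sets (distr fibred fibred (fibre_flow t))"
  then have B: "B \<in> sets fibred" by simp
  have V: "fibre_flow t -` B \<in> sets fibred" using measurable_sets[OF measurable_fibre_flow B, of t] by simp
  have "Pair y -` (fibre_flow t -` B) = irp_flow (fst y * t) -` (Pair y -` B)" for y
    by (auto simp: fibre_flow_def)
  then have "emeasure fibred (fibre_flow t -` B) = emeasure fibred B"
    by (simp add: emeasure_fibred[OF V] emeasure_fibred[OF B] emeasure_irp_vimage[OF section_sets[OF B]])
  then show "emeasure (distr fibred fibred (fibre_flow t)) B = emeasure fibred B"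
    using B by (simp add: emeasure_distr)
qed simp

lemma emeasure_fibred_label:
  assumes B: "B \<in> sets borel"
  shows "emeasure fibred {z. fst (fst z) \<in> B} = 0 \<longleftrightarrow> emeasure k B = 0"
proof -
  have "{z::(real \<times> real) \<times> (nat \<Rightarrow> real). fst (fst z) \<in> B} = (B \<times> UNIV) \<times> UNIV" by auto
  then have "emeasure fibred {z. fst (fst z) \<in> B} = emeasure labels (B \<times> UNIV) * emeasure irp UNIV"
    unfolding fibred_def using B by (simp only:) (rule irp.emeasure_pair_measure_Times, simp_all add: sets_labels)
  also have "emeasure labels (B \<times> UNIV) = emeasure k B * emeasure lborel (UNIV :: real set)"
    unfolding labels_def using B by (intro lborel.emeasure_pair_measure_Times) (simp_all add: sets_k)
  finally show ?thesis using emeasure_irp_UNIV by (simp add: zero_less_iff_neq_zero)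
qed

lemma emeasure_fibred_UNIV: "emeasure fibred UNIV = \<infinity>"
proof -
  have "emeasure fibred (UNIV \<times> UNIV) = emeasure labels UNIV * emeasure irp UNIV"
    unfolding fibred_def using sets.top[of labels] by (intro irp.emeasure_pair_measure_Times) simp_all
  moreover have "emeasure labels (UNIV \<times> UNIV) = emeasure k UNIV * emeasure lborel (UNIV :: real set)"
    unfolding labels_def by (rule lborel.emeasure_pair_measure_Times) (simp_all add: sets_k)
  ultimately show ?thesis
    using emeasure_irp_UNIV emeasure_space_1 by (simp add: ennreal_top_mult)
qed

lemma AE_fibredI:
  assumes "AE s in k. P s"
  shows "AE z in fibred. P (fst (fst z))"
proof -
  obtain N where N: "N \<in> sets k" "emeasure k N = 0" "{s. \<not> P s} \<subseteq> N"
    using assms by (auto elim!: AE_E)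
  have "emeasure fibred {z. fst (fst z) \<in> N} = 0" using N by (simp add: emeasure_fibred_label sets_k)
  moreover have "{z::(real \<times> real) \<times> (nat \<Rightarrow> real). fst (fst z) \<in> N} = (N \<times> UNIV) \<times> UNIV" by auto
  then have "{z. fst (fst z) \<in> N} \<in> sets fibred"
    unfolding fibred_def labels_def by (simp only:) (intro pair_measureI N(1), simp_all)
  ultimately show ?thesis using N(3) by (intro AE_I[of _ _ "{z. fst (fst z) \<in> N}"]) auto
qed

lemma AE_fibred_pos: "AE z in fibred. 0 < fst (fst z)"
  by (rule AE_fibredI) (rule pos_k)

lemma AE_fibred_tail: "AE z in fibred. \<exists>N. snd z \<in> tail N"
proof -
  have "AE z in labels \<Otimes>\<^sub>M irp. \<exists>N. snd z \<in> tail N"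
  proof (rule fibred.AE_pair_measure)
    show "{z \<in> space (labels \<Otimes>\<^sub>M irp). \<exists>N. snd z \<in> tail N} \<in> sets (labels \<Otimes>\<^sub>M irp)" by measurable
    show "AE x in labels. AE y in irp. \<exists>N. snd (x, y) \<in> tail N" using AE_irp_tail by simp
  qed
  then show ?thesis by (simp only: fibred_def)
qed

text \<open>It is above gap n by the factor 4^n and below ell (n + 1) by the factor 4^(3n + 3). Both
  margins grow, so multiplication by labels bounded away from 0 and infinity eventually keeps it in
  the range of \<open>no_return\<close>.\<close>

definition escape_time :: "nat \<Rightarrow> real" where "escape_time n = 4 ^ n * gap n"

definition window :: "nat \<Rightarrow> ((real \<times> real) \<times> (nat \<Rightarrow> real)) set" where
  "window N = {z. 1 / (real N + 1) \<le> fst (fst z) \<and> fst (fst z) \<le> real N + 1 \<and> snd z \<in> tail N}"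

lemma window_sets: "window N \<in> sets fibred"
proof -
  have "window N = {z \<in> space (labels \<Otimes>\<^sub>M irp). 1 / (real N + 1) \<le> fst (fst z) \<and> fst (fst z) \<le> real N + 1 \<and> snd z \<in> tail N}"
    by (auto simp: window_def space_pair_measure)
  also have "\<dots> \<in> sets (labels \<Otimes>\<^sub>M irp)" unfolding labels_def by measurable
  finally show ?thesis by (simp only: fibred_def)
qed

lemma window_mono: "N \<le> L \<Longrightarrow> window N \<subseteq> window L"
proof
  fix z assume "N \<le> L" "z \<in> window N"
  moreover have "1 / (real L + 1) \<le> 1 / (real N + 1)" using \<open>N \<le> L\<close> by (intro divide_left_mono) auto
  ultimately show "z \<in> window L" using tail_mono[of N L] by (auto simp: window_def)
qed

lemma ex_window:
  assumes "0 < fst (fst z)" "snd z \<in> tail N"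
  shows "\<exists>L. z \<in> window L"
proof -
  obtain a :: nat where a: "1 / fst (fst z) < real a" using reals_Archimedean2 by blast
  obtain b :: nat where b: "fst (fst z) < real b" using reals_Archimedean2 by blast
  define L where "L = max N (max a b)"
  have "1 / fst (fst z) \<le> real L + 1" "fst (fst z) \<le> real L + 1" using a b by (auto simp: L_def)
  then have "1 / (real L + 1) \<le> fst (fst z)" using assms(1) by (simp add: field_simps)
  then show ?thesis
    using \<open>fst (fst z) \<le> real L + 1\<close> tail_mono[of N L] assms(2) by (intro exI[of _ L]) (auto simp: window_def L_def)
qed

lemma AE_window: "AE z in fibred. \<exists>N. z \<in> window N"
  using AE_fibred_pos AE_fibred_tail by eventually_elim (auto intro: ex_window)

lemma window_escape:
  assumes z: "z \<in> window N" and n: "N + 1 \<le> n"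
  shows "fibre_flow (escape_time n) z \<notin> window N"
proof -
  have pow: "real m + 1 \<le> 4 ^ m" for m :: nat
    by (induction m) auto
  have "4 * gap n \<le> fst (fst z) * escape_time n"
  proof -
    have "4 * (real N + 1) \<le> 4 * 4 ^ N" using pow[of N] by simp
    also have "\<dots> \<le> 4 ^ n" using n power_increasing[of "Suc N" n "4::real"] by simp
    finally have "4 \<le> 1 / (real N + 1) * 4 ^ n" by (simp add: field_simps)
    also have "\<dots> \<le> fst (fst z) * 4 ^ n" using z by (intro mult_right_mono) (auto simp: window_def)
    finally have "4 * gap n \<le> (fst (fst z) * 4 ^ n) * gap n" by (intro mult_right_mono) auto
    then show ?thesis by (simp add: escape_time_def mult.assoc)
  qed
  moreover have "fst (fst z) * escape_time n \<le> 2 * ell (Suc n)"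
  proof -
    have "fst (fst z) \<le> 4 ^ N" using z pow[of N] by (simp add: window_def)
    also have "\<dots> \<le> 4 ^ n" using n by (intro power_increasing) auto
    finally have "fst (fst z) * 4 ^ n \<le> 4 ^ n * 4 ^ n" by (intro mult_right_mono) auto
    also have "\<dots> \<le> 4 ^ (4 * n + 3)" by (simp only: power_add[symmetric], rule power_increasing) auto
    finally have "(fst (fst z) * 4 ^ n) * gap n \<le> 4 ^ (4 * n + 3) * gap n" by (intro mult_right_mono) auto
    then have "fst (fst z) * escape_time n \<le> ell (Suc n)"
      unfolding ell_Suc_eq by (simp add: escape_time_def mult.assoc)
    then show ?thesis using ell_pos[of "Suc n"] by linarith
  qed
  ultimately have "irp_flow (fst (fst z) * escape_time n) (snd z) \<notin> tail N"
    using z n by (intro no_return[of _ N n]) (auto simp: window_def)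
  then show ?thesis by (simp add: window_def fibre_flow_def)
qed

end

lemma AE_lborel_Ioo:
  assumes "AE e in lborel. P e" "a < (b::real)"
  obtains e where "a < e" "e < b" "P e"
proof (rule ccontr)
  assume "\<not> thesis"
  then have "\<And>e. P e \<Longrightarrow> e \<notin> {a<..<b}" using that by auto
  then have "AE e in lborel. e \<notin> {a<..<b}" using assms(1) by (auto elim: eventually_mono)
  then have "emeasure lborel {a<..<b} = 0" by (subst (asm) AE_iff_measurable[where N="{a<..<b}"]) auto
  then show False using assms(2) by simp
qed

section \<open>Which rescalings of time are isomorphic to the flow\<close>

context label_law
begin

text \<open>The isomorphism multiplies labels by h and stretches the idle coordinate over s by
  \<rho> s. This contributes the density 1 / \<rho> s = r s, which turns k into the law of s / h,
  and multiplication by h takes that law back to k.\<close>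

lemma self_similarity_of_equivalent:
  assumes h: "0 < h" and qi: "\<And>B. B \<in> sets borel \<Longrightarrow> emeasure k {s. h * s \<in> B} = 0 \<longleftrightarrow> emeasure k B = 0"
  shows "flow_isomorphic fibred (\<lambda>t. fibre_flow (h * t)) fibre_flow"
proof -
  define k' where "k' = distr k borel (\<lambda>s. s / h)"
  have sk': "sets k' = sets k" by (simp add: k'_def sets_k)
  have mdiv: "(\<lambda>s. s / h) \<in> k \<rightarrow>\<^sub>M borel"
    by (subst measurable_cong_sets[OF sets_k refl]) simp
  have k'_eq: "emeasure k' B = emeasure k {s. s / h \<in> B}" if "B \<in> sets borel" for B
    using that mdiv by (simp add: k'_def emeasure_distr vimage_def)
  have null: "emeasure k' B = 0 \<longleftrightarrow> emeasure k B = 0" if B: "B \<in> sets borel" for B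
  proof -
    have "{s. s / h \<in> B} \<in> sets borel"
      using measurable_sets[OF mdiv B] by (simp add: vimage_def sets_k)
    from qi[OF this] show ?thesis using h by (simp add: k'_eq[OF B])
  qed
  have ac: "absolutely_continuous k k'"
    unfolding absolutely_continuous_def using null by (auto simp: null_sets_def sk' sets_k)
  define r where "r = RN_deriv k k'"
  have r [measurable]: "r \<in> borel_measurable borel"
    using borel_measurable_RN_deriv[of k k'] measurable_cong_sets[OF sets_k refl] by (auto simp: r_def)
  have dens: "density k r = k'" unfolding r_def by (rule density_RN_deriv[OF ac sk'])
  have "prob_space k'" unfolding k'_def by (rule prob_space_distr[OF mdiv])
  then have "AE s in k. r s \<noteq> \<infinity>"
    unfolding r_def by (intro RN_deriv_finite ac sk' prob_space_imp_sigma_finite)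
  moreover have "AE s in k. r s \<noteq> 0"
  proof -
    have R0: "{s. r s = 0} \<in> sets borel" using measurable_sets[OF r, of "{0}"] by (simp add: vimage_def)
    have rk: "r \<in> borel_measurable k" using r measurable_cong_sets[OF sets_k refl] by blast
    have "emeasure k' {s. r s = 0} = (\<integral>\<^sup>+s. r s * indicator {s. r s = 0} s \<partial>k)"
      unfolding dens[symmetric] using R0 rk by (intro emeasure_density) (simp_all add: sets_k)
    also have "\<dots> = (\<integral>\<^sup>+s. 0 \<partial>k)" by (intro nn_integral_cong) (auto simp: indicator_def)
    finally have "emeasure k {s. r s = 0} = 0" using null[OF R0] by simp
    then show ?thesis using R0 by (intro AE_I[of _ _ "{s. r s = 0}"]) (auto simp: sets_k)
  qed
  ultimately have r_pos: "AE s in k. r s \<noteq> 0 \<and> r s \<noteq> \<infinity>" by eventually_elim simp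
  \<comment> \<open>The default 1, used on the null set where r is 0 or infinite, keeps \<rho>
    positive everywhere, so Q and Q' are inverse to each other at every point.\<close>
  define \<rho> where "\<rho> s = (if r s = 0 \<or> r s = \<infinity> then 1 else 1 / enn2real (r s))" for s
  have \<rho>_pos: "0 < \<rho> s" for s
    by (auto simp: \<rho>_def enn2real_positive_iff less_top zero_less_iff_neq_zero)
  have \<rho>_r: "AE s in k. ennreal (1 / \<rho> s) = r s"
    using r_pos by eventually_elim (auto simp: \<rho>_def ennreal_enn2real_if)
  have [measurable]: "\<rho> \<in> borel_measurable borel"
    unfolding \<rho>_def by measurable
  define Q :: "(real \<times> real) \<times> (nat \<Rightarrow> real) \<Rightarrow> (real \<times> real) \<times> (nat \<Rightarrow> real)"
    where "Q z = ((h * fst (fst z), \<rho> (fst (fst z)) * snd (fst z)), snd z)" for z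
  define Q' :: "(real \<times> real) \<times> (nat \<Rightarrow> real) \<Rightarrow> (real \<times> real) \<times> (nat \<Rightarrow> real)"
    where "Q' z = ((fst (fst z) / h, snd (fst z) / \<rho> (fst (fst z) / h)), snd z)" for z
  have Qm: "Q \<in> fibred \<rightarrow>\<^sub>M fibred" and Q'm: "Q' \<in> fibred \<rightarrow>\<^sub>M fibred"
    unfolding Q_def[abs_def] Q'_def[abs_def] fibred_def labels_def by measurable
  have Q'Q: "Q' (Q z) = z" and QQ': "Q (Q' z) = z" for z
    using h \<rho>_pos by (auto simp: Q_def Q'_def prod_eq_iff less_imp_neq[symmetric])
  have dQ: "distr fibred fibred Q = fibred"
  proof (rule measure_eqI)
    fix B assume "B \<in> sets (distr fibred fibred Q)"
    then have B: "B \<in> sets fibred" by simp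
    then have B' [measurable]: "B \<in> sets (labels \<Otimes>\<^sub>M irp)" by (simp only: fibred_def)
    have V: "Q -` B \<in> sets fibred" using measurable_sets[OF Qm B] by simp
    define \<phi> where "\<phi> y = emeasure irp (Pair y -` B)" for y
    have \<phi>: "\<phi> \<in> borel_measurable labels"
      unfolding \<phi>_def by (rule irp.measurable_emeasure_Pair[OF B'])
    then have \<phi>' [measurable]: "\<phi> \<in> borel_measurable (borel \<Otimes>\<^sub>M borel)"
      using measurable_cong_sets[OF sets_labels refl] by blast
    define F where "F s = (\<integral>\<^sup>+w. \<phi> (s, w) \<partial>lborel)" for s
    have F [measurable]: "F \<in> borel_measurable borel"
      unfolding F_def by measurable
    have eq: "emeasure fibred B = (\<integral>\<^sup>+s. F s \<partial>k)"
    proof -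
      have "emeasure fibred B = (\<integral>\<^sup>+y. \<phi> y \<partial>labels)" unfolding \<phi>_def by (rule emeasure_fibred[OF B])
      also have "\<dots> = (\<integral>\<^sup>+s. F s \<partial>k)"
        unfolding F_def labels_def using \<phi> by (intro lborel.nn_integral_fst[symmetric]) (simp add: labels_def)
      finally show ?thesis .
    qed
    have "Pair y -` (Q -` B) = Pair (h * fst y, \<rho> (fst y) * snd y) -` B" for y
      by (auto simp: Q_def)
    then have "emeasure fibred (Q -` B) = (\<integral>\<^sup>+y. \<phi> (h * fst y, \<rho> (fst y) * snd y) \<partial>labels)"
      unfolding \<phi>_def emeasure_fibred[OF V] by simp
    also have "\<dots> = (\<integral>\<^sup>+s. \<integral>\<^sup>+w. \<phi> (h * s, \<rho> s * w) \<partial>lborel \<partial>k)"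
      unfolding labels_def by (subst lborel.nn_integral_fst[symmetric]) (simp_all)
    also have "\<dots> = (\<integral>\<^sup>+s. ennreal (1 / \<rho> s) * F (h * s) \<partial>k)"
    proof (intro nn_integral_cong)
      fix s
      have "F (h * s) = ennreal \<bar>\<rho> s\<bar> * (\<integral>\<^sup>+w. \<phi> (h * s, 0 + \<rho> s * w) \<partial>lborel)"
        unfolding F_def using \<rho>_pos[of s] by (intro nn_integral_real_affine) auto
      then have "ennreal (1 / \<rho> s) * F (h * s) = (ennreal (1 / \<rho> s) * ennreal (\<rho> s)) * (\<integral>\<^sup>+w. \<phi> (h * s, \<rho> s * w) \<partial>lborel)"
        using \<rho>_pos[of s] by (simp add: mult.assoc)
      also have "ennreal (1 / \<rho> s) * ennreal (\<rho> s) = 1"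
        using \<rho>_pos[of s] by (simp add: ennreal_mult[symmetric])
      finally show "(\<integral>\<^sup>+w. \<phi> (h * s, \<rho> s * w) \<partial>lborel) = ennreal (1 / \<rho> s) * F (h * s)" by simp
    qed
    also have "\<dots> = (\<integral>\<^sup>+s. r s * F (h * s) \<partial>k)"
      by (rule nn_integral_cong_AE) (use \<rho>_r in \<open>eventually_elim, simp\<close>)
    also have "\<dots> = (\<integral>\<^sup>+s. F (h * s) \<partial>k')"
      unfolding dens[symmetric] by (subst nn_integral_density) (simp_all add: measurable_cong_sets[OF sets_k refl])
    also have "\<dots> = (\<integral>\<^sup>+s. F (h * (s / h)) \<partial>k)"
      unfolding k'_def using mdiv by (subst nn_integral_distr) simp_all
    also have "\<dots> = (\<integral>\<^sup>+s. F s \<partial>k)" using h by simp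
    finally show "emeasure (distr fibred fibred Q) B = emeasure fibred B"
      using B Qm by (simp add: emeasure_distr eq)
  qed simp
  have dQ': "distr fibred fibred Q' = fibred"
  proof -
    have "distr fibred fibred Q' = distr (distr fibred fibred Q) fibred Q'" by (simp add: dQ)
    also have "\<dots> = distr fibred fibred (Q' \<circ> Q)" by (rule distr_distr[OF Q'm Qm])
    also have "\<dots> = distr fibred fibred id" by (rule distr_cong) (auto simp: Q'Q)
    finally show ?thesis by (simp add: id_def)
  qed
  show ?thesis
    unfolding flow_isomorphic_def invertible_mod_null_def
  proof (rule exI[of _ Q], rule exI[of _ Q'], intro conjI allI)
    have "Q' (fibre_flow t (Q z)) = fibre_flow (h * t) z" for t z
      using h \<rho>_pos[of "fst (fst z)"] by (simp add: Q_def Q'_def fibre_flow_def ac_simps prod_eq_iff)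
    then show "AE z in fibred. Q' (fibre_flow t (Q z)) = fibre_flow (h * t) z" for t by simp
  qed (use Qm Q'm dQ dQ' Q'Q QQ' in auto)
qed

text \<open>Q sends a point with label s to one with label \<sigma> and fibre part \<xi>. It carries
  triple returns at times u, 3u with u near gap n to triple returns of \<xi> at times \<rho> u, 3
  \<rho> u, where \<rho> = \<sigma> / (h s). By \<open>triple_return\<close> the time \<rho> u is
  near some gap m, and \<open>gap_ratio\<close> forces \<rho> close to 1. So \<sigma> = h s almost
  everywhere, and from this the sign of h and the null sets of k are read off.\<close>

lemma equivalent_of_self_similarity:
  assumes h: "h \<noteq> 0" and iso: "flow_isomorphic fibred (\<lambda>t. fibre_flow (h * t)) fibre_flow"
  shows "0 < h \<and> (\<forall>B\<in>sets borel. emeasure k {s. h * s \<in> B} = 0 \<longleftrightarrow> emeasure k B = 0)"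
proof -
  obtain Q Q' where Q [measurable]: "Q \<in> fibred \<rightarrow>\<^sub>M fibred" and Q': "Q' \<in> fibred \<rightarrow>\<^sub>M fibred"
    and inv: "AE z in fibred. Q (Q' z) = z"
    and dQ: "distr fibred fibred Q = fibred"
    and ST: "\<And>t. AE z in fibred. Q' (fibre_flow t (Q z)) = fibre_flow (h * t) z"
    using iso by (auto simp: flow_isomorphic_def invertible_mod_null_def)
  define \<sigma> where "\<sigma> z = fst (fst (Q z))" for z
  define \<xi> where "\<xi> z = snd (Q z)" for z
  have "(\<lambda>z. fst (fst z)) \<in> fibred \<rightarrow>\<^sub>M borel" "snd \<in> fibred \<rightarrow>\<^sub>M borel"
    unfolding fibred_def labels_def by measurable
  from measurable_compose[OF Q this(1)] measurable_compose[OF Q this(2)]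
  have \<sigma> [measurable]: "\<sigma> \<in> fibred \<rightarrow>\<^sub>M borel" and \<xi> [measurable]: "\<xi> \<in> fibred \<rightarrow>\<^sub>M borel"
    by (simp_all add: \<sigma>_def[abs_def] \<xi>_def[abs_def])
  have AEQ: "AE z in fibred. P (Q z)" if "AE z in fibred. P z" for P
  proof -
    have "AE z in distr fibred fibred Q. P z" using that by (simp only: dQ)
    then show ?thesis by (rule AE_distrD[OF Q])
  qed
  have AEF: "AE z in fibred. P (fibre_flow t z)" if "AE z in fibred. P z" for P t
  proof -
    have "AE z in distr fibred fibred (fibre_flow t). P z" using that by (simp only: distr_fibre_flow)
    then show ?thesis by (rule AE_distrD[OF measurable_fibre_flow])
  qed
  have com: "AE z in fibred. fibre_flow t (Q z) = Q (fibre_flow (h * t) z)" for t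
  proof -
    have "AE z in fibred. Q (Q' (fibre_flow t (Q z))) = fibre_flow t (Q z)"
      by (rule AEQ[OF AEF[OF inv]])
    then show ?thesis using ST[of t] by eventually_elim simp
  qed
  \<comment> \<open>The fibre part of the commutation relation, at the two times t and 3 t that a
    triple return involves.\<close>
  define R where "R t z \<longleftrightarrow> irp_flow (\<sigma> z * t) (\<xi> z) = \<xi> (fibre_flow (h * t) z)
    \<and> irp_flow (\<sigma> z * (3 * t)) (\<xi> z) = \<xi> (fibre_flow (h * (3 * t)) z)" for t z
  have R_AE: "AE z in fibred. R t z" for t
    using com[of t] com[of "3 * t"]
  proof eventually_elim
    case (elim z)
    from arg_cong[OF elim(1), of snd] arg_cong[OF elim(2), of snd] show ?case
      by (simp add: R_def \<sigma>_def \<xi>_def fibre_flow_def)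
  qed
  have m1: "(\<lambda>p. irp_flow (\<sigma> (snd p) * (c * fst p)) (\<xi> (snd p))) \<in> borel \<Otimes>\<^sub>M fibred \<rightarrow>\<^sub>M borel" for c
    by measurable
  have m2: "(\<lambda>p. \<xi> (fibre_flow (h * (c * fst p)) (snd p))) \<in> borel \<Otimes>\<^sub>M fibred \<rightarrow>\<^sub>M borel" for c
  proof (rule measurable_compose[OF _ \<xi>])
    have "(\<lambda>p. (h * (c * fst p), snd p)) \<in> borel \<Otimes>\<^sub>M fibred \<rightarrow>\<^sub>M borel \<Otimes>\<^sub>M fibred" by measurable
    from measurable_compose[OF this measurable_fibre_flow_pair]
    show "(\<lambda>p. fibre_flow (h * (c * fst p)) (snd p)) \<in> borel \<Otimes>\<^sub>M fibred \<rightarrow>\<^sub>M fibred" by simp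
  qed
  have R_pred: "Measurable.pred (borel \<Otimes>\<^sub>M fibred) (\<lambda>p. R (fst p) (snd p))"
  proof -
    have "Measurable.pred (borel \<Otimes>\<^sub>M fibred)
        (\<lambda>p. irp_flow (\<sigma> (snd p) * (c * fst p)) (\<xi> (snd p)) = \<xi> (fibre_flow (h * (c * fst p)) (snd p)))" for c
    proof -
      have "Measurable.pred (borel \<Otimes>\<^sub>M fibred)
          (\<lambda>p. irp_flow (\<sigma> (snd p) * (c * fst p)) (\<xi> (snd p)) j = \<xi> (fibre_flow (h * (c * fst p)) (snd p)) j)" for j
        using measurable_compose[OF m1[of c] measurable_coordinate[of j]] measurable_compose[OF m2[of c] measurable_coordinate[of j]]
        unfolding pred_def by (rule borel_measurable_eq)
      then show ?thesis unfolding fun_eq_iff by simp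
    qed
    from pred_intros_logic(3)[OF this[of 1] this[of 3]] show ?thesis unfolding R_def by simp
  qed
  have R_pred': "Measurable.pred N (\<lambda>p. R (f p) (g p))" if "f \<in> N \<rightarrow>\<^sub>M borel" "g \<in> N \<rightarrow>\<^sub>M fibred" for N f g
    using measurable_compose[OF measurable_Pair[OF that] R_pred] by simp
  interpret lf: pair_sigma_finite lborel fibred
    unfolding pair_sigma_finite_def using sigma_finite_fibred lborel.sigma_finite_measure_axioms by simp
  interpret il: pair_sigma_finite irp lborel ..
  \<comment> \<open>At this time the rescaled flow moves a point with label s by exactly gap n + e,
    because s * (h * \<theta> n e s) = gap n + e.\<close>
  define \<theta> where "\<theta> n e s = (gap n + e) / (h * s)" for n e s
  \<comment> \<open>The relation is known for each t at almost every z, but the times \<theta>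
    depend on the label. Fubini gives it for almost all t at almost every z; with z fixed, an affine
    change of variable passes from t to e.\<close>
  have "AE z in fibred. AE t in lborel. R t z"
  proof (subst lf.AE_commute[symmetric])
    have "Measurable.pred (lborel \<Otimes>\<^sub>M fibred) (\<lambda>p. R (fst p) (snd p))"
      by (rule R_pred') simp_all
    then show "{p \<in> space (lborel \<Otimes>\<^sub>M fibred). R (fst p) (snd p)} \<in> sets (lborel \<Otimes>\<^sub>M fibred)"
      by (simp add: pred_def)
  qed (simp add: R_AE)
  then have "AE z in fibred. AE e in lborel. \<forall>n. R (\<theta> n e (fst (fst z))) z"
    using AE_fibred_pos
  proof eventually_elim
    case (elim z)
    have "AE e in lborel. R (\<theta> n e (fst (fst z))) z" for n
    proof -
      let ?c = "1 / (h * fst (fst z))"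
      have "Measurable.pred borel (\<lambda>t. R t z)" by (rule R_pred') simp_all
      then have "AE e in lborel. R (gap n * ?c + ?c * e) z"
        using elim h by (intro AE_borel_affine) auto
      moreover have "gap n * ?c + ?c * e = \<theta> n e (fst (fst z))" for e
        by (simp add: \<theta>_def add_divide_distrib)
      ultimately show ?thesis by simp
    qed
    then show ?case by (simp add: AE_all_countable)
  qed
  then have R_lab: "AE y in labels. AE x in irp. AE e in lborel. \<forall>n. R (\<theta> n e (fst y)) (y, x)"
    using fibred.AE_pair[of "\<lambda>z. AE e in lborel. \<forall>n. R (\<theta> n e (fst (fst z))) z", folded fibred_def] by simp
  have pos_lab: "AE y in labels. AE x in irp. 0 < fst y"
    using fibred.AE_pair[of "\<lambda>z. 0 < fst (fst z)", folded fibred_def] AE_fibred_pos by simp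
  have win_lab: "AE y in labels. AE x in irp. \<exists>N. Q (y, x) \<in> window N"
    using fibred.AE_pair[of "\<lambda>z. \<exists>N. Q z \<in> window N", folded fibred_def] AEQ[OF AE_window] by simp
  have main: "AE z in labels \<Otimes>\<^sub>M irp. \<sigma> z = h * fst (fst z)"
  proof (rule fibred.AE_pair_measure)
    have "Measurable.pred fibred (\<lambda>z. \<sigma> z = h * fst (fst z))"
      using \<sigma> unfolding fibred_def labels_def by measurable
    then show "{z \<in> space (labels \<Otimes>\<^sub>M irp). \<sigma> z = h * fst (fst z)} \<in> sets (labels \<Otimes>\<^sub>M irp)"
      by (simp add: pred_def fibred_def)
    show "AE y in labels. AE x in irp. \<sigma> (y, x) = h * fst (fst (y, x))"
      using R_lab pos_lab win_lab
    proof eventually_elim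
      case (elim y)
      define s where "s = fst y"
      have s: "0 < s"
      proof (rule ccontr)
        assume "\<not> 0 < s"
        then have "AE x in irp. False" using elim(2) by (simp add: s_def)
        then show False using emeasure_irp_UNIV by (subst (asm) AE_iff_measurable[where N=UNIV]) auto
      qed
      \<comment> \<open>A second exchange, on a fixed label fibre: almost every e is good for almost
        all x simultaneously, as \<open>partial_rigidity\<close> works with one perturbation for the
        whole set.\<close>
      have Rxe: "AE e in lborel. AE x in irp. \<forall>n. R (\<theta> n e s) (y, x)"
      proof (subst il.AE_commute[symmetric])
        have "Measurable.pred (irp \<Otimes>\<^sub>M lborel) (\<lambda>p. R (\<theta> n (snd p) s) (y, fst p))" for n
        proof (rule R_pred')
          show "(\<lambda>p. \<theta> n (snd p) s) \<in> irp \<Otimes>\<^sub>M lborel \<rightarrow>\<^sub>M borel" unfolding \<theta>_def by measurable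
          show "(\<lambda>p. (y, fst p)) \<in> irp \<Otimes>\<^sub>M lborel \<rightarrow>\<^sub>M fibred" unfolding fibred_def by simp
        qed
        then have "Measurable.pred (irp \<Otimes>\<^sub>M lborel) (\<lambda>p. \<forall>n. R (\<theta> n (snd p) s) (y, fst p))" by simp
        then show "{p \<in> space (irp \<Otimes>\<^sub>M lborel). \<forall>n. R (\<theta> n (snd p) s) (y, fst p)} \<in> sets (irp \<Otimes>\<^sub>M lborel)"
          by (simp add: pred_def)
        show "AE x in irp. AE e in lborel. \<forall>n. R (\<theta> n e s) (y, x)" using elim(1) by (simp add: s_def)
      qed
      have "AE x in irp. \<sigma> (y, x) = h * s"
      proof (rule ccontr)
        assume contra: "\<not> (AE x in irp. \<sigma> (y, x) = h * s)"
        \<comment> \<open>If \<sigma> = h s failed on this fibre, some A N would have positive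
          measure. There Q lands in a window, which bounds \<sigma> and puts \<xi> in
          \<open>tail N\<close>, and \<sigma> is wrong by a definite amount.\<close>
        define A where "A N = {x. Q (y, x) \<in> window N \<and> 1 / (real N + 1) \<le> \<bar>\<sigma> (y, x) - h * s\<bar>}" for N :: nat
        have Py: "(\<lambda>x. (y, x)) \<in> borel \<rightarrow>\<^sub>M fibred" unfolding fibred_def by simp
        have A: "A N \<in> sets borel" for N
        proof -
          have "(\<lambda>x. Q (y, x)) -` window N \<in> sets borel"
            using measurable_sets[OF measurable_compose[OF Py Q] window_sets, of N] by simp
          moreover have "{x. 1 / (real N + 1) \<le> \<bar>\<sigma> (y, x) - h * s\<bar>} \<in> sets borel"
          proof -
            have "(\<lambda>x. \<sigma> (y, x)) \<in> borel \<rightarrow>\<^sub>M borel" by (rule measurable_compose[OF Py \<sigma>])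
            then show ?thesis by simp
          qed
          ultimately have "(\<lambda>x. Q (y, x)) -` window N \<inter> {x. 1 / (real N + 1) \<le> \<bar>\<sigma> (y, x) - h * s\<bar>} \<in> sets borel"
            by (rule sets.Int)
          then show ?thesis by (simp add: A_def vimage_def Collect_conj_eq)
        qed
        obtain N where N: "0 < emeasure irp (A N)"
        proof (rule ccontr)
          assume "\<not> thesis"
          then have "emeasure irp (A N) = 0" for N using that by (auto simp: zero_less_iff_neq_zero)
          then have "AE x in irp. x \<notin> A N" for N using A by (intro AE_I[of _ _ "A N"]) auto
          then have "AE x in irp. \<forall>N. x \<notin> A N" by (simp add: AE_all_countable)
          then have "AE x in irp. \<sigma> (y, x) = h * s"
            using elim(3)
          proof eventually_elim
            case (elim x)
            then obtain L where L: "Q (y, x) \<in> window L" by blast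
            show ?case
            proof (rule ccontr)
              assume "\<sigma> (y, x) \<noteq> h * s"
              then obtain j :: nat where j: "inverse (real (Suc j)) < \<bar>\<sigma> (y, x) - h * s\<bar>"
                using reals_Archimedean[of "\<bar>\<sigma> (y, x) - h * s\<bar>"] by auto
              let ?N = "max L j"
              have "1 / (real ?N + 1) \<le> inverse (real (Suc j))"
                by (simp add: inverse_eq_divide) (intro divide_left_mono, auto)
              then have "x \<in> A ?N" using j L window_mono[of L ?N] by (auto simp: A_def)
              then show False using elim by blast
            qed
          qed
          then show False using contra by simp
        qed
        \<comment> \<open>Perturbations that tend to 0 and stay below 1/3, as
          \<open>partial_rigidity\<close> requires, chosen outside the null set of bad values of
          e.\<close>
        define e where "e n = (SOME e. 0 < e \<and> e < 1 / (3 * (real n + 1)) \<and> (AE x in irp. \<forall>m. R (\<theta> m e s) (y, x)))" for n :: nat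
        have e: "0 < e n" "e n < 1 / (3 * (real n + 1))" "AE x in irp. \<forall>m. R (\<theta> m (e n) s) (y, x)" for n
        proof -
          have "\<exists>e. 0 < e \<and> e < 1 / (3 * (real n + 1)) \<and> (AE x in irp. \<forall>m. R (\<theta> m e s) (y, x))"
            using AE_lborel_Ioo[OF Rxe, of 0 "1 / (3 * (real n + 1))"] by auto
          from someI_ex[OF this] show "0 < e n" "e n < 1 / (3 * (real n + 1))" "AE x in irp. \<forall>m. R (\<theta> m (e n) s) (y, x)"
            unfolding e_def by auto
        qed
        have e_le: "e n \<le> 1 / 3" for n
        proof -
          have "1 / (3 * (real n + 1)) \<le> 1 / 3" by (intro divide_left_mono) auto
          with e(2)[of n] show ?thesis by linarith
        qed
        have e_lim: "e \<longlonglongrightarrow> 0"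
        proof (rule tendsto_sandwich[of "\<lambda>_. 0"])
          show "eventually (\<lambda>n. e n \<le> inverse (real (Suc n))) sequentially"
          proof (intro always_eventually allI)
            fix n
            have "1 / (3 * (real n + 1)) \<le> 1 / (1 * (real n + 1))" by (intro divide_left_mono mult_right_mono) auto
            then show "e n \<le> inverse (real (Suc n))" using e(2)[of n] by (simp add: inverse_eq_divide add.commute)
          qed
        qed (use e(1) LIMSEQ_inverse_real_of_nat in \<open>auto intro!: always_eventually less_imp_le\<close>)
        \<comment> \<open>At points of A N, \<delta> is a lower bound both for |\<rho>| and for
          |\<rho> - 1|, and b is an upper bound for |\<rho>|. The index n is then taken so large
          that \<open>triple_return\<close> and \<open>gap_ratio\<close> apply; the latter yields
          |\<rho> - 1| < \<delta>, a contradiction.\<close>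
        define \<delta> where "\<delta> = 1 / ((real N + 1) * (\<bar>h\<bar> * s))"
        define b where "b = (real N + 1) / (\<bar>h\<bar> * s)"
        have \<delta>: "0 < \<delta>" using h s by (simp add: \<delta>_def)
        have hs: "0 < \<bar>h\<bar> * s" using h s by simp
        obtain n0 where n0: "max (max b (1 / \<delta>)) (max ((1 + b) / \<delta>) (ell N / \<delta>)) < 4 ^ n0"
          using real_arch_pow[of 4 "max (max b (1 / \<delta>)) (max ((1 + b) / \<delta>) (ell N / \<delta>))"] by auto
        have "eventually (\<lambda>n. 0 < emeasure irp (A N \<inter> irp_flow (gap n + e n) -` A N \<inter> irp_flow (3 * (gap n + e n)) -` A N)) sequentially"
          using e(1) by (intro partial_rigidity A N e_le e_lim less_imp_le)
        then obtain n1 where n1: "\<And>n. n1 \<le> n \<Longrightarrow>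
            0 < emeasure irp (A N \<inter> irp_flow (gap n + e n) -` A N \<inter> irp_flow (3 * (gap n + e n)) -` A N)"
          by (auto simp: eventually_sequentially)
        define n where "n = max n0 n1"
        have big: "max (max b (1 / \<delta>)) (max ((1 + b) / \<delta>) (ell N / \<delta>)) < 4 ^ n"
          using n0 power_increasing[of n0 n "4::real"] unfolding n_def by (meson less_le_trans max.cobounded1 one_le_numeral)
        have nb: "b < 4 ^ n" "1 < \<delta> * 4 ^ n" "1 + b < \<delta> * 4 ^ n" "ell N < \<delta> * 4 ^ n"
          using big \<delta> by (simp_all add: pos_divide_less_eq mult.commute)
        define u where "u = gap n + e n"
        let ?U = "A N \<inter> irp_flow u -` A N \<inter> irp_flow (3 * u) -` A N"
        have Upos: "0 < emeasure irp ?U" unfolding u_def by (rule n1) (simp add: n_def)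
        have Us: "?U \<in> sets borel" using A by (intro sets.Int vimage_irp_flow_sets)
        obtain x where x: "x \<in> ?U" and Rx: "R (\<theta> n (e n) s) (y, x)"
        proof (rule ccontr)
          assume "\<not> thesis"
          then have "\<And>x. R (\<theta> n (e n) s) (y, x) \<Longrightarrow> x \<notin> ?U" using that by blast
          then have "AE x in irp. x \<notin> ?U" using e(3)[of n] by (auto elim: eventually_mono)
          then have "emeasure irp ?U = 0" using Us by (subst (asm) AE_iff_measurable[where N="?U"]) auto
          then show False using Upos by simp
        qed
        define t where "t = \<theta> n (e n) s"
        have st: "s * (h * t) = u" using h s by (simp add: t_def \<theta>_def u_def)
        have st3: "s * (h * (3 * t)) = 3 * u" using st by (simp add: ac_simps)
        have w0: "Q (y, x) \<in> window N" "1 / (real N + 1) \<le> \<bar>\<sigma> (y, x) - h * s\<bar>"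
          and w1: "Q (y, irp_flow u x) \<in> window N" and w3: "Q (y, irp_flow (3 * u) x) \<in> window N"
          using x by (auto simp: A_def)
        define \<rho> where "\<rho> = \<sigma> (y, x) / (h * s)"
        have \<rho>u: "\<sigma> (y, x) * t = \<rho> * u" by (simp add: \<rho>_def t_def \<theta>_def u_def)
        have "irp_flow (\<sigma> (y, x) * t) (\<xi> (y, x)) = \<xi> (y, irp_flow u x)"
          "irp_flow (\<sigma> (y, x) * (3 * t)) (\<xi> (y, x)) = \<xi> (y, irp_flow (3 * u) x)"
          using Rx unfolding R_def t_def[symmetric] fibre_flow_def fst_conv snd_conv s_def[symmetric] st st3 by blast+
        moreover have "\<sigma> (y, x) * (3 * t) = 3 * (\<rho> * u)" using \<rho>u by simp
        ultimately have r1: "irp_flow (\<rho> * u) (\<xi> (y, x)) = \<xi> (y, irp_flow u x)"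
          and r3: "irp_flow (3 * (\<rho> * u)) (\<xi> (y, x)) = \<xi> (y, irp_flow (3 * u) x)"
          using \<rho>u by simp_all
        have \<sigma>b: "1 / (real N + 1) \<le> \<sigma> (y, x)" "\<sigma> (y, x) \<le> real N + 1"
          using w0 by (auto simp: window_def \<sigma>_def)
        have \<sigma>0: "0 < \<sigma> (y, x)" using \<sigma>b(1) by (rule less_le_trans[rotated]) simp
        have abs_\<rho>: "\<bar>\<rho>\<bar> = \<sigma> (y, x) / (\<bar>h\<bar> * s)" using \<sigma>0 s by (simp add: \<rho>_def abs_mult)
        have \<rho>_ge: "\<delta> \<le> \<bar>\<rho>\<bar>"
          using divide_right_mono[OF \<sigma>b(1) less_imp_le[OF hs]] by (simp add: abs_\<rho> \<delta>_def)
        have \<rho>_le: "\<bar>\<rho>\<bar> \<le> b" unfolding abs_\<rho> b_def using \<sigma>b(2) hs by (intro divide_right_mono) auto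
        have \<rho>4: "1 \<le> \<bar>\<rho>\<bar> * 4 ^ n"
        proof -
          have "\<delta> * 4 ^ n \<le> \<bar>\<rho>\<bar> * 4 ^ n" using \<rho>_ge by (rule mult_right_mono) simp
          with nb(2) show ?thesis by linarith
        qed
        have u_ge: "4 ^ n \<le> u"
        proof -
          have "4 ^ n \<le> gap n" unfolding gap_def by (intro power_increasing) (auto simp: power2_eq_square)
          then show ?thesis using e(1)[of n] by (simp add: u_def)
        qed
        have "ell N \<le> \<bar>\<rho> * u\<bar>"
        proof -
          have "\<delta> * 4 ^ n \<le> \<bar>\<rho>\<bar> * u" using \<rho>_ge u_ge \<delta> by (intro mult_mono) auto
          moreover have "0 \<le> u" using u_ge by (rule order_trans[rotated]) simp
          ultimately show ?thesis using nb(4) by (simp add: abs_mult)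
        qed
        then obtain m where m: "\<bar>\<rho> * u - gap m\<bar> < ell m"
          using triple_return[of "\<xi> (y, x)" N "\<rho> * u"] w0 w1 w3 r1 r3 by (auto simp: window_def \<xi>_def)
        have "\<bar>\<rho> - 1\<bar> < \<delta>"
          using e(1)[of n] e_le[of n] by (intro gap_ratio[OF \<rho>_le \<rho>4 nb(1,3) _ _ m]) (auto simp: u_def)
        moreover have "\<delta> \<le> \<bar>\<rho> - 1\<bar>"
        proof -
          have "\<rho> - 1 = (\<sigma> (y, x) - h * s) / (h * s)" using h s by (simp add: \<rho>_def field_simps)
          then have "\<bar>\<rho> - 1\<bar> = \<bar>\<sigma> (y, x) - h * s\<bar> / (\<bar>h\<bar> * s)" using s by (simp add: abs_mult)
          then show ?thesis
            using divide_right_mono[OF w0(2) less_imp_le[OF hs]] by (simp add: \<delta>_def)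
        qed
        ultimately show False by simp
      qed
      then show ?case by (simp add: s_def)
    qed
  qed
  then have main: "AE z in fibred. \<sigma> z = h * fst (fst z)" by (simp only: fibred_def)
  \<comment> \<open>A label and its image are both positive almost everywhere, which \<sigma> = h s
    permits only for positive h.\<close>
  have "0 < h"
  proof (rule ccontr)
    assume "\<not> 0 < h"
    have "AE z in fibred. False"
      using main AE_fibred_pos AEQ[OF AE_fibred_pos]
    proof eventually_elim
      case (elim z)
      then show False using \<open>\<not> 0 < h\<close> by (auto simp: \<sigma>_def zero_less_mult_iff)
    qed
    then show False
      using emeasure_fibred_UNIV sets.top[of fibred] by (subst (asm) AE_iff_measurable[where N=UNIV]) auto
  qed
  \<comment> \<open>Q preserves the measure and acts on labels as multiplication by h. Because of
    the idle coordinate, a set of labels has measure 0 or infinity in \<open>fibred\<close>, so what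
    is transported is precisely the class of null sets of k.\<close>
  moreover have "emeasure k {s. h * s \<in> B} = 0 \<longleftrightarrow> emeasure k B = 0" if B: "B \<in> sets borel" for B
  proof -
    have mh: "{s. h * s \<in> B} \<in> sets borel"
      using measurable_sets[of "\<lambda>s. h * s" borel borel B] B by (simp add: vimage_def)
    have lab: "{z. fst (fst z) \<in> B} \<in> sets fibred" if "B \<in> sets borel" for B
    proof -
      have "(\<lambda>z. fst (fst z)) \<in> fibred \<rightarrow>\<^sub>M borel" unfolding fibred_def labels_def by measurable
      from measurable_sets[OF this that] show ?thesis by (simp add: vimage_def)
    qed
    have "emeasure fibred {z. fst (fst z) \<in> B} = emeasure (distr fibred fibred Q) {z. fst (fst z) \<in> B}" by (simp only: dQ)
    also have "\<dots> = emeasure fibred {z. \<sigma> z \<in> B}"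
      using Q lab[OF B] by (simp add: emeasure_distr \<sigma>_def vimage_def)
    also have "\<dots> = emeasure fibred {z. fst (fst z) \<in> {s. h * s \<in> B}}"
    proof (rule emeasure_eq_AE)
      show "AE z in fibred. (z \<in> {z. \<sigma> z \<in> B}) = (z \<in> {z. fst (fst z) \<in> {s. h * s \<in> B}})"
        using main by eventually_elim simp
      show "{z. \<sigma> z \<in> B} \<in> sets fibred" using measurable_sets[OF \<sigma> B] by (simp add: vimage_def)
    qed (rule lab[OF mh])
    finally show ?thesis using emeasure_fibred_label[OF B] emeasure_fibred_label[OF mh] by simp
  qed
  ultimately show ?thesis by blast
qed

end

text \<open>The bridge between the given measure on the positive half-line and its image on the
  whole line, on which \<open>label_law\<close> is based. Mutual absolute continuity is rewritten as
  equality of null sets, tested on Borel sets.\<close>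

lemma quasi_invariance_group_iff:
  assumes \<kappa>: "sets \<kappa> = sets (restrict_space borel {0::real<..})"
  shows "h \<in> quasi_invariance_group \<kappa> \<longleftrightarrow> 0 < h \<and>
    (\<forall>B\<in>sets borel. emeasure (distr \<kappa> borel (\<lambda>s. s)) {s. h * s \<in> B} = 0 \<longleftrightarrow> emeasure (distr \<kappa> borel (\<lambda>s. s)) B = 0)"
proof (cases "0 < h")
  case h: True
  have sp: "space \<kappa> = {0<..}"
    using sets_eq_imp_space_eq[OF \<kappa>] by (simp add: space_restrict_space)
  have sets: "B \<inter> {0<..} \<in> sets \<kappa>" if "B \<in> sets borel" for B
    unfolding \<kappa> sets_restrict_space using that by blast
  have sub: "B \<in> sets borel" if "B \<in> sets \<kappa>" for B
    using that unfolding \<kappa> by (auto simp: sets_restrict_space)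
  have m: "(\<lambda>s. s) \<in> \<kappa> \<rightarrow>\<^sub>M borel"
    using sets by (intro measurableI) (auto simp: sp vimage_def)
  have mh: "(\<lambda>s. h * s) \<in> \<kappa> \<rightarrow>\<^sub>M \<kappa>"
  proof (rule measurableI)
    fix B assume "B \<in> sets \<kappa>"
    from measurable_sets[OF _ sub[OF this], of "\<lambda>s. h * s" borel]
    have "{s. h * s \<in> B} \<in> sets borel" by (simp add: vimage_def)
    then show "(\<lambda>s. h * s) -` B \<inter> space \<kappa> \<in> sets \<kappa>"
      using sets[of "{s. h * s \<in> B}"] by (simp add: sp vimage_def)
  qed (use h in \<open>simp add: sp\<close>)
  have k: "emeasure (distr \<kappa> borel (\<lambda>s. s)) B = emeasure \<kappa> (B \<inter> {0<..})" if "B \<in> sets borel" for B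
    using emeasure_distr[OF m that] by (simp add: sp vimage_def)
  have kh: "emeasure (distr \<kappa> \<kappa> (\<lambda>s. h * s)) B = emeasure \<kappa> ({s. h * s \<in> B} \<inter> {0<..})" if "B \<in> sets \<kappa>" for B
    using emeasure_distr[OF mh that] by (simp add: sp vimage_def)
  have B0: "{s. h * s \<in> B} \<inter> {0<..} = {s. h * s \<in> B \<inter> {0<..}} \<inter> {0<..}" for B
    using h by auto
  have bh: "{s. h * s \<in> B} \<in> sets borel" if "B \<in> sets borel" for B
    using measurable_sets[OF _ that, of "\<lambda>s. h * s" borel] by (simp add: vimage_def)
  have "h \<in> quasi_invariance_group \<kappa> \<longleftrightarrow>
      (\<forall>B\<in>sets \<kappa>. emeasure (distr \<kappa> \<kappa> (\<lambda>s. h * s)) B = 0 \<longleftrightarrow> emeasure \<kappa> B = 0)"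
    using h by (auto simp: quasi_invariance_group_def absolutely_continuous_def null_sets_def)
  also have "\<dots> \<longleftrightarrow> (\<forall>B\<in>sets borel. emeasure (distr \<kappa> borel (\<lambda>s. s)) {s. h * s \<in> B} = 0 \<longleftrightarrow>
      emeasure (distr \<kappa> borel (\<lambda>s. s)) B = 0)"
  proof (rule iffI; rule ballI)
    fix B :: "real set"
    assume *: "\<forall>B\<in>sets \<kappa>. emeasure (distr \<kappa> \<kappa> (\<lambda>s. h * s)) B = 0 \<longleftrightarrow> emeasure \<kappa> B = 0" and B: "B \<in> sets borel"
    from *[rule_format, OF sets[OF B]]
    show "emeasure (distr \<kappa> borel (\<lambda>s. s)) {s. h * s \<in> B} = 0 \<longleftrightarrow> emeasure (distr \<kappa> borel (\<lambda>s. s)) B = 0"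
      unfolding kh[OF sets[OF B]] k[OF B] k[OF bh[OF B]] B0[of B] .
  next
    fix B
    assume *: "\<forall>B\<in>sets borel. emeasure (distr \<kappa> borel (\<lambda>s. s)) {s. h * s \<in> B} = 0 \<longleftrightarrow>
      emeasure (distr \<kappa> borel (\<lambda>s. s)) B = 0" and B: "B \<in> sets \<kappa>"
    have "B \<inter> {0<..} = B" using sets.sets_into_space[OF B] sp by auto
    with *[rule_format, OF sub[OF B]]
    show "emeasure (distr \<kappa> \<kappa> (\<lambda>s. h * s)) B = 0 \<longleftrightarrow> emeasure \<kappa> B = 0"
      unfolding kh[OF B] k[OF sub[OF B]] k[OF bh[OF sub[OF B]]] by simp
  qed
  finally show ?thesis using h by simp
qed (simp add: quasi_invariance_group_def)

text \<open>Label and idle coordinate are put in front of the sequence, so that the whole space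
  becomes the Polish space of real sequences.\<close>

definition encode :: "(real \<times> real) \<times> (nat \<Rightarrow> real) \<Rightarrow> nat \<Rightarrow> real" where
  "encode z = case_nat (fst (fst z)) (case_nat (snd (fst z)) (snd z))"

definition decode :: "(nat \<Rightarrow> real) \<Rightarrow> (real \<times> real) \<times> (nat \<Rightarrow> real)" where
  "decode z = ((z 0, z 1), \<lambda>n. z (Suc (Suc n)))"

lemma decode_encode [simp]: "decode (encode z) = z"
  by (simp add: encode_def decode_def)

lemma encode_decode [simp]: "encode (decode z) = z"
  by (auto simp: encode_def decode_def fun_eq_iff split: nat.split)

lemma measurable_encode: "encode \<in> (borel \<Otimes>\<^sub>M borel) \<Otimes>\<^sub>M borel \<rightarrow>\<^sub>M borel"
proof (rule measurable_sequenceI)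
  fix n
  have "(\<lambda>z::(real \<times> real) \<times> (nat \<Rightarrow> real). snd z j) \<in> (borel \<Otimes>\<^sub>M borel) \<Otimes>\<^sub>M borel \<rightarrow>\<^sub>M borel" for j :: nat
    using measurable_compose[OF measurable_snd measurable_coordinate[of j]] by simp
  then show "(\<lambda>z. encode z n) \<in> (borel \<Otimes>\<^sub>M borel) \<Otimes>\<^sub>M borel \<rightarrow>\<^sub>M borel"
    unfolding encode_def by (auto split: nat.split)
qed

lemma measurable_decode: "decode \<in> borel \<rightarrow>\<^sub>M (borel \<Otimes>\<^sub>M borel) \<Otimes>\<^sub>M borel"
proof -
  have "(\<lambda>z::nat \<Rightarrow> real. \<lambda>n. z (Suc (Suc n))) \<in> borel \<rightarrow>\<^sub>M borel"
    by (rule measurable_sequenceI) (rule measurable_coordinate)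
  then show ?thesis
    unfolding decode_def[abs_def] by (intro measurable_Pair measurable_coordinate)
qed

section \<open>The flow on the space of real sequences\<close>

context label_law
begin

definition coded :: "(nat \<Rightarrow> real) measure" where
  "coded = distr fibred borel encode"

definition coded_flow :: "real \<Rightarrow> (nat \<Rightarrow> real) \<Rightarrow> nat \<Rightarrow> real" where
  "coded_flow t z = encode (fibre_flow t (decode z))"

lemma sets_coded [simp, measurable_cong]: "sets coded = sets borel"
  and space_coded [simp]: "space coded = UNIV"
  by (auto simp: coded_def)

lemma encode_fibred: "encode \<in> fibred \<rightarrow>\<^sub>M coded"
  using measurable_encode measurable_cong_sets[OF sets_fibred sets_coded] by blast

lemma decode_coded: "decode \<in> coded \<rightarrow>\<^sub>M fibred"
  using measurable_decode measurable_cong_sets[OF sets_coded sets_fibred] by blast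

lemma distr_encode: "distr fibred coded encode = coded"
  unfolding coded_def by (rule distr_cong) auto

lemma distr_decode: "distr coded fibred decode = fibred"
proof -
  have "distr coded fibred decode = distr (distr fibred coded encode) fibred decode"
    by (simp only: distr_encode)
  also have "\<dots> = distr fibred fibred (decode \<circ> encode)"
    by (rule distr_distr[OF decode_coded encode_fibred])
  also have "\<dots> = distr fibred fibred id" by (rule distr_cong) auto
  finally show ?thesis by (simp add: id_def)
qed

lemma AE_coded: "AE z in fibred. P z \<Longrightarrow> AE z in coded. P (decode z)"
  using AE_distrD[OF decode_coded, of P] by (simp only: distr_decode)

lemma emeasure_coded: "B \<in> sets borel \<Longrightarrow> emeasure coded B = emeasure fibred (encode -` B)"
  using emeasure_distr[OF encode_fibred, of B] by (simp add: distr_encode)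

lemma sigma_finite_coded: "sigma_finite_measure coded"
proof -
  obtain A where A: "range A \<subseteq> sets fibred" "(\<Union>i. A i) = space fibred" "\<And>i::nat. emeasure fibred (A i) \<noteq> \<infinity>"
    using sigma_finite_measure.sigma_finite[OF sigma_finite_fibred] by blast
  have d: "decode -` A i \<in> sets coded" for i
    using measurable_sets[OF decode_coded, of "A i"] A(1) by auto
  have "encode -` (decode -` A i) = A i" for i by auto
  then have "emeasure coded (decode -` A i) \<noteq> \<infinity>" for i
    using emeasure_coded[of "decode -` A i"] d[of i] A(3)[of i] by simp
  moreover have "\<Union>(range (\<lambda>i. decode -` A i)) = decode -` (\<Union>i. A i)" by auto
  then have "\<Union>(range (\<lambda>i. decode -` A i)) = space coded" by (simp add: A(2))
  ultimately show ?thesis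
    using d by (intro sigma_finite_measure.intro exI[of _ "range (\<lambda>i. decode -` A i)"]) auto
qed

lemma flow_coded: "measure_preserving_flow coded coded_flow"
  unfolding measure_preserving_flow_def
proof (intro conjI allI ballI)
  have "(\<lambda>p. (fst p, decode (snd p))) \<in> borel \<Otimes>\<^sub>M coded \<rightarrow>\<^sub>M borel \<Otimes>\<^sub>M fibred"
    using decode_coded by (intro measurable_Pair measurable_fst measurable_compose[OF measurable_snd])
  from measurable_compose[OF measurable_compose[OF this measurable_fibre_flow_pair] encode_fibred]
  show "(\<lambda>(t, x). coded_flow t x) \<in> borel \<Otimes>\<^sub>M coded \<rightarrow>\<^sub>M coded"
    by (simp add: coded_flow_def case_prod_beta)
  show "coded_flow 0 x = x" for x by (simp add: coded_flow_def)
  show "coded_flow (s + t) x = coded_flow s (coded_flow t x)" for s t x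
    by (simp add: coded_flow_def fibre_flow_add)
  fix t
  have "distr coded coded (coded_flow t) = distr (distr (distr coded fibred decode) fibred (fibre_flow t)) coded encode"
    by (subst distr_distr[OF measurable_fibre_flow decode_coded],
        subst distr_distr[OF encode_fibred measurable_comp[OF decode_coded measurable_fibre_flow]])
      (simp add: comp_def coded_flow_def[abs_def])
  then show "distr coded coded (coded_flow t) = coded"
    by (simp add: distr_decode distr_fibre_flow distr_encode)
qed

lemma zero_type_coded:
  assumes "A \<in> finite_sets coded" "B \<in> finite_sets coded"
  shows "(\<lambda>n. measure coded (A \<inter> (coded_flow (escape_time n) -` B \<inter> space coded))) \<longlonglongrightarrow> 0"
proof (rule zero_type_criterion[OF flow_coded, where G="\<lambda>N. decode -` window N"])
  show "decode -` window N \<in> sets coded" for N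
    using measurable_sets[OF decode_coded window_sets, of N] by simp
  show "incseq (\<lambda>N. decode -` window N)" using window_mono by (auto simp: incseq_def)
  show "AE z in coded. \<exists>N. z \<in> decode -` window N" using AE_coded[OF AE_window] by simp
  fix N
  show "eventually (\<lambda>n. \<forall>z\<in>decode -` window N. coded_flow (escape_time n) z \<notin> decode -` window N) sequentially"
    using eventually_ge_at_top[of "N + 1"] by eventually_elim (simp add: coded_flow_def window_escape)
qed (use assms in auto)

lemma self_similarities_coded:
  "h \<in> self_similarities coded coded_flow \<longleftrightarrow> 0 < h \<and>
    (\<forall>B\<in>sets borel. emeasure k {s. h * s \<in> B} = 0 \<longleftrightarrow> emeasure k B = 0)"
proof
  assume "h \<in> self_similarities coded coded_flow"
  then have h: "h \<noteq> 0" and iso: "flow_isomorphic coded (\<lambda>t. coded_flow (h * t)) coded_flow"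
    by (auto simp: self_similarities_def)
  have "flow_isomorphic fibred (\<lambda>t y. decode (coded_flow (h * t) (encode y))) (\<lambda>t y. decode (coded_flow t (encode y)))"
    by (rule flow_isomorphic_transfer[OF decode_coded encode_fibred _ distr_decode iso]) auto
  then have "flow_isomorphic fibred (\<lambda>t. fibre_flow (h * t)) fibre_flow" by (simp add: coded_flow_def)
  with h show "0 < h \<and> (\<forall>B\<in>sets borel. emeasure k {s. h * s \<in> B} = 0 \<longleftrightarrow> emeasure k B = 0)"
    by (rule equivalent_of_self_similarity)
next
  assume h: "0 < h \<and> (\<forall>B\<in>sets borel. emeasure k {s. h * s \<in> B} = 0 \<longleftrightarrow> emeasure k B = 0)"
  then have iso: "flow_isomorphic fibred (\<lambda>t. fibre_flow (h * t)) fibre_flow"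
    by (intro self_similarity_of_equivalent) auto
  have "flow_isomorphic coded (\<lambda>t y. encode (fibre_flow (h * t) (decode y))) (\<lambda>t y. encode (fibre_flow t (decode y)))"
    by (rule flow_isomorphic_transfer[OF encode_fibred decode_coded _ distr_encode iso]) auto
  then show "h \<in> self_similarities coded coded_flow"
    using h by (simp add: self_similarities_def coded_flow_def[abs_def])
qed

end

theorem theorem0p2:
  fixes \<kappa> :: "real measure"
  assumes "prob_space \<kappa>"
    and "sets \<kappa> = sets (restrict_space borel {0<..})"
  shows "\<exists>(M :: (nat \<Rightarrow> real) measure) T P.
           standard_borel M \<and> sigma_finite_measure M \<and> emeasure M (space M) = \<infinity> \<and>
           measure_preserving_flow M T \<and>
           poisson_law M P \<and>
           weakly_mixing_flow P (suspension M T) \<and>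
           poissonian_self_similarities M T = quasi_invariance_group \<kappa>"
proof -
  interpret \<kappa>: prob_space \<kappa> by fact
  define k where "k = distr \<kappa> borel (\<lambda>s. s)"
  have sp: "space \<kappa> = {0<..}"
    using sets_eq_imp_space_eq[OF assms(2)] by (simp add: space_restrict_space)
  have m: "(\<lambda>s. s) \<in> \<kappa> \<rightarrow>\<^sub>M borel"
    using assms(2) by (intro measurableI) (auto simp: sp sets_restrict_space vimage_def)
  interpret label_law k
  proof (intro label_law.intro label_law_axioms.intro)
    show "prob_space k" unfolding k_def by (rule \<kappa>.prob_space_distr[OF m])
    show "sets k = sets borel" by (simp add: k_def)
    show "AE s in k. 0 < s"
      unfolding k_def by (subst AE_distr_iff[OF m]) (auto simp: sp intro!: AE_I2)
  qed
  have inf: "emeasure coded (space coded) = \<infinity>"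
    using emeasure_coded[of UNIV] emeasure_fibred_UNIV by simp
  obtain P where P: "laplace_law coded P"
    using laplace_law_exists[OF sigma_finite_coded] inf by auto
  interpret mixing_base coded coded_flow P escape_time
    by unfold_locales (use flow_coded P zero_type_coded in auto)
  have "poissonian_self_similarities coded coded_flow = quasi_invariance_group \<kappa>"
    unfolding poissonian_self_similarities_def
    using self_similarities_coded quasi_invariance_group_iff[OF assms(2)] by (auto simp: k_def)
  then show ?thesis
    using standard_borel_polish[OF sets_coded] sigma_finite_coded inf flow_coded
      laplace_law_imp_poisson_law[OF P] weakly_mixing by blast
qed

end
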